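(* Let $K$ be an infinite field, let $s\ge 2$ and $n\geq 1$ be integers, and let $H=([n],E)$ be a forest of complete $s$-uniform hypergraphs. Let $X=(x_{ij})$ be the generic $s\times n$ matrix of variables and $S=K[X]$ with the $\mathbb{Z}^n$-grading $\deg x_{ij}=e_j$. Then the ideal $I_H(s)\subseteq S$ is Cartwright-Sturmfels.
   Context: Notation: $[n]=\{1,\dots,n\}$, $e_j$ is the $j$-th standard basis vector of $\mathbb{Z}^n$, and $\binom{V}{s}$ is the set of $s$-element subsets of $V$. An $s$-uniform hypergraph $H=(V,E)$ consists of a finite vertex set $V$ and a set $E$ of $s$-element subsets of $V$. The complete $s$-uniform hypergraph on $V$ is $(V,\binom{V}{s})$. Forests of complete $s$-uniform hypergraphs are defined recursively: $H=(V,E)$ is a forest of complete $s$-uniform hypergraphs if either $H$ is a complete $s$-uniform hypergraph, or $E=E_1\cup E_2$ where, for some subsets $A,B\subseteq V$: (F1) $E_1\subseteq\binom{A}{s}$ and $E_2=\binom{B}{s}$; (F2) $A\cup B=V$ and $\#(A\cap B)\le 1$; (F3) $(A,E_1)$ is a forest of complete $s$-uniform hypergraphs. For an $s$-uniform hypergraph $H=([n],E)$ and an $m\times n$ generic matrix $X$, $I_H(m)$ is the ideal of $K[X]$ generated by the $s$-minors of $X$ with columns $j_1<\cdots<j_s$ such that $\{j_1,\dots,j_s\}\in E$; here $m=s$. The group $\mathrm{GL}_m(K)^n$ acts on $S=K[X]$ by $\mathbb{Z}^n$-graded automorphisms, the $j$-th factor acting linearly on the span of $x_{1j},\dots,x_{mj}$.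 Borel-fixed ideals are those fixed by the product of the subgroups of upper triangular matrices; a radical monomial ideal $J$ is Borel-fixed if and only if for all monomials $x_{ij}w\in J$ one has $x_{kj}w\in J$ for all $k<i$. The $\mathbb{Z}^n$-graded Hilbert series of a finitely generated $\mathbb{Z}^n$-graded module $M=\bigoplus_{a\in\mathbb{N}^n}M_a$ is $\sum_a(\dim_K M_a)Z^a\in\mathbb{Q}[[Z_1,\dots,Z_n]]$. A $\mathbb{Z}^n$-graded ideal $I$ of $S$ is Cartwright-Sturmfels (CS) if there exists a radical Borel-fixed monomial ideal of $S$ with the same $\mathbb{Z}^n$-graded Hilbert series as $I$. *)

theory Defs
  imports
    "HOL-Library.Poly_Mapping"
    "HOL-Library.Ramsey"
    "HOL-Algebra.Ideal"
    "Jordan_Normal_Form.Determinant"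
begin

section \<open>Forests of complete uniform hypergraphs\<close>

definition uniform_hypergraph :: "nat \<Rightarrow> 'v set \<Rightarrow> 'v set set \<Rightarrow> bool" where
  "uniform_hypergraph s V E \<longleftrightarrow> finite V \<and> E \<subseteq> [V]\<^bsup>s\<^esup>"

text \<open>The conditions (F1), (F2) and (F3) are the three groups of premises of \<open>glue\<close>.\<close>

inductive complete_hypergraph_forest :: "nat \<Rightarrow> 'v set \<Rightarrow> 'v set set \<Rightarrow> bool" for s where
  complete: "finite V \<Longrightarrow> complete_hypergraph_forest s V ([V]\<^bsup>s\<^esup>)"
| glue: "\<lbrakk>finite V; A \<subseteq> V; B \<subseteq> V;
          E1 \<subseteq> [A]\<^bsup>s\<^esup>; E2 = [B]\<^bsup>s\<^esup>;
          A \<union> B = V; card (A \<inter> B) \<le> 1;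
          complete_hypergraph_forest s A E1\<rbrakk>
        \<Longrightarrow> complete_hypergraph_forest s V (E1 \<union> E2)"

lemma complete_hypergraph_forest_imp_uniform:
  "complete_hypergraph_forest s V E \<Longrightarrow> uniform_hypergraph s V E"
  by (induction rule: complete_hypergraph_forest.induct)
    (auto simp: uniform_hypergraph_def nsets_def)


section \<open>The polynomial ring of a generic matrix\<close>

text \<open>
  A variable is a pair \<open>(i, j)\<close> of a row and a column index, both starting at 1. A monomial is
  its exponent vector, and a polynomial is the family of its coefficients, so that the ring
  operations are those of \<^theory>\<open>HOL-Library.Poly_Mapping\<close>. The variables of an \<open>m \<times> n\<close> matrix
  are singled out by the carrier of \<open>mat_ring m n\<close>.
\<close>

type_synonym monomial = "(nat \<times> nat) \<Rightarrow>\<^sub>0 nat"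
type_synonym 'k polynomial = "monomial \<Rightarrow>\<^sub>0 'k"

definition monomials :: "nat \<Rightarrow> nat \<Rightarrow> monomial set" where
  "monomials m n = {t. Poly_Mapping.keys t \<subseteq> {1..m} \<times> {1..n}}"

definition mat_ring :: "nat \<Rightarrow> nat \<Rightarrow> 'k::field polynomial ring" where
  "mat_ring m n =
    \<lparr>carrier = {p. Poly_Mapping.keys p \<subseteq> monomials m n},
     monoid.mult = (*), one = 1, zero = 0, add = (+)\<rparr>"

definition mono_poly :: "monomial \<Rightarrow> 'k::field polynomial" where
  "mono_poly t = Poly_Mapping.single t 1"

definition const_poly :: "'k \<Rightarrow> 'k::field polynomial" where
  "const_poly c = Poly_Mapping.single 0 c"

definition var_poly :: "nat \<Rightarrow> nat \<Rightarrow> 'k::field polynomial" where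
  "var_poly i j = mono_poly (Poly_Mapping.single (i, j) 1)"

lemma monomials_add: "t \<in> monomials m n \<Longrightarrow> u \<in> monomials m n \<Longrightarrow> t + u \<in> monomials m n"
  using Poly_Mapping.keys_add[of t u] by (auto simp: monomials_def)

lemma mat_ring_add_closed:
  "p \<in> carrier (mat_ring m n) \<Longrightarrow> q \<in> carrier (mat_ring m n) \<Longrightarrow> p + q \<in> carrier (mat_ring m n)"
  using Poly_Mapping.keys_add[of p q] by (auto simp: mat_ring_def)

lemma mat_ring_mult_closed:
  "p \<in> carrier (mat_ring m n) \<Longrightarrow> q \<in> carrier (mat_ring m n) \<Longrightarrow> p * q \<in> carrier (mat_ring m n)"
  using Poly_Mapping.keys_mult[of p q] monomials_add by (fastforce simp: mat_ring_def)

lemma mat_ring_uminus_closed: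
  "p \<in> carrier (mat_ring m n) \<Longrightarrow> - p \<in> carrier (mat_ring m n)"
  by (auto simp: mat_ring_def in_keys_iff)

lemma mat_ring_zero_closed: "0 \<in> carrier (mat_ring m n)"
  by (simp add: mat_ring_def)

lemma mat_ring_one_closed: "1 \<in> carrier (mat_ring m n)"
  by (simp add: mat_ring_def monomials_def)

lemma mat_ring_ops [simp]:
  "monoid.mult (mat_ring m n) = (*)" "monoid.one (mat_ring m n) = 1"
  "ring.zero (mat_ring m n) = 0" "ring.add (mat_ring m n) = (+)"
  by (simp_all add: mat_ring_def)

lemma mat_ring_cring: "cring (mat_ring m n :: 'k::field polynomial ring)"
proof (rule cringI)
  show "abelian_group (mat_ring m n :: 'k polynomial ring)"
  proof (rule abelian_groupI)
    fix x :: "'k polynomial"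
    assume "x \<in> carrier (mat_ring m n)"
    then show "\<exists>y\<in>carrier (mat_ring m n). y \<oplus>\<^bsub>mat_ring m n\<^esub> x = \<zero>\<^bsub>mat_ring m n\<^esub>"
      by (intro bexI[of _ "- x"] mat_ring_uminus_closed) simp_all
  qed (simp_all add: mat_ring_add_closed mat_ring_zero_closed add_ac)
  show "comm_monoid (mat_ring m n :: 'k polynomial ring)"
    by (rule comm_monoidI)
      (simp_all add: mat_ring_mult_closed mat_ring_one_closed mult_ac)
qed (simp add: distrib_right)

lemma mat_ring_sum_closed:
  "(\<And>x. x \<in> A \<Longrightarrow> f x \<in> carrier (mat_ring m n)) \<Longrightarrow> sum f A \<in> carrier (mat_ring m n)"
  by (induction A rule: infinite_finite_induct) (auto intro: mat_ring_zero_closed mat_ring_add_closed)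

lemma mat_ring_prod_closed:
  "(\<And>x. x \<in> A \<Longrightarrow> f x \<in> carrier (mat_ring m n)) \<Longrightarrow> prod f A \<in> carrier (mat_ring m n)"
  by (induction A rule: infinite_finite_induct) (auto intro: mat_ring_one_closed mat_ring_mult_closed)

lemma var_poly_closed:
  "i \<in> {1..m} \<Longrightarrow> j \<in> {1..n} \<Longrightarrow> var_poly i j \<in> carrier (mat_ring m n)"
  by (auto simp: var_poly_def mono_poly_def mat_ring_def monomials_def)


section \<open>The ideal of minors attached to a hypergraph\<close>

definition generic_minor :: "nat \<Rightarrow> nat set \<Rightarrow> nat set \<Rightarrow> 'k::field polynomial" where
  "generic_minor s R C =
    det (mat s s (\<lambda>(a, b). var_poly (sorted_list_of_set R ! a) (sorted_list_of_set C ! b)))"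

definition hypergraph_ideal ::
  "nat \<Rightarrow> nat \<Rightarrow> nat \<Rightarrow> nat set set \<Rightarrow> 'k::field polynomial set" where
  "hypergraph_ideal s m n E =
    Idl\<^bsub>mat_ring m n\<^esub> {generic_minor s R C | R C. R \<in> [{1..m}]\<^bsup>s\<^esup> \<and> C \<in> E}"

lemma generic_minor_closed:
  assumes "R \<in> [{1..m}]\<^bsup>s\<^esup>" "C \<in> [{1..n}]\<^bsup>s\<^esup>"
  shows "generic_minor s R C \<in> carrier (mat_ring m n :: 'k::field polynomial ring)"
proof -
  have R: "sorted_list_of_set R ! a \<in> {1..m}" if "a < s" for a
    using assms that nth_mem[of a "sorted_list_of_set R"] by (auto simp: nsets_def)
  have C: "sorted_list_of_set C ! b \<in> {1..n}" if "b < s" for b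
    using assms that nth_mem[of b "sorted_list_of_set C"] by (auto simp: nsets_def)
  have sg: "of_int (sign p) \<in> carrier (mat_ring m n :: 'k polynomial ring)" for p :: "nat \<Rightarrow> nat"
    by (auto simp: sign_def intro: mat_ring_one_closed mat_ring_uminus_closed)
  show ?thesis
    unfolding generic_minor_def det_def
    by (auto simp: permutes_in_image intro!: mat_ring_sum_closed mat_ring_mult_closed sg
        mat_ring_prod_closed var_poly_closed R C mat_ring_one_closed mat_ring_uminus_closed)
qed


section \<open>Multigraded Hilbert series\<close>

text \<open>
  The degree is determined by \<open>deg x\<^sub>i\<^sub>j = e\<^sub>j\<close>. Only degrees with natural entries occur, hence
  the grading group is replaced by its submonoid \<open>nat \<Rightarrow>\<^sub>0 nat\<close>.
\<close>

definition mdeg :: "monomial \<Rightarrow> (nat \<Rightarrow>\<^sub>0 nat)" where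
  "mdeg t = (\<Sum>v\<in>Poly_Mapping.keys t.
    Poly_Mapping.single (snd v) (Poly_Mapping.lookup t v))"

definition hom_component :: "(nat \<Rightarrow>\<^sub>0 nat) \<Rightarrow> 'k::field polynomial \<Rightarrow> 'k polynomial" where
  "hom_component a p = (\<Sum>t\<in>{t \<in> Poly_Mapping.keys p. mdeg t = a}.
    Poly_Mapping.single t (Poly_Mapping.lookup p t))"

definition graded_piece :: "'k::field polynomial set \<Rightarrow> (nat \<Rightarrow>\<^sub>0 nat) \<Rightarrow> 'k polynomial set" where
  "graded_piece M a = {p \<in> M. \<forall>t\<in>Poly_Mapping.keys p. mdeg t = a}"

definition multigraded_ideal :: "nat \<Rightarrow> nat \<Rightarrow> 'k::field polynomial set \<Rightarrow> bool" where
  "multigraded_ideal m n I \<longleftrightarrow>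
    ideal I (mat_ring m n) \<and> (\<forall>p\<in>I. \<forall>a. hom_component a p \<in> I)"

definition poly_scale :: "'k \<Rightarrow> 'k::field polynomial \<Rightarrow> 'k polynomial" where
  "poly_scale c p = const_poly c * p"

lemma poly_scale_vector_space: "vector_space (poly_scale :: 'k::field \<Rightarrow> _)"
  by standard
    (simp_all add: poly_scale_def const_poly_def single_add mult_single algebra_simps
      flip: mult.assoc)

text \<open>
  A power series in \<open>Z\<^sub>1, \<dots>, Z\<^sub>n\<close> is given by its coefficient function. The pieces of an ideal of
  \<open>mat_ring m n\<close> have finite dimension, since there are finitely many monomials of each degree;
  so the convention that \<open>dim\<close> is \<open>0\<close> in infinite dimension plays no role.
\<close>

definition hilbert_series :: "'k::field polynomial set \<Rightarrow> (nat \<Rightarrow>\<^sub>0 nat) \<Rightarrow> rat" where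
  "hilbert_series M = (\<lambda>a. of_nat (vector_space.dim poly_scale (graded_piece M a)))"


section \<open>Borel-fixed ideals and Cartwright-Sturmfels ideals\<close>

definition poly_subst ::
  "(nat \<Rightarrow> nat \<Rightarrow> 'k polynomial) \<Rightarrow> 'k::field polynomial \<Rightarrow> 'k polynomial" where
  "poly_subst \<phi> p = (\<Sum>t\<in>Poly_Mapping.keys p. const_poly (Poly_Mapping.lookup p t) *
    (\<Prod>(i, j)\<in>Poly_Mapping.keys t. \<phi> i j ^ Poly_Mapping.lookup t (i, j)))"

text \<open>
  The family \<open>g\<close> acts by \<open>x\<^sub>i\<^sub>j \<mapsto> \<Sum>\<^sub>k (g\<^sub>j)\<^sub>k\<^sub>i x\<^sub>k\<^sub>j\<close>, i.e. column \<open>i\<close> of \<open>g\<^sub>j\<close> is the image of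
  \<open>x\<^sub>i\<^sub>j\<close>; an upper triangular \<open>g\<^sub>j\<close> therefore sends \<open>x\<^sub>i\<^sub>j\<close> into the span of the \<open>x\<^sub>k\<^sub>j\<close> with
  \<open>k \<le> i\<close>. Matrix entries are indexed from 0.
\<close>

definition gl_action :: "nat \<Rightarrow> (nat \<Rightarrow> 'k mat) \<Rightarrow> 'k::field polynomial \<Rightarrow> 'k polynomial" where
  "gl_action m g =
    poly_subst (\<lambda>i j. \<Sum>k\<in>{1..m}. const_poly (g j $$ (k - 1, i - 1)) * var_poly k j)"

definition borel_group :: "nat \<Rightarrow> nat \<Rightarrow> (nat \<Rightarrow> 'k::field mat) set" where
  "borel_group m n = {g. \<forall>j\<in>{1..n}.
    g j \<in> carrier_mat m m \<and> invertible_mat (g j) \<and> upper_triangular (g j)}"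

definition borel_fixed :: "nat \<Rightarrow> nat \<Rightarrow> 'k::field polynomial set \<Rightarrow> bool" where
  "borel_fixed m n J \<longleftrightarrow> (\<forall>g\<in>borel_group m n. gl_action m g ` J = J)"

definition monomial_ideal :: "nat \<Rightarrow> nat \<Rightarrow> 'k::field polynomial set \<Rightarrow> bool" where
  "monomial_ideal m n J \<longleftrightarrow> (\<exists>T \<subseteq> monomials m n. J = Idl\<^bsub>mat_ring m n\<^esub> (mono_poly ` T))"

definition radical_ideal :: "nat \<Rightarrow> nat \<Rightarrow> 'k::field polynomial set \<Rightarrow> bool" where
  "radical_ideal m n J \<longleftrightarrow> ideal J (mat_ring m n) \<and>
    (\<forall>p\<in>carrier (mat_ring m n). \<forall>k. p ^ k \<in> J \<longrightarrow> p \<in> J)"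

definition cartwright_sturmfels :: "nat \<Rightarrow> nat \<Rightarrow> 'k::field polynomial set \<Rightarrow> bool" where
  "cartwright_sturmfels m n I \<longleftrightarrow> multigraded_ideal m n I \<and>
    (\<exists>J :: 'k polynomial set. monomial_ideal m n J \<and> radical_ideal m n J \<and> borel_fixed m n J \<and>
         hilbert_series J = hilbert_series I)"

end

theory Submission
  imports Defs "HOL-Computational_Algebra.Polynomial"
begin

text \<open>
  Write a column as \<open>x\<^sub>j = \<Sum>\<^sub>i z\<^sub>i\<^sub>j q\<^sub>j\<^sub>i\<close> in a generic basis \<open>q\<^sub>j\<^sub>1, \<dots>, q\<^sub>j\<^sub>s\<close> of its own. A monomial in the \<open>z\<^sub>i\<^sub>j\<close>
  is declared standard by peeling off the complete hypergraphs in the reverse order of the gluing: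
  among the new columns of the last block \<open>B\<close>, at most \<open>s - 1\<close> may contain their pivot \<open>z\<^sub>1\<^sub>j\<close>; if
  exactly \<open>s - 1\<close> do, then these pivots span a hyperplane, the column \<open>v\<close> along which \<open>B\<close> is glued is
  confined to this hyperplane, \<open>z\<^sub>1\<^sub>v\<close> is eliminated, and the next variable becomes the pivot of \<open>v\<close>.
  The nonstandard monomials form a radical Borel-fixed ideal \<open>J\<close>, so it suffices that the standard
  monomials are a basis modulo the ideal of minors. They span because a minor is, up to terms of
  lower degree in the pivots, a multiple of the product of its pivots. For independence, an
  induction over the blocks finds, for every nonzero combination \<open>f\<close> of standard monomials, a point of
  the variety at which \<open>f\<close> does not vanish. The new columns are tilted away from their pivots by
  powers of a small parameter with weights that single out one monomial in the new columns, and its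
  coefficient is a combination of standard monomials in the old columns. If less than \<open>s - 1\<close> pivots
  occur, the hyperplane must contain \<open>x\<^sub>v\<close>, but not the remaining pivots; this can be arranged because
  a linear form of \<open>x\<^sub>v\<close> in general position is a nonzerodivisor in degrees that involve \<open>v\<close>, as
  one sees by counting standard monomials.
\<close>

text \<open>The obstacle is independence. The hyperplane of the last block depends on the tilted
  pivots, so the subspace left to the glued column moves with the small parameter, and a point for
  one fixed frame would be of no use to the induction. What is carried along instead is a section: a
  family of points that is polynomial in the frame and in the scalar and lies on the variety for
  every frame, degenerate ones included; nonvanishing is asked only at the given frame in general
  position. For the same reason elimination in a column is done without division, so that it stays
  polynomial. Spanning and independence are intertwined. When few pivots occur, the choice of the
  hyperplane needs a nonzerodivisor statement for the older blocks; it rests on spanning there, on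
  independence there, which the induction supplies, and on a recursion for the number of standard
  monomials when the subspace of one column loses a dimension. This is why all notions are set up
  for arbitrary codimensions \<open>k\<close>, although the ideal of minors itself is the case
  \<open>k = 0\<close>.\<close>

abbreviation keys :: "('a \<Rightarrow>\<^sub>0 'b::zero) \<Rightarrow> 'a set" where "keys \<equiv> Poly_Mapping.keys"
abbreviation lookup :: "('a \<Rightarrow>\<^sub>0 'b::zero) \<Rightarrow> 'a \<Rightarrow> 'b" where "lookup \<equiv> Poly_Mapping.lookup"
abbreviation single :: "'a \<Rightarrow> 'b::zero \<Rightarrow> ('a \<Rightarrow>\<^sub>0 'b)" where "single \<equiv> Poly_Mapping.single"

section \<open>Evaluation of polynomials\<close>

lemma polynomial_induct [case_names single add]:
  fixes p :: "'k::field polynomial"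
  assumes "\<And>t c. P (single t c)" and "\<And>p q. P p \<Longrightarrow> P q \<Longrightarrow> P (p + q)"
  shows "P p"
proof (induction p rule: Poly_Mapping.update_induct)
  case const
  show ?case using assms(1)[of 0 0] by simp
next
  case (update f a b)
  have "Poly_Mapping.update a b f = f + single a b"
    using update(1) by (intro poly_mapping_eqI)
      (auto simp: lookup_update lookup_add lookup_single in_keys_iff when_def)
  then show ?case using assms update.IH by simp
qed

lemma sum_single: "(\<Sum>t\<in>keys p. single t (lookup p t)) = p"
  by (intro poly_mapping_eqI) (auto simp: lookup_sum lookup_single when_def in_keys_iff)

definition monom_eval :: "(nat \<times> nat \<Rightarrow> 'r::comm_ring_1) \<Rightarrow> monomial \<Rightarrow> 'r" where
  "monom_eval z t = (\<Prod>v\<in>keys t. z v ^ lookup t v)"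

text \<open>The coefficient map \<open>c\<close> lets one evaluation serve three purposes: values at
  points, values along polynomial curves in one parameter, and substitutions within the polynomial
  ring.\<close>

definition poly_eval ::
  "('k \<Rightarrow> 'r) \<Rightarrow> (nat \<times> nat \<Rightarrow> 'r::comm_ring_1) \<Rightarrow> 'k::field polynomial \<Rightarrow> 'r" where
  "poly_eval c z p = (\<Sum>t\<in>keys p. c (lookup p t) * monom_eval z t)"

definition ring_map :: "('a::comm_ring_1 \<Rightarrow> 'b::comm_ring_1) \<Rightarrow> bool" where
  "ring_map f \<longleftrightarrow> f 1 = 1 \<and> (\<forall>x y. f (x + y) = f x + f y) \<and> (\<forall>x y. f (x * y) = f x * f y)"

lemma ring_mapD:
  assumes "ring_map f"
  shows "f 1 = 1" "f (x + y) = f x + f y" "f (x * y) = f x * f y" "f 0 = 0"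
    "f (- x) = - f x" "f (x - y) = f x - f y" "f (x ^ n) = f x ^ n"
proof -
  show 1: "f 1 = 1" and 2: "\<And>x y. f (x + y) = f x + f y" and 3: "\<And>x y. f (x * y) = f x * f y"
    using assms by (auto simp: ring_map_def)
  show 4: "f 0 = 0" using 2[of 0 0] by simp
  show 5: "f (- x) = - f x" for x using 2[of x "- x"] 4 by (simp add: eq_neg_iff_add_eq_0 add.commute)
  show "f (x - y) = f x - f y" using 2[of x "- y"] 5 by simp
  show "f (x ^ n) = f x ^ n" by (induction n) (auto simp: 1 3)
qed

lemma ring_map_sum: "ring_map f \<Longrightarrow> f (sum g A) = (\<Sum>x\<in>A. f (g x))"
  by (induction A rule: infinite_finite_induct) (auto simp: ring_mapD)

lemma ring_map_prod: "ring_map f \<Longrightarrow> f (prod g A) = (\<Prod>x\<in>A. f (g x))"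
  by (induction A rule: infinite_finite_induct) (auto simp: ring_mapD)

lemma ring_map_comp: "ring_map f \<Longrightarrow> ring_map g \<Longrightarrow> ring_map (\<lambda>x. f (g x))"
  by (auto simp: ring_map_def)

lemma ring_map_id: "ring_map (\<lambda>x. x)"
  by (simp add: ring_map_def)

lemma const_poly_ring_map: "ring_map (const_poly :: 'k::field \<Rightarrow> _)"
  by (auto simp: ring_map_def const_poly_def single_add mult_single)

lemma pCons_ring_map: "ring_map (\<lambda>c::'k::field. [:c:])"
  by (auto simp: ring_map_def)

lemma monom_eval_superset:
  assumes "finite A" "keys t \<subseteq> A"
  shows "monom_eval z t = (\<Prod>v\<in>A. z v ^ lookup t v)"
  unfolding monom_eval_def using assms by (intro prod.mono_neutral_left) (auto simp: in_keys_iff)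

lemma monom_eval_0 [simp]: "monom_eval z 0 = 1"
  by (simp add: monom_eval_def)

lemma monom_eval_add: "monom_eval z (t + u) = monom_eval z t * monom_eval z u"
proof -
  let ?A = "keys t \<union> keys u"
  have "monom_eval z (t + u) = (\<Prod>v\<in>?A. z v ^ lookup (t + u) v)"
    using Poly_Mapping.keys_add[of t u] by (intro monom_eval_superset) auto
  also have "\<dots> = (\<Prod>v\<in>?A. z v ^ lookup t v) * (\<Prod>v\<in>?A. z v ^ lookup u v)"
    by (simp add: lookup_add power_add prod.distrib)
  finally show ?thesis
    by (simp add: monom_eval_superset[of ?A t] monom_eval_superset[of ?A u])
qed

lemma monom_eval_single [simp]: "monom_eval z (single v n) = z v ^ n"
  by (simp add: monom_eval_def)

lemma monom_eval_cong:
  "(\<And>v. v \<in> keys t \<Longrightarrow> z v = z' v) \<Longrightarrow> monom_eval z t = monom_eval z' t"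
  by (auto simp: monom_eval_def)

lemma poly_eval_single:
  assumes "ring_map c"
  shows "poly_eval c z (single t a) = c a * monom_eval z t"
  using assms by (simp add: poly_eval_def ring_mapD)

lemma poly_eval_superset:
  assumes "ring_map c" "finite A" "keys p \<subseteq> A"
  shows "poly_eval c z p = (\<Sum>t\<in>A. c (lookup p t) * monom_eval z t)"
  unfolding poly_eval_def using assms
  by (intro sum.mono_neutral_left) (auto simp: in_keys_iff ring_mapD)

lemma poly_eval_add:
  assumes "ring_map c"
  shows "poly_eval c z (p + q) = poly_eval c z p + poly_eval c z q"
proof -
  let ?A = "keys p \<union> keys q"
  have "poly_eval c z (p + q) = (\<Sum>t\<in>?A. c (lookup (p + q) t) * monom_eval z t)"
    using assms Poly_Mapping.keys_add[of p q] by (intro poly_eval_superset) auto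
  also have "\<dots> = (\<Sum>t\<in>?A. c (lookup p t) * monom_eval z t) +
      (\<Sum>t\<in>?A. c (lookup q t) * monom_eval z t)"
    by (simp add: lookup_add ring_mapD[OF assms] algebra_simps sum.distrib)
  finally show ?thesis
    using assms by (simp add: poly_eval_superset[of c ?A p] poly_eval_superset[of c ?A q])
qed

lemma poly_eval_ring_map:
  assumes c: "ring_map c"
  shows "ring_map (poly_eval c z)"
proof -
  have "poly_eval c z (p * q) = poly_eval c z p * poly_eval c z q" for p q
  proof (induction p rule: polynomial_induct)
    case (single t a)
    show ?case
      by (induction q rule: polynomial_induct)
        (auto simp: mult_single poly_eval_single[OF c] poly_eval_add[OF c] monom_eval_add
          ring_mapD[OF c] algebra_simps)
  qed (auto simp: poly_eval_add[OF c] algebra_simps)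
  moreover have "poly_eval c z 1 = 1"
    using poly_eval_single[OF c, of z 0 1] by (simp add: ring_mapD[OF c])
  ultimately show ?thesis
    by (auto simp: ring_map_def poly_eval_add[OF c])
qed

lemma poly_eval_const [simp]: "ring_map c \<Longrightarrow> poly_eval c z (const_poly a) = c a"
  by (simp add: const_poly_def poly_eval_single)

lemma poly_eval_mono [simp]: "ring_map c \<Longrightarrow> poly_eval c z (mono_poly t) = monom_eval z t"
  by (simp add: mono_poly_def poly_eval_single ring_mapD)

lemma poly_eval_var [simp]: "ring_map c \<Longrightarrow> poly_eval c z (var_poly i j) = z (i, j)"
  by (simp add: var_poly_def)

lemma single_eq_const_mono: "single t a = const_poly a * mono_poly t"
  by (simp add: const_poly_def mono_poly_def mult_single)

lemma mono_poly_add: "mono_poly (t + u) = mono_poly t * mono_poly u"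
  by (simp add: mono_poly_def mult_single)

lemma mono_poly_0 [simp]: "mono_poly 0 = 1"
  by (simp add: mono_poly_def)

lemma mono_poly_prod:
  "(mono_poly t :: 'k::field polynomial) = monom_eval (\<lambda>(i, j). var_poly i j) t"
proof (induction t rule: Poly_Mapping.update_induct)
  case const
  then show ?case by simp
next
  case (update f a b)
  have eq: "Poly_Mapping.update a b f = f + single a b"
    using update(1) by (intro poly_mapping_eqI)
      (auto simp: lookup_update lookup_add lookup_single in_keys_iff when_def)
  have "(mono_poly (single a n) :: 'k polynomial) = var_poly (fst a) (snd a) ^ n" for n
  proof (induction n)
    case (Suc n)
    have "single a (Suc n) = single a 1 + single a n"
      by (metis plus_1_eq_Suc single_add)
    then show ?case using Suc by (simp add: mono_poly_add var_poly_def)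
  qed auto
  then show ?case
    using update.IH by (simp add: eq mono_poly_add monom_eval_add case_prod_unfold)
qed

lemma ring_map_eq_poly_eval:
  assumes F: "ring_map F"
  shows "F p = poly_eval (\<lambda>a. F (const_poly a)) (\<lambda>(i, j). F (var_poly i j)) p"
proof (induction p rule: polynomial_induct)
  case (single t a)
  have c: "ring_map (\<lambda>a. F (const_poly a))"
    by (rule ring_map_comp[OF F const_poly_ring_map])
  have "F (mono_poly t) = monom_eval (\<lambda>(i, j). F (var_poly i j)) t"
    unfolding mono_poly_prod monom_eval_def
    by (simp add: ring_map_prod[OF F] ring_mapD[OF F] case_prod_unfold)
  then show ?case
    unfolding poly_eval_single[OF c] by (simp add: single_eq_const_mono ring_mapD[OF F])
next
  case (add p q)
  have c: "ring_map (\<lambda>a. F (const_poly a))"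
    by (rule ring_map_comp[OF F const_poly_ring_map])
  show ?case using add by (simp add: ring_mapD[OF F] poly_eval_add[OF c])
qed

lemma ring_map_eqI:
  assumes "ring_map F" "ring_map G" "\<And>a. F (const_poly a) = G (const_poly a)"
    and "\<And>i j. F (var_poly i j) = G (var_poly i j)"
  shows "F p = G p"
  using ring_map_eq_poly_eval[OF assms(1), of p] ring_map_eq_poly_eval[OF assms(2), of p]
  unfolding assms(3,4) by simp

lemma poly_eval_cong:
  assumes "\<And>t v. t \<in> keys p \<Longrightarrow> v \<in> keys t \<Longrightarrow> z v = z' v"
  shows "poly_eval c z p = poly_eval c z' p"
  unfolding poly_eval_def using assms by (intro sum.cong refl arg_cong2[of _ _ _ _ "(*)"] monom_eval_cong) auto

lemma poly_subst_eq_poly_eval: "poly_subst \<phi> p = poly_eval const_poly (\<lambda>(i, j). \<phi> i j) p"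
  by (simp add: poly_subst_def poly_eval_def monom_eval_def case_prod_unfold)

lemma poly_subst_ring_map: "ring_map (poly_subst \<phi>)"
  unfolding poly_subst_eq_poly_eval[abs_def] by (rule poly_eval_ring_map[OF const_poly_ring_map])

lemma poly_subst_simps [simp]:
  "poly_subst \<phi> (const_poly a) = const_poly a" "poly_subst \<phi> (var_poly i j) = \<phi> i j"
  by (simp_all add: poly_subst_eq_poly_eval const_poly_ring_map)

lemma poly_subst_var: "poly_subst var_poly p = p"
  using ring_map_eqI[OF poly_subst_ring_map[of var_poly] ring_map_id] by simp

lemma const_poly_simps [simp]: "const_poly 0 = 0" "const_poly 1 = 1"
  by (simp_all add: const_poly_def)

lemma lookup_const_mult [simp]:
  "lookup (const_poly a * p) t = a * lookup p t"
  by (simp add: const_poly_def mult_map_scale_conv_mult[symmetric] Poly_Mapping.map.rep_eq when_def)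

lemma keys_const_mult: "keys (const_poly a * p) \<subseteq> keys p"
  by (auto simp: in_keys_iff)

lemma keys_mono_mult: "keys (mono_poly t * p) \<subseteq> (\<lambda>u. t + u) ` keys p"
  using Poly_Mapping.keys_mult[of "mono_poly t" p] by (auto simp: mono_poly_def split: if_splits)

lemma keys_sum_subset:
  "(\<And>x. x \<in> A \<Longrightarrow> keys (f x) \<subseteq> S) \<Longrightarrow> keys (sum f A) \<subseteq> S"
proof (induction A rule: infinite_finite_induct)
  case (insert x A)
  then show ?case using Poly_Mapping.keys_add[of "f x" "sum f A"] by (auto; blast)
qed auto


section \<open>Multigraded components\<close>

lemma mdeg_superset:
  assumes "finite A" "keys t \<subseteq> A"
  shows "mdeg t = (\<Sum>v\<in>A. single (snd v) (lookup t v))"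
  unfolding mdeg_def using assms by (intro sum.mono_neutral_left) (auto simp: in_keys_iff)

lemma mdeg_0 [simp]: "mdeg 0 = 0"
  by (simp add: mdeg_def)

lemma mdeg_single [simp]: "mdeg (single v n) = single (snd v) n"
  by (simp add: mdeg_def)

lemma mdeg_add: "mdeg (t + u) = mdeg t + mdeg u"
proof -
  let ?A = "keys t \<union> keys u"
  have "mdeg (t + u) = (\<Sum>v\<in>?A. single (snd v) (lookup (t + u) v))"
    using Poly_Mapping.keys_add[of t u] by (intro mdeg_superset) auto
  then show ?thesis
    by (simp add: mdeg_superset[of ?A t] mdeg_superset[of ?A u] lookup_add single_add sum.distrib)
qed

lemma lookup_mdeg:
  "lookup (mdeg t) j =
    (\<Sum>v\<in>{v \<in> keys t. snd v = j}. lookup t v)"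
  by (simp add: mdeg_def lookup_sum lookup_single when_def sum.inter_filter)

lemma keys_mdeg: "keys (mdeg t) = snd ` keys t"
proof (rule Set.set_eqI)
  fix j
  have "lookup (mdeg t) j = 0 \<longleftrightarrow> j \<notin> snd ` keys t"
    unfolding lookup_mdeg by (subst sum_eq_0_iff) (auto simp: in_keys_iff image_iff Bex_def)
  then show "j \<in> keys (mdeg t) \<longleftrightarrow> j \<in> snd ` keys t"
    by (simp add: in_keys_iff[of _ "mdeg t"])
qed

definition homog :: "(nat \<Rightarrow>\<^sub>0 nat) \<Rightarrow> 'k::field polynomial \<Rightarrow> bool" where
  "homog a p \<longleftrightarrow> (\<forall>t\<in>keys p. mdeg t = a)"

lemma homog_0 [simp]: "homog a 0"
  by (simp add: homog_def)

lemma homog_add: "homog a p \<Longrightarrow> homog a q \<Longrightarrow> homog a (p + q)"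
  using Poly_Mapping.keys_add[of p q] by (auto simp: homog_def)

lemma homog_uminus: "homog a p \<Longrightarrow> homog a (- p)"
  by (auto simp: homog_def in_keys_iff)

lemma homog_diff: "homog a p \<Longrightarrow> homog a q \<Longrightarrow> homog a (p - q)"
  using homog_add[of a p "- q"] homog_uminus[of a q] by simp

lemma homog_sum: "(\<And>x. x \<in> A \<Longrightarrow> homog a (f x)) \<Longrightarrow> homog a (sum f A)"
  by (induction A rule: infinite_finite_induct) (auto intro: homog_add)

lemma homog_mult: "homog a p \<Longrightarrow> homog b q \<Longrightarrow> homog (a + b) (p * q)"
  using Poly_Mapping.keys_mult[of p q] by (fastforce simp: homog_def mdeg_add)

lemma homog_const [simp]: "homog 0 (const_poly c)"
  by (simp add: homog_def const_poly_def)

lemma homog_const_mult: "homog a p \<Longrightarrow> homog a (const_poly c * p)"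
  using homog_mult[of 0 "const_poly c" a p] by simp

lemma homog_mono [simp]: "homog a (mono_poly t :: 'k::field polynomial) \<longleftrightarrow> mdeg t = a"
  by (simp add: homog_def mono_poly_def)

lemma homog_var: "homog (single j 1) (var_poly i j)"
  by (simp add: var_poly_def)

lemma homog_prod:
  "(\<And>x. x \<in> A \<Longrightarrow> homog (a x) (f x)) \<Longrightarrow> homog (sum a A) (prod f A)"
proof (induction A rule: infinite_finite_induct)
  case (insert x A)
  then show ?case by (auto intro: homog_mult)
qed (auto simp: homog_def)

lemma lookup_hom_component:
  "lookup (hom_component a p) t = (if mdeg t = a then lookup p t else 0)"
  by (auto simp: hom_component_def lookup_sum lookup_single when_def in_keys_iff)

lemma hom_component_add: "hom_component a (p + q) = hom_component a p + hom_component a q"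
  by (intro poly_mapping_eqI) (simp add: lookup_hom_component lookup_add)

lemma hom_component_diff: "hom_component a (p - q) = hom_component a p - hom_component a q"
  by (intro poly_mapping_eqI) (simp add: lookup_hom_component lookup_minus)

lemma hom_component_0 [simp]: "hom_component a 0 = 0"
  by (intro poly_mapping_eqI) (simp add: lookup_hom_component)

lemma keys_hom_component: "keys (hom_component a p) = {t \<in> keys p. mdeg t = a}"
  by (auto simp: in_keys_iff lookup_hom_component split: if_splits)

lemma hom_component_homog [simp]: "homog a (hom_component a p)"
  by (auto simp: homog_def keys_hom_component)

lemma hom_component_of_homog: "homog b p \<Longrightarrow> hom_component a p = (if a = b then p else 0)"
  by (intro poly_mapping_eqI) (auto simp: lookup_hom_component homog_def in_keys_iff)

lemma hom_component_mult_homog: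
  assumes "homog b q"
  shows "hom_component (a + b) (p * q) = hom_component a p * q"
proof (induction p rule: polynomial_induct)
  case (single t c)
  have 1: "homog (mdeg t) (single t c)"
    by (simp add: homog_def)
  show ?case
    using hom_component_of_homog[OF 1] hom_component_of_homog[OF homog_mult[OF 1 assms]] by auto
qed (simp add: hom_component_add algebra_simps)

lemma homog_eq_sum:
  "homog a p \<Longrightarrow> p = (\<Sum>t\<in>keys p. const_poly (lookup p t) * mono_poly t)"
  using sum_single[of p] by (simp add: single_eq_const_mono)


section \<open>Ideals of the full polynomial ring\<close>

text \<open>A commutative ring is a module over itself, and its submodules are its ideals; thus
  \<open>span\<close> is the generated ideal. For polynomials this is an ideal in all variables,
  compared with ideals of \<open>mat_ring\<close> only at the end.\<close>

interpretation poly_module: Modules.module "(*) :: 'a::comm_ring_1 \<Rightarrow> 'a \<Rightarrow> 'a"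
  by standard (auto simp: algebra_simps)

text \<open>This rule would loop with \<open>mult.assoc\<close>.\<close>

declare poly_module.scale_scale [simp del]

abbreviation gen_ideal :: "'a::comm_ring_1 set \<Rightarrow> 'a set" where
  "gen_ideal \<equiv> poly_module.span"

lemma gen_ideal_mult: "x \<in> gen_ideal G \<Longrightarrow> r * x \<in> gen_ideal G"
  by (rule poly_module.span_scale)

lemma gen_ideal_image:
  assumes "ring_map F" "\<And>g. g \<in> G \<Longrightarrow> F g \<in> gen_ideal H" "x \<in> gen_ideal G"
  shows "F x \<in> gen_ideal H"
  using assms(3)
proof (induction rule: poly_module.span_induct_alt)
  case base
  then show ?case by (simp add: ring_mapD[OF assms(1)] poly_module.span_zero)
next
  case (step c x y)
  then show ?case
    by (simp add: ring_mapD[OF assms(1)] poly_module.span_add assms(2) gen_ideal_mult)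
qed

lemma gen_ideal_insert:
  assumes "x \<in> gen_ideal (insert g G)"
  obtains r where "x - r * g \<in> gen_ideal G"
  using poly_module.span_breakdown_eq[of x g G] assms by auto

lemma hom_component_gen_ideal:
  assumes G: "\<And>g. g \<in> G \<Longrightarrow> \<exists>b. homog b g" and x: "x \<in> gen_ideal G"
  shows "hom_component a x \<in> gen_ideal G"
  using x
proof (induction rule: poly_module.span_induct_alt)
  case base
  then show ?case by (simp add: poly_module.span_zero)
next
  case (step c g y)
  obtain b where b: "homog b g" using G step by blast
  have "hom_component a (c * g) \<in> gen_ideal G"
  proof (induction c rule: polynomial_induct)
    case (single t u)
    have "homog (mdeg t + b) (single t u * g)"
      by (rule homog_mult[OF _ b]) (simp add: homog_def)
    then show ?case
      using poly_module.span_scale[OF poly_module.span_base[OF step(1)]]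
      by (auto simp: hom_component_of_homog poly_module.span_zero)
  qed (simp add: hom_component_add poly_module.span_add algebra_simps)
  then show ?case using step by (simp add: hom_component_add poly_module.span_add)
qed

section \<open>Determinants of lists of vectors\<close>

definition vdet :: "(nat \<Rightarrow> 'a::comm_ring_1) list \<Rightarrow> 'a" where
  "vdet xs = det (mat (length xs) (length xs) (\<lambda>(b, a). (xs ! b) a))"

lemma vdet_Leibniz:
  "length xs = n \<Longrightarrow> vdet xs =
    (\<Sum>p\<in>{p. p permutes {0..<n}}. signof p * (\<Prod>b = 0..<n. (xs ! b) (p b)))"
  unfolding vdet_def
  by (subst det_def'[of _ n]) (auto intro!: sum.cong prod.cong simp: permutes_in_image)

lemma vdet_cong:
  assumes "length xs = length ys"
    and "\<And>b a. b < length xs \<Longrightarrow> a < length xs \<Longrightarrow> (xs ! b) a = (ys ! b) a"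
  shows "vdet xs = vdet ys"
  unfolding vdet_def using assms by (intro arg_cong[of _ _ det] eq_matI) auto

lemma ring_map_signof: "ring_map F \<Longrightarrow> F (signof p) = signof p"
  by (auto simp: sign_def ring_mapD)

lemma ring_map_vdet: "ring_map F \<Longrightarrow> F (vdet xs) = vdet (map (\<lambda>x a. F (x a)) xs)"
  by (simp add: vdet_Leibniz[OF refl] ring_map_sum ring_mapD(3) ring_map_signof ring_map_prod)

text \<open>Multilinearity in all rows at once: a function in the \<open>PiE\<close> set chooses one
  summand in each row.\<close>

lemma vdet_expand:
  fixes n :: nat
  assumes "\<And>b. b < n \<Longrightarrow> finite (I b)"
  shows "vdet (map (\<lambda>b l. \<Sum>i\<in>I b. c b i * y b i l) [0..<n]) =
    (\<Sum>f\<in>PiE {0..<n} I. (\<Prod>b = 0..<n. c b (f b)) * vdet (map (\<lambda>b. y b (f b)) [0..<n]))"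
proof -
  let ?P = "{p. p permutes {0..<n}}"
  have "vdet (map (\<lambda>b l. \<Sum>i\<in>I b. c b i * y b i l) [0..<n]) =
      (\<Sum>p\<in>?P. signof p * (\<Prod>b = 0..<n. \<Sum>i\<in>I b. c b i * y b i (p b)))"
    by (simp add: vdet_Leibniz[of _ n])
  also have "\<dots> = (\<Sum>p\<in>?P. \<Sum>f\<in>PiE {0..<n} I. signof p * (\<Prod>b = 0..<n. c b (f b) * y b (f b) (p b)))"
    using assms by (intro sum.cong refl) (subst prod_sum_PiE, auto simp: sum_distrib_left)
  also have "\<dots> = (\<Sum>f\<in>PiE {0..<n} I. \<Sum>p\<in>?P. signof p * (\<Prod>b = 0..<n. c b (f b) * y b (f b) (p b)))"
    by (rule sum.swap)
  also have "\<dots> = (\<Sum>f\<in>PiE {0..<n} I. (\<Prod>b = 0..<n. c b (f b)) * vdet (map (\<lambda>b. y b (f b)) [0..<n]))"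
    by (intro sum.cong refl)
      (simp add: vdet_Leibniz[of _ n] sum_distrib_left prod.distrib mult_ac)
  finally show ?thesis .
qed

lemma vdet_snoc_sum:
  assumes "finite I"
  shows "vdet (us @ [\<lambda>l. \<Sum>i\<in>I. c i * y i l]) = (\<Sum>i\<in>I. c i * vdet (us @ [y i]))"
proof -
  let ?m = "length us"
  let ?P = "{p. p permutes {0..<Suc ?m}}"
  have L: "vdet (us @ [x]) = (\<Sum>p\<in>?P. signof p * (\<Prod>b = 0..<?m. (us ! b) (p b)) * x (p ?m))" for x
    by (subst vdet_Leibniz[of _ "Suc ?m"]) (auto intro!: sum.cong simp: nth_append mult.assoc)
  show ?thesis
    unfolding L sum_distrib_left by (subst sum.swap) (simp add: sum_distrib_left mult_ac)
qed

lemma vdet_cofactor_snoc: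
  "vdet (us @ [x]) = (\<Sum>l<Suc (length us). x l * vdet (us @ [\<lambda>a. if a = l then 1 else 0]))"
proof -
  have "vdet (us @ [x]) = vdet (us @ [\<lambda>a. \<Sum>l<Suc (length us). x l * (if a = l then 1 else 0)])"
    by (rule vdet_cong) (auto simp: nth_append if_distrib cong: if_cong)
  then show ?thesis by (subst (asm) vdet_snoc_sum) auto
qed

lemma vdet_eq_0_if_eq:
  assumes "i < length xs" "j < length xs" "i \<noteq> j" "xs ! i = xs ! j"
  shows "vdet xs = 0"
  unfolding vdet_def
  by (rule det_identical_rows[of _ "length xs" i j]) (use assms in \<open>auto intro!: eq_vecI\<close>)

lemma vdet_snoc_mem:
  assumes "x \<in> set us"
  shows "vdet (us @ [x]) = 0"
proof -
  obtain i where i: "i < length us" "us ! i = x" using assms by (auto simp: in_set_conv_nth)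
  then show ?thesis by (intro vdet_eq_0_if_eq[of i _ "length us"]) (auto simp: nth_append)
qed

lemma vdet_mset:
  assumes "mset xs = mset ys"
  shows "vdet xs = vdet ys \<or> vdet xs = - vdet ys"
proof -
  let ?n = "length ys"
  obtain p where p: "p permutes {..<?n}" "permute_list p ys = xs"
    using mset_eq_permutation[OF assms] by blast
  have len: "length xs = ?n" using assms mset_eq_length by blast
  let ?A = "mat ?n ?n (\<lambda>(b, a). (ys ! b) a)"
  have p0: "p permutes {0..<?n}" using p(1) by (simp add: lessThan_atLeast0)
  have plt: "b < ?n \<Longrightarrow> p b < ?n" for b
    using permutes_in_image[OF p(1), of b] by auto
  have "vdet xs = det (mat ?n ?n (\<lambda>(i, j). ?A $$ (p i, j)))"
    unfolding vdet_def len using p len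
    by (intro arg_cong[of _ _ det] eq_matI) (auto simp: permute_list_nth plt)
  also have "\<dots> = signof p * vdet ys"
    by (subst det_permute_rows[OF _ p0]) (auto simp: vdet_def)
  finally show ?thesis by (cases "sign p = 1") (auto simp: sign_def split: if_splits)
qed

section \<open>Hyperplanes and vanishing determinants\<close>

definition dot :: "nat \<Rightarrow> (nat \<Rightarrow> 'a::comm_ring_1) \<Rightarrow> (nat \<Rightarrow> 'a) \<Rightarrow> 'a" where
  "dot n h x = (\<Sum>l<n. h l * x l)"

lemma dot_sum: "dot n h (\<lambda>l. \<Sum>i\<in>I. c i * y i l) = (\<Sum>i\<in>I. c i * dot n h (y i))"
  unfolding dot_def sum_distrib_left by (subst sum.swap) (simp add: mult_ac)

text \<open>The geometric form in which minors are made to vanish later: the vectors lie on a common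
  hyperplane with normal vector \<open>h\<close>.\<close>

lemma vdet_eq_0_iff:
  fixes xs :: "(nat \<Rightarrow> 'a::field) list"
  assumes n: "length xs = n"
  shows "vdet xs = 0 \<longleftrightarrow> (\<exists>h. (\<exists>l<n. h l \<noteq> 0) \<and> (\<forall>x\<in>set xs. dot n h x = 0))"
proof -
  let ?A = "mat n n (\<lambda>(b, a). (xs ! b) a)"
  have mv: "?A *\<^sub>v v = 0\<^sub>v n \<longleftrightarrow> (\<forall>x\<in>set xs. dot n (vec_index v) x = 0)" if v: "v \<in> carrier_vec n" for v
  proof -
    have "?A *\<^sub>v v = 0\<^sub>v n \<longleftrightarrow> (\<forall>b<n. dot n (vec_index v) (xs ! b) = 0)"
      using v by (auto simp: vec_eq_iff scalar_prod_def dot_def lessThan_atLeast0 mult.commute)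
    then show ?thesis using n by (auto simp: set_conv_nth)
  qed
  have "vdet xs = 0 \<longleftrightarrow> (\<exists>v. v \<in> carrier_vec n \<and> v \<noteq> 0\<^sub>v n \<and> ?A *\<^sub>v v = 0\<^sub>v n)"
    unfolding vdet_def n by (rule det_0_iff_vec_prod_zero_field) auto
  also have "\<dots> \<longleftrightarrow> (\<exists>h. (\<exists>l<n. h l \<noteq> 0) \<and> (\<forall>x\<in>set xs. dot n h x = 0))" (is "?L = ?R")
  proof
    assume ?L
    then obtain v where v: "v \<in> carrier_vec n" "v \<noteq> 0\<^sub>v n" "?A *\<^sub>v v = 0\<^sub>v n" by blast
    then show ?R using mv[OF v(1)] by (intro exI[of _ "vec_index v"]) (auto simp: vec_eq_iff)
  next
    assume ?R
    then obtain h l where h: "l < n" "h l \<noteq> 0" "\<forall>x\<in>set xs. dot n h x = 0" by blast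
    have "dot n (vec_index (vec n h)) x = dot n h x" for x :: "nat \<Rightarrow> 'a"
      by (simp add: dot_def)
    then show ?L using h mv[of "vec n h"] by (intro exI[of _ "vec n h"]) (auto simp: vec_eq_iff)
  qed
  finally show ?thesis .
qed

lemma vdet_zero_vector:
  assumes "x \<in> set xs" "\<And>a. a < length xs \<Longrightarrow> x a = 0"
  shows "vdet xs = 0"
proof -
  obtain b where b: "b < length xs" "xs ! b = x" using assms(1) by (auto simp: in_set_conv_nth)
  have "(\<Prod>i = 0..<length xs. (xs ! i) (p i)) = 0" if "p permutes {0..<length xs}" for p
    using b assms(2)[of "p b"] permutes_in_image[OF that, of b]
    by (intro prod_zero) (auto intro!: bexI[of _ b])
  then show ?thesis by (simp add: vdet_Leibniz[OF refl])
qed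

lemma ex_orthogonal:
  fixes Y :: "(nat \<Rightarrow> 'a::field) list"
  assumes "length Y < n"
  obtains h l where "l < n" "h l \<noteq> 0" "\<forall>y\<in>set Y. dot n h y = 0"
proof -
  \<comment> \<open>Padding with zero vectors makes the system square and singular.\<close>
  let ?xs = "Y @ replicate (n - length Y) (\<lambda>_. 0)"
  have "vdet ?xs = 0"
    by (rule vdet_zero_vector[of "\<lambda>_. 0"]) (use assms in auto)
  moreover have "length ?xs = n" using assms by simp
  ultimately show ?thesis using that vdet_eq_0_iff[of ?xs n] by auto
qed

text \<open>The vectors \<open>h l * e_j - h j * e_l\<close> with \<open>j\<close> different from
  \<open>l\<close> span the hyperplane, and \<open>e_l\<close> lies outside of it.\<close>

lemma ex_hyperplane_basis:
  fixes h :: "nat \<Rightarrow> 'a::field"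
  assumes l: "l < n" "h l \<noteq> 0"
  obtains us w where "length us = n - 1" "vdet (us @ [w]) \<noteq> 0"
    "\<And>x. dot n h x = 0 \<Longrightarrow> vdet (us @ [x]) = 0"
proof -
  define u where "u j = (\<lambda>m. if m = j then h l else if m = l then - h j else 0)" for j
  define us where "us = map u (filter (\<lambda>j. j \<noteq> l) [0..<n])"
  define w where "w = (\<lambda>m. if m = l then 1 else 0 :: 'a)"
  have dot_u: "dot n g (u j) = g j * h l - g l * h j" if "j \<noteq> l" "j < n" for g j
  proof -
    have "dot n g (u j) = (\<Sum>m\<in>{j, l}. g m * u j m)"
      unfolding dot_def using that l by (intro sum.mono_neutral_right) (auto simp: u_def)
    then show ?thesis using that by (simp add: u_def)
  qed
  have "card {j. j < n \<and> j \<noteq> l} = n - 1"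
  proof -
    have "{j. j < n \<and> j \<noteq> l} = {..<n} - {l}" by auto
    then show ?thesis using l by simp
  qed
  then have len: "length us = n - 1"
    by (simp add: us_def length_filter_conv_card cong: conj_cong)
  show ?thesis
  proof (rule that[OF len])
    have "\<not> (\<exists>g. (\<exists>j<n. g j \<noteq> 0) \<and> (\<forall>x\<in>set (us @ [w]). dot n g x = 0))"
    proof
      assume "\<exists>g. (\<exists>j<n. g j \<noteq> 0) \<and> (\<forall>x\<in>set (us @ [w]). dot n g x = 0)"
      then obtain g j where g: "j < n" "g j \<noteq> 0" "\<And>x. x \<in> set us \<Longrightarrow> dot n g x = 0" "dot n g w = 0"
        by auto
      have "dot n g w = g l" using l by (simp add: dot_def w_def if_distrib cong: if_cong)
      then have "j \<noteq> l" "g l = 0" using g by auto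
      moreover have "dot n g (u j) = 0" using g \<open>j \<noteq> l\<close> by (intro g(3)) (auto simp: us_def)
      ultimately show False using dot_u[of j g] g l by auto
    qed
    then show "vdet (us @ [w]) \<noteq> 0"
      using vdet_eq_0_iff[of "us @ [w]" n] len l by auto
    fix x :: "nat \<Rightarrow> 'a" assume "dot n h x = 0"
    then have "\<forall>y\<in>set (us @ [x]). dot n h y = 0" by (auto simp: us_def dot_u)
    then show "vdet (us @ [x]) = 0"
      using vdet_eq_0_iff[of "us @ [x]" n] len l by auto
  qed
qed


section \<open>Polynomial functions of the coordinate vectors\<close>

text \<open>
  A parameter consists of a vector \<open>q j i\<close> for each column \<open>j\<close> and each index \<open>i\<close>, and of one more
  scalar. A function is called regular if it is polynomial along all polynomial curves; this
  replaces polynomials in infinitely many parameters and is evidently stable under composition.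
\<close>

type_synonym 'k frame = "nat \<Rightarrow> nat \<Rightarrow> nat \<Rightarrow> 'k"
type_synonym 'k param = "'k frame \<times> 'k"

definition regular :: "('k::field param \<Rightarrow> 'k) \<Rightarrow> bool" where
  "regular f \<longleftrightarrow> (\<forall>g e. \<exists>p. \<forall>t. f (\<lambda>j i l. poly (g j i l) t, poly e t) = poly p t)"

lemma regular_curve:
  assumes "regular f"
  obtains p where "\<And>t. f (\<lambda>j i l. poly (g j i l) t, poly e t) = poly p t"
  using assms unfolding regular_def by blast

lemma regular_const [simp]: "regular (\<lambda>_. c)"
  unfolding regular_def by (auto intro!: exI[of _ "[:c:]"])

lemma regular_coord [simp]: "regular (\<lambda>x. fst x j i l)"
  unfolding regular_def by auto

lemma regular_snd [simp]: "regular snd"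
  unfolding regular_def by auto

lemma regular_add: "regular f \<Longrightarrow> regular g \<Longrightarrow> regular (\<lambda>x. f x + g x)"
  unfolding regular_def by (metis poly_add)

lemma regular_mult: "regular f \<Longrightarrow> regular g \<Longrightarrow> regular (\<lambda>x. f x * g x)"
  unfolding regular_def by (metis poly_mult)

lemma regular_uminus: "regular f \<Longrightarrow> regular (\<lambda>x. - f x)"
  unfolding regular_def by (metis poly_minus)

lemma regular_diff: "regular f \<Longrightarrow> regular g \<Longrightarrow> regular (\<lambda>x. f x - g x)"
  using regular_add[of f "\<lambda>x. - g x"] regular_uminus[of g] by simp

lemma regular_sum: "(\<And>i. i \<in> A \<Longrightarrow> regular (f i)) \<Longrightarrow> regular (\<lambda>x. \<Sum>i\<in>A. f i x)"
  by (induction A rule: infinite_finite_induct) (auto intro: regular_add)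

lemma regular_prod: "(\<And>i. i \<in> A \<Longrightarrow> regular (f i)) \<Longrightarrow> regular (\<lambda>x. \<Prod>i\<in>A. f i x)"
  by (induction A rule: infinite_finite_induct) (auto intro: regular_mult)

lemma regular_power: "regular f \<Longrightarrow> regular (\<lambda>x. f x ^ n)"
  by (induction n) (auto intro: regular_mult)

lemma regular_if: "regular f \<Longrightarrow> regular g \<Longrightarrow> regular (\<lambda>x. if b then f x else g x)"
  by (cases b) auto

lemma regular_vdet:
  assumes "\<And>f a. f \<in> set fs \<Longrightarrow> regular (\<lambda>x. f x a)"
  shows "regular (\<lambda>x. vdet (map (\<lambda>f. f x) fs))"
proof -
  have "regular (\<lambda>x. (\<Sum>p\<in>{p. p permutes {0..<length fs}}.
      signof p * (\<Prod>b = 0..<length fs. (fs ! b) x (p b))))"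
    using assms by (intro regular_sum regular_mult regular_prod regular_const) auto
  moreover have "vdet (map (\<lambda>f. f x) fs) = (\<Sum>p\<in>{p. p permutes {0..<length fs}}.
      signof p * (\<Prod>b = 0..<length fs. (fs ! b) x (p b)))" for x
    by (simp add: vdet_Leibniz[of _ "length fs"])
  ultimately show ?thesis by simp
qed

text \<open>Composition is what the notion is made for: sections and genericity conditions of the
  older blocks are evaluated at an eliminated frame, which itself depends on the parameters.\<close>

lemma regular_comp:
  assumes f: "regular f" and Q: "\<And>j i l. regular (\<lambda>x. Q x j i l)" and E: "regular E"
  shows "regular (\<lambda>x. f (Q x, E x))"
  unfolding regular_def
proof (intro allI)
  fix g :: "nat \<Rightarrow> nat \<Rightarrow> nat \<Rightarrow> 'a poly" and e :: "'a poly"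
  let ?c = "\<lambda>t. (\<lambda>j i l. poly (g j i l) t, poly e t)"
  have "\<forall>j i l. \<exists>p. \<forall>t. Q (?c t) j i l = poly p t"
    using Q unfolding regular_def by blast
  then obtain g' where g': "\<And>j i l t. Q (?c t) j i l = poly (g' j i l) t" by metis
  obtain e' where e': "\<And>t. E (?c t) = poly e' t" using E unfolding regular_def by blast
  have Qeq: "Q (?c t) = (\<lambda>j i l. poly (g' j i l) t)" for t
    by (intro ext) (simp add: g')
  obtain p where "\<And>t. f (\<lambda>j i l. poly (g' j i l) t, poly e' t) = poly p t"
    using regular_curve[OF f, of g' e'] by blast
  then show "\<exists>p. \<forall>t. f (Q (?c t), E (?c t)) = poly p t"
    by (auto simp: Qeq e')
qed

lemma regular_fix_snd: "regular f \<Longrightarrow> regular (\<lambda>x. f (fst x, c))"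
  using regular_comp[of f fst "\<lambda>_. c"] by simp

lemma poly_nonroot:
  fixes p :: "'k::field poly"
  assumes "infinite (UNIV :: 'k set)" "p \<noteq> 0"
  obtains t where "poly p t \<noteq> 0"
proof -
  have "finite {t. poly p t = 0}" using assms(2) by (rule poly_roots_finite)
  then have "{t. poly p t = 0} \<noteq> UNIV" using assms(1) by auto
  then show ?thesis using that by auto
qed

text \<open>Stands for a nonempty principal open set in the space of frames, which has infinitely
  many coordinates. The scalar parameter is frozen at \<open>0\<close>.\<close>

definition generic :: "('k::field frame \<Rightarrow> bool) \<Rightarrow> bool" where
  "generic P \<longleftrightarrow> (\<exists>f. regular f \<and> (\<exists>q. f (q, 0) \<noteq> 0) \<and> (\<forall>q. f (q, 0) \<noteq> 0 \<longrightarrow> P q))"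

text \<open>Two nonempty open sets meet. On the line through a point of each, both functions
  restrict to nonzero polynomials in one variable, and their product has a nonroot because the field
  is infinite.\<close>

lemma generic_conj:
  fixes P Q :: "'k::field frame \<Rightarrow> bool"
  assumes inf: "infinite (UNIV :: 'k set)" and "generic P" "generic Q"
  shows "generic (\<lambda>q. P q \<and> Q q)"
proof -
  obtain f a where f: "regular f" "f (a, 0) \<noteq> 0" "\<And>q. f (q, 0) \<noteq> 0 \<Longrightarrow> P q"
    using assms(2) unfolding generic_def by blast
  obtain g b where g: "regular g" "g (b, 0) \<noteq> 0" "\<And>q. g (q, 0) \<noteq> 0 \<Longrightarrow> Q q"
    using assms(3) unfolding generic_def by blast
  let ?c = "\<lambda>j i l. [:a j i l, b j i l - a j i l:]"
  obtain p where p: "\<And>t. f (\<lambda>j i l. poly (?c j i l) t, poly 0 t) = poly p t"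
    using regular_curve[OF f(1), of ?c 0] by blast
  obtain r where r: "\<And>t. g (\<lambda>j i l. poly (?c j i l) t, poly 0 t) = poly r t"
    using regular_curve[OF g(1), of ?c 0] by blast
  have "poly p 0 \<noteq> 0" using p[of 0] f(2) by simp
  moreover have "poly r 1 \<noteq> 0" using r[of 1] g(2) by simp
  ultimately have "p * r \<noteq> 0" by auto
  then obtain t where "poly (p * r) t \<noteq> 0" using poly_nonroot[OF inf] by blast
  then have "f (\<lambda>j i l. poly (?c j i l) t, 0) * g (\<lambda>j i l. poly (?c j i l) t, 0) \<noteq> 0"
    using p[of t] r[of t] by simp
  then show ?thesis
    unfolding generic_def using f g
    by (intro exI[of _ "\<lambda>x. f x * g x"] conjI regular_mult exI[of _ "\<lambda>j i l. poly (?c j i l) t"])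
      auto
qed

lemma generic_True [simp]: "generic (\<lambda>_. True)"
  unfolding generic_def by (intro exI[of _ "\<lambda>_. 1"]) auto

lemma generic_finite_ball:
  fixes P :: "'i \<Rightarrow> 'k::field frame \<Rightarrow> bool"
  assumes inf: "infinite (UNIV :: 'k set)" and "finite A" "\<And>i. i \<in> A \<Longrightarrow> generic (P i)"
  shows "generic (\<lambda>q. \<forall>i\<in>A. P i q)"
  using assms(2,3) by (induction A rule: finite_induct) (auto intro: generic_conj[OF inf])

lemma generic_mono: "generic P \<Longrightarrow> (\<And>q. P q \<Longrightarrow> Q q) \<Longrightarrow> generic Q"
  unfolding generic_def by blast

lemma generic_ex: "generic P \<Longrightarrow> \<exists>q. P q"
  unfolding generic_def by blast

section \<open>Standard monomials\<close>

text \<open>The head of the list is the block that was glued last, so that recursion on the list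
  undoes the gluing.\<close>

fun forest_blocks :: "nat set list \<Rightarrow> bool" where
  "forest_blocks [] \<longleftrightarrow> True"
| "forest_blocks (B # Bs) \<longleftrightarrow>
    finite B \<and> card (B \<inter> \<Union>(set Bs)) \<le> 1 \<and> forest_blocks Bs"

definition cells :: "nat \<Rightarrow> nat set \<Rightarrow> (nat \<Rightarrow> nat) \<Rightarrow> (nat \<times> nat) set" where
  "cells s V k = {(i, j). j \<in> V \<and> k j < i \<and> i \<le> s}"

definition bump :: "nat set \<Rightarrow> (nat \<Rightarrow> nat) \<Rightarrow> nat \<Rightarrow> nat" where
  "bump B k j = (if j \<in> B then Suc (k j) else k j)"

text \<open>\<open>k j\<close> counts the coordinates already eliminated in the column
  \<open>j\<close>, hence \<open>Suc (k j)\<close> is the row of its pivot. Only the support of a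
  monomial enters, which is the source of radicality. Although \<open>bump\<close> acts on all of
  \<open>B\<close>, the recursive call sees only the vertex shared with older blocks.\<close>

fun std :: "nat \<Rightarrow> nat set list \<Rightarrow> (nat \<Rightarrow> nat) \<Rightarrow> (nat \<times> nat) set \<Rightarrow> bool" where
  "std s [] k S \<longleftrightarrow> S = {}"
| "std s (B # Bs) k S \<longleftrightarrow> S \<subseteq> cells s (B \<union> \<Union>(set Bs)) k \<and>
    card {j \<in> B - \<Union>(set Bs). (Suc (k j), j) \<in> S} < s \<and>
    std s Bs (if card {j \<in> B - \<Union>(set Bs). (Suc (k j), j) \<in> S} = s - 1 then bump B k else k)
      {v \<in> S. snd v \<in> \<Union>(set Bs)}"

lemma std_cells: "std s Bs k S \<Longrightarrow> S \<subseteq> cells s (\<Union>(set Bs)) k"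
  by (cases Bs) auto

text \<open>A column with \<open>k j \<ge> s\<close> has no cells left, so values of
  \<open>k\<close> from \<open>s\<close> on cannot be told apart. This permits replacing
  \<open>bump B k\<close> by an update at the gluing vertex, or by \<open>k\<close> itself if the
  glued column is exhausted.\<close>

lemma std_cong:
  assumes "\<And>j. j \<in> \<Union>(set Bs) \<Longrightarrow> min s (k j) = min s (k' j)"
  shows "std s Bs k S \<longleftrightarrow> std s Bs k' S"
  using assms
proof (induction Bs arbitrary: k k' S)
  case (Cons B Bs)
  let ?A = "\<Union>(set Bs)"
  have lt: "k j < i \<longleftrightarrow> k' j < i" if "j \<in> B \<union> ?A" "i \<le> s" for i j
  proof -
    have "min s (k j) = min s (k' j)" using Cons.prems that by auto
    then show ?thesis using that by (auto simp: min_def split: if_splits)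
  qed
  have cells: "cells s (B \<union> ?A) k = cells s (B \<union> ?A) k'"
    using lt unfolding cells_def by auto
  show ?case
  proof (cases "S \<subseteq> cells s (B \<union> ?A) k")
    case True
    have "{j \<in> B - ?A. (Suc (k j), j) \<in> S} = {j \<in> B - ?A. (Suc (k' j), j) \<in> S}"
    proof -
      have "(Suc (k j), j) \<in> S \<longleftrightarrow> (Suc (k' j), j) \<in> S" if "j \<in> B" for j
      proof -
        have "min s (k j) = min s (k' j)" using Cons.prems that by auto
        moreover have "(Suc (k j), j) \<in> S \<Longrightarrow> k j < s" "(Suc (k' j), j) \<in> S \<Longrightarrow> k' j < s"
          using True by (auto simp: cells_def)
        ultimately show ?thesis by (auto simp: min_def split: if_splits)
      qed
      then show ?thesis by auto
    qed
    moreover have "std s Bs (bump B k) S' \<longleftrightarrow> std s Bs (bump B k') S'" for S'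
    proof (rule Cons.IH)
      fix j assume "j \<in> ?A"
      then have "min s (k j) = min s (k' j)" using Cons.prems by auto
      then show "min s (bump B k j) = min s (bump B k' j)"
        by (auto simp: bump_def min_def split: if_splits)
    qed
    moreover have "std s Bs k S' \<longleftrightarrow> std s Bs k' S'" for S'
      using Cons.prems by (intro Cons.IH) auto
    ultimately show ?thesis using cells by simp
  next
    case False
    then show ?thesis using cells by simp
  qed
qed auto

section \<open>Moving variables to larger rows\<close>

definition dominated :: "(nat \<times> nat) set \<Rightarrow> (nat \<times> nat) set \<Rightarrow> bool" where
  "dominated S' S \<longleftrightarrow> (\<forall>(i', j)\<in>S'. \<exists>i\<le>i'. (i, j) \<in> S)"

text \<open>If a pivot for \<open>k'\<close> occurs in \<open>S'\<close>, then a variable of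
  \<open>S\<close> lies weakly above it and below row \<open>k j\<close>, and
  \<open>k' j \<le> k j\<close> leaves only the pivot for \<open>k\<close>. So \<open>S'\<close> has
  at most the pivots of \<open>S\<close>; when \<open>S'\<close> reaches the threshold
  \<open>s - 1\<close>, so does \<open>S\<close>, and the inequality between \<open>k'\<close> and
  \<open>k\<close> survives the recursion. The case \<open>k' = k\<close> is the combinatorial core
  of Borel-fixedness.\<close>

lemma std_dominated:
  assumes "forest_blocks Bs" "std s Bs k S" "dominated S' S" "\<And>j. j \<in> \<Union>(set Bs) \<Longrightarrow> k' j \<le> k j"
    and "\<And>i j. (i, j) \<in> S' \<Longrightarrow> i \<le> s"
  shows "std s Bs k' S'"
  using assms
proof (induction Bs arbitrary: k k' S S')
  case Nil
  then show ?case by (auto simp: dominated_def)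
next
  case (Cons B Bs)
  let ?A = "\<Union>(set Bs)"
  let ?U = "{j \<in> B - ?A. (Suc (k j), j) \<in> S}"
  let ?U' = "{j \<in> B - ?A. (Suc (k' j), j) \<in> S'}"
  have S: "S \<subseteq> cells s (B \<union> ?A) k" and U: "card ?U < s" using Cons.prems(2) by auto
  have dom: "\<exists>i\<le>i'. (i, j) \<in> S" if "(i', j) \<in> S'" for i' j
    using Cons.prems(3) that by (auto simp: dominated_def)
  have S': "S' \<subseteq> cells s (B \<union> ?A) k'"
  proof
    fix v assume v: "v \<in> S'"
    obtain i' j where ij: "v = (i', j)" by (cases v)
    obtain i where i: "i \<le> i'" "(i, j) \<in> S" using dom v ij by blast
    then have "j \<in> B \<union> ?A" "k j < i" using S by (auto simp: cells_def)
    moreover have "k' j \<le> k j" using Cons.prems(4)[of j] calculation by auto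
    ultimately show "v \<in> cells s (B \<union> ?A) k'"
      using i Cons.prems(5)[of i' j] v ij by (auto simp: cells_def)
  qed
  have "?U' \<subseteq> ?U"
  proof
    fix j assume j: "j \<in> ?U'"
    then obtain i where i: "i \<le> Suc (k' j)" "(i, j) \<in> S" using dom by blast
    then have "k j < i" using S by (auto simp: cells_def)
    moreover have "k' j \<le> k j" using Cons.prems(4)[of j] j by auto
    ultimately have "i = Suc (k j)" using i by simp
    then show "j \<in> ?U" using i j by auto
  qed
  moreover have finU: "finite ?U" using Cons.prems(1) by simp
  ultimately have le: "card ?U' \<le> card ?U" by (intro card_mono)
  have dom': "dominated {v \<in> S'. snd v \<in> ?A} {v \<in> S. snd v \<in> ?A}"
    using Cons.prems(3) by (fastforce simp: dominated_def)
  have "std s Bs (if card ?U' = s - 1 then bump B k' else k') {v \<in> S'. snd v \<in> ?A}"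
  proof (rule Cons.IH[OF _ _ dom'])
    show "forest_blocks Bs" using Cons.prems(1) by simp
    show "std s Bs (if card ?U = s - 1 then bump B k else k) {v \<in> S. snd v \<in> ?A}"
      using Cons.prems(2) by simp
    fix j assume "j \<in> ?A"
    then have "k' j \<le> k j" using Cons.prems(4) by auto
    then show "(if card ?U' = s - 1 then bump B k' else k') j \<le> (if card ?U = s - 1 then bump B k else k) j"
      using le U by (auto simp: bump_def)
  next
    fix i j assume "(i, j) \<in> {v \<in> S'. snd v \<in> ?A}"
    then show "i \<le> s" using Cons.prems(5) by auto
  qed
  then show ?case using S' le U by simp
qed

section \<open>Shifting one column by a row\<close>

definition shift_col :: "nat \<Rightarrow> nat \<times> nat \<Rightarrow> nat \<times> nat" where
  "shift_col v = (\<lambda>(i, j). (if j = v then Suc i else i, j))"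

lemma inj_shift_col: "inj (shift_col v)"
  by (auto simp: inj_def shift_col_def split: if_splits)

lemma snd_shift_col [simp]: "snd (shift_col v x) = snd x"
  by (auto simp: shift_col_def split: prod.splits)

lemma shift_col_mem: "shift_col v x \<in> shift_col v ` S \<longleftrightarrow> x \<in> S"
  by (rule inj_image_mem_iff[OF inj_shift_col])

text \<open>Raising the codimension of the column \<open>v\<close> merely renumbers its rows, with
  \<open>i\<close> becoming \<open>Suc i\<close>. The last row must be empty because the shift would
  push it out of the cells.\<close>

lemma std_shift:
  assumes "\<And>i. (i, v) \<in> S \<Longrightarrow> i < s" "v \<in> \<Union>(set Bs)"
  shows "std s Bs (k(v := Suc (k v))) (shift_col v ` S) \<longleftrightarrow> std s Bs k S"
  using assms
proof (induction Bs arbitrary: k S)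
  case (Cons B Bs)
  let ?A = "\<Union>(set Bs)"
  let ?k = "k(v := Suc (k v))"
  let ?S = "shift_col v ` S"
  have mem: "(Suc (?k j), j) \<in> ?S \<longleftrightarrow> (Suc (k j), j) \<in> S" for j
  proof -
    have "(Suc (?k j), j) = shift_col v (Suc (k j), j)" by (simp add: shift_col_def)
    then show ?thesis using shift_col_mem[of v "(Suc (k j), j)" S] by simp
  qed
  have cells: "?S \<subseteq> cells s (B \<union> ?A) ?k \<longleftrightarrow> S \<subseteq> cells s (B \<union> ?A) k"
  proof -
    have "shift_col v x \<in> cells s (B \<union> ?A) ?k \<longleftrightarrow> x \<in> cells s (B \<union> ?A) k" if "x \<in> S" for x
      using that Cons.prems(1)[of "fst x"] by (cases x) (auto simp: shift_col_def cells_def)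
    then show ?thesis by (auto simp: image_subset_iff)
  qed
  have "{w \<in> ?S. snd w \<in> ?A} = shift_col v ` {w \<in> S. snd (shift_col v w) \<in> ?A}" by blast
  then have restr: "{w \<in> ?S. snd w \<in> ?A} = shift_col v ` {w \<in> S. snd w \<in> ?A}"
    by (simp only: snd_shift_col)
  let ?k1 = "if card {j \<in> B - ?A. (Suc (k j), j) \<in> S} = s - 1 then bump B k else k"
  have k1: "(if card {j \<in> B - ?A. (Suc (k j), j) \<in> S} = s - 1 then bump B ?k else ?k) =
      ?k1(v := Suc (?k1 v))"
    by (auto simp: bump_def)
  have "std s Bs (?k1(v := Suc (?k1 v))) (shift_col v ` {w \<in> S. snd w \<in> ?A}) \<longleftrightarrow>
      std s Bs ?k1 {w \<in> S. snd w \<in> ?A}"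
  proof (cases "v \<in> ?A")
    case True
    then show ?thesis using Cons.prems(1) by (intro Cons.IH) auto
  next
    case False
    have "shift_col v ` {w \<in> S. snd w \<in> ?A} = (\<lambda>x. x) ` {w \<in> S. snd w \<in> ?A}"
      using False by (intro image_cong) (auto simp: shift_col_def)
    then have "shift_col v ` {w \<in> S. snd w \<in> ?A} = {w \<in> S. snd w \<in> ?A}" by simp
    then show ?thesis using False by (simp only:) (rule std_cong, auto)
  qed
  then show ?case unfolding std.simps restr mem cells k1 by (simp only:)
qed auto

section \<open>Counting standard monomials of a given degree\<close>

definition std_set :: "nat \<Rightarrow> nat set list \<Rightarrow> (nat \<Rightarrow> nat) \<Rightarrow> (nat \<Rightarrow>\<^sub>0 nat) \<Rightarrow> monomial set" where
  "std_set s Bs k a = {t. std s Bs k (keys t) \<and> mdeg t = a}"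

lemma finite_monomials_mdeg: "finite {t. fst ` keys t \<subseteq> {..s} \<and> mdeg t = a}"
proof -
  let ?X = "{..s} \<times> keys a"
  let ?N = "Max (lookup a ` keys a)"
  let ?F = "{f. \<forall>x. (x \<in> ?X \<longrightarrow> f x \<in> {..?N}) \<and> (x \<notin> ?X \<longrightarrow> f x = (0::nat))}"
  have "finite ?F" by (intro finite_set_of_finite_funs) auto
  moreover have "lookup ` {t. fst ` keys t \<subseteq> {..s} \<and> mdeg t = a} \<subseteq> ?F"
  proof (rule image_subsetI)
    fix t :: monomial
    assume t: "t \<in> {t. fst ` keys t \<subseteq> {..s} \<and> mdeg t = a}"
    have key: "x \<in> keys t \<Longrightarrow> x \<in> ?X" for x
      using t by (cases x) (force simp: keys_mdeg)
    have "lookup t x \<le> ?N" if "x \<in> ?X" for x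
    proof -
      have "lookup t x \<le> lookup (mdeg t) (snd x)"
      proof (cases "x \<in> keys t")
        case True
        then show ?thesis unfolding lookup_mdeg by (intro member_le_sum) auto
      qed (auto simp: in_keys_iff)
      also have "\<dots> = lookup a (snd x)" using t by simp
      also have "\<dots> \<le> ?N" using that by (intro Max_ge) auto
      finally show ?thesis .
    qed
    moreover have "lookup t x = 0" if "x \<notin> ?X" for x
      using key[of x] that by (meson in_keys_iff)
    ultimately show "lookup t \<in> ?F" by blast
  qed
  ultimately have "finite (lookup ` {t. fst ` keys t \<subseteq> {..s} \<and> mdeg t = a})"
    by (rule finite_subset[rotated])
  then show ?thesis
    by (rule finite_imageD) (rule inj_onI, rule poly_mapping_eqI, simp only:)
qed

lemma finite_std_set: "finite (std_set s Bs k a)"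
proof (rule finite_subset[OF _ finite_monomials_mdeg[of s a]])
  show "std_set s Bs k a \<subseteq> {t. fst ` keys t \<subseteq> {..s} \<and> mdeg t = a}"
  proof
    fix t assume "t \<in> std_set s Bs k a"
    then have "keys t \<subseteq> cells s (\<Union>(set Bs)) k" "mdeg t = a"
      using std_cells by (auto simp: std_set_def)
    then show "t \<in> {t. fst ` keys t \<subseteq> {..s} \<and> mdeg t = a}"
      by (auto simp: cells_def)
  qed
qed

definition shift_monomial :: "nat \<Rightarrow> monomial \<Rightarrow> monomial" where
  "shift_monomial v t =
    (\<Sum>x\<in>keys t. single (shift_col v x) (lookup t x))"

lemma lookup_shift_monomial [simp]:
  "lookup (shift_monomial v t) (shift_col v x) = lookup t x"
  by (auto simp: shift_monomial_def lookup_sum lookup_single when_def inj_eq[OF inj_shift_col]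
      in_keys_iff)

lemma lookup_shift_monomial_notin:
  "y \<notin> range (shift_col v) \<Longrightarrow> lookup (shift_monomial v t) y = 0"
  by (auto simp: shift_monomial_def lookup_sum lookup_single when_def intro!: sum.neutral)

lemma keys_shift_monomial:
  "keys (shift_monomial v t) = shift_col v ` keys t"
proof (rule Set.set_eqI)
  fix y show "y \<in> keys (shift_monomial v t) \<longleftrightarrow> y \<in> shift_col v ` keys t"
  proof (cases "y \<in> range (shift_col v)")
    case True
    then obtain x where "y = shift_col v x" by auto
    then show ?thesis by (simp add: shift_col_mem in_keys_iff)
  next
    case False
    then show ?thesis using lookup_shift_monomial_notin[OF False] by (auto simp: in_keys_iff)
  qed
qed

lemma mdeg_shift_monomial [simp]: "mdeg (shift_monomial v t) = mdeg t"
proof -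
  have "mdeg (shift_monomial v t) = (\<Sum>x\<in>shift_col v ` keys t.
      single (snd x) (lookup (shift_monomial v t) x))"
    by (simp add: mdeg_def keys_shift_monomial)
  also have "\<dots> = mdeg t"
    by (subst sum.reindex) (auto simp: mdeg_def inj_on_subset[OF inj_shift_col])
  finally show ?thesis .
qed

text \<open>Standard monomials are split by the occurrence of the last variable
  \<open>(s, v)\<close>. Where it occurs, it is divided out; conversely, multiplying by it preserves
  standardness, since by \<open>lookup a v \<ge> 1\<close> the column \<open>v\<close> is already
  occupied in a row that is at most \<open>s\<close>. Where it does not occur, the column is
  shifted. The equation is the one between Hilbert functions that a linear form of the column
  \<open>v\<close> satisfies when it is a nonzerodivisor.\<close>

lemma card_std_set_Suc:
  assumes blocks: "forest_blocks Bs" and v: "v \<in> \<Union>(set Bs)" and kv: "k v < s"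
    and av: "lookup a v \<ge> 1"
  shows "card (std_set s Bs k (a + single v 1)) =
    card (std_set s Bs k a) + card (std_set s Bs (k(v := Suc (k v))) (a + single v 1))"
proof -
  let ?a' = "a + single v 1"
  let ?x = "single (s, v) (1::nat)"
  let ?X = "std_set s Bs k ?a'"
  let ?X1 = "{t \<in> ?X. (s, v) \<in> keys t}"
  let ?X2 = "{t \<in> ?X. (s, v) \<notin> keys t}"
  have rows: "i \<le> s" if "std s Bs k' S" "(i, j) \<in> S" for i j S k'
    using std_cells[OF that(1)] that(2) by (auto simp: cells_def)
  have im1: "(\<lambda>t. t + ?x) ` std_set s Bs k a = ?X1"
  proof (intro Set.equalityI subsetI)
    fix u assume "u \<in> (\<lambda>t. t + ?x) ` std_set s Bs k a"
    then obtain t where t: "u = t + ?x" "std s Bs k (keys t)" "mdeg t = a"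
      by (auto simp: std_set_def)
    have ku: "keys u = insert (s, v) (keys t)"
      unfolding t by (auto simp: in_keys_iff lookup_add lookup_single when_def split: if_splits)
    have "v \<in> keys (mdeg t)" using av t by (simp add: in_keys_iff)
    then obtain i where i: "(i, v) \<in> keys t" by (auto simp: keys_mdeg)
    then have "i \<le> s" using rows t(2) by blast
    have "dominated (keys u) (keys t)"
      unfolding ku dominated_def using i \<open>i \<le> s\<close> by blast
    then have "std s Bs k (keys u)"
      by (rule std_dominated[OF blocks t(2)]) (use ku rows[OF t(2)] in auto)
    then show "u \<in> ?X1" using ku t by (auto simp: std_set_def mdeg_add)
  next
    fix u assume u: "u \<in> ?X1"
    define t where "t = u - ?x"
    have lt: "lookup t y = lookup u y - lookup ?x y" for y
      by (simp add: t_def lookup_minus)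
    have ut: "u = t + ?x"
      using u by (intro poly_mapping_eqI) (auto simp: lt lookup_add lookup_single when_def in_keys_iff)
    have "mdeg t + single v 1 = ?a'"
      using u ut by (simp add: std_set_def mdeg_add)
    then have "mdeg t = a" by simp
    moreover have "keys t \<subseteq> keys u"
      by (auto simp: in_keys_iff lt)
    moreover from this have "dominated (keys t) (keys u)"
      by (auto simp: dominated_def)
    moreover have su: "std s Bs k (keys u)" using u by (simp add: std_set_def)
    ultimately have "std s Bs k (keys t)"
      using rows[OF su] by (intro std_dominated[OF blocks su]) auto
    with \<open>mdeg t = a\<close> have "t \<in> std_set s Bs k a" by (simp add: std_set_def)
    then show "u \<in> (\<lambda>t. t + ?x) ` std_set s Bs k a"
      using ut by (rule image_eqI[rotated])
  qed
  have "inj_on (\<lambda>t. t + ?x) (std_set s Bs k a)" by (auto simp: inj_on_def)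
  then have c1: "card ?X1 = card (std_set s Bs k a)" by (simp only: card_image flip: im1)
  have less: "i < s" if "u \<in> ?X2" "(i, v) \<in> keys u" for u i
  proof -
    have "i \<le> s" "i \<noteq> s" using that rows[of k "keys u" i v] by (auto simp: std_set_def)
    then show ?thesis by simp
  qed
  have im2: "shift_monomial v ` ?X2 = std_set s Bs (k(v := Suc (k v))) ?a'"
  proof (intro Set.equalityI subsetI)
    fix w assume "w \<in> shift_monomial v ` ?X2"
    then obtain u where u: "u \<in> ?X2" "w = shift_monomial v u" by auto
    then show "w \<in> std_set s Bs (k(v := Suc (k v))) ?a'"
      using std_shift[of v "keys u" s Bs k, OF less[OF u(1)] v]
      by (auto simp: std_set_def keys_shift_monomial)
  next
    fix w assume w: "w \<in> std_set s Bs (k(v := Suc (k v))) ?a'"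
    define u where "u = Poly_Mapping.map_key (shift_col v) w"
    have cellw: "keys w \<subseteq> cells s (\<Union>(set Bs)) (k(v := Suc (k v)))"
      using w std_cells by (auto simp: std_set_def)
    have range: "keys w \<subseteq> range (shift_col v)"
    proof
      fix y assume "y \<in> keys w"
      then have "y = shift_col v (if snd y = v then fst y - 1 else fst y, snd y)"
        using cellw by (cases y) (auto simp: shift_col_def cells_def)
      then show "y \<in> range (shift_col v)" by blast
    qed
    have lu: "lookup u x = lookup w (shift_col v x)" for x
      unfolding u_def by (simp add: Poly_Mapping.map_key.rep_eq[OF inj_shift_col])
    have wu: "w = shift_monomial v u"
    proof (rule poly_mapping_eqI)
      fix y show "lookup w y = lookup (shift_monomial v u) y"
      proof (cases "y \<in> range (shift_col v)")
        case False
        then show ?thesis using range lookup_shift_monomial_notin[OF False] by (auto simp: in_keys_iff)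
      qed (auto simp: lu)
    qed
    have sv: "i < s" if "(i, v) \<in> keys u" for i
    proof -
      have "(Suc i, v) \<in> keys w"
        using that by (simp add: in_keys_iff lu shift_col_def)
      then show ?thesis using cellw by (auto simp: cells_def)
    qed
    have "std s Bs k (keys u)"
      using w std_shift[of v "keys u" s Bs k, OF sv v]
      by (simp add: wu std_set_def keys_shift_monomial)
    then have "u \<in> ?X2" using w wu sv by (auto simp: std_set_def)
    then show "w \<in> shift_monomial v ` ?X2" using wu by blast
  qed
  have "inj_on (shift_monomial v) ?X2"
    by (rule inj_onI, rule poly_mapping_eqI) (metis lookup_shift_monomial)
  then have c2: "card ?X2 = card (std_set s Bs (k(v := Suc (k v))) ?a')" by (simp only: card_image flip: im2)
  have fin: "finite ?X" by (rule finite_std_set)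
  have "?X = ?X1 \<union> ?X2" by blast
  then have "card ?X = card (?X1 \<union> ?X2)" by simp
  also have "\<dots> = card ?X1 + card ?X2"
    by (rule card_Un_disjoint) (use fin in \<open>auto intro: finite_subset\<close>)
  finally have "card ?X = card ?X1 + card ?X2" .
  then show ?thesis using c1 c2 by simp
qed

section \<open>Ideals of minors with columns in subspaces\<close>

text \<open>
  The parameter \<open>k j\<close> is the codimension of a subspace of \<open>K\<^sup>s\<close> spanned by the vectors
  \<open>q j i\<close> with \<open>k j < i \<le> s\<close>, and \<open>(i, j)\<close> indexes the coordinate of the \<open>j\<close>-th column that
  belongs to \<open>q j i\<close>. The vector \<open>q j (Suc (k j))\<close> is called the pivot of the column.
\<close>

definition column ::
  "nat \<Rightarrow> ('k \<Rightarrow> 'r::comm_ring_1) \<Rightarrow> (nat \<Rightarrow> nat) \<Rightarrow> 'k frame \<Rightarrow>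
    (nat \<times> nat \<Rightarrow> 'r) \<Rightarrow> nat \<Rightarrow> nat \<Rightarrow> 'r" where
  "column s c k q z j = (\<lambda>l. \<Sum>i\<in>{k j<..s}. z (i, j) * c (q j i l))"

definition gcol ::
  "nat \<Rightarrow> (nat \<Rightarrow> nat) \<Rightarrow> 'k frame \<Rightarrow> nat \<Rightarrow> nat \<Rightarrow> 'k::field polynomial" where
  "gcol s k q = column s const_poly k q (\<lambda>(i, j). var_poly i j)"

definition block_minor ::
  "nat \<Rightarrow> (nat \<Rightarrow> nat) \<Rightarrow> 'k frame \<Rightarrow> nat list \<Rightarrow> 'k::field polynomial" where
  "block_minor s k q js = vdet (map (gcol s k q) js)"

definition hyp_gens ::
  "nat \<Rightarrow> nat set list \<Rightarrow> (nat \<Rightarrow> nat) \<Rightarrow> 'k frame \<Rightarrow> 'k::field polynomial set" where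
  "hyp_gens s Bs k q =
    {var_poly i j | i j. j \<in> \<Union>(set Bs) \<and> (i, j) \<notin> cells s (\<Union>(set Bs)) k} \<union>
    {block_minor s k q js | js B. B \<in> set Bs \<and> set js \<subseteq> B \<and> distinct js \<and> length js = s}"

abbreviation hyp_ideal ::
  "nat \<Rightarrow> nat set list \<Rightarrow> (nat \<Rightarrow> nat) \<Rightarrow> 'k frame \<Rightarrow> 'k::field polynomial set" where
  "hyp_ideal s Bs k q \<equiv> gen_ideal (hyp_gens s Bs k q)"

definition pivot :: "(nat \<Rightarrow> nat) \<Rightarrow> 'k frame \<Rightarrow> nat \<Rightarrow> nat \<Rightarrow> 'k" where
  "pivot k q j = q j (Suc (k j))"

text \<open>The generalized cross product: a normal vector of the hyperplane spanned by
  \<open>s - 1\<close> vectors. It is polynomial in them and, over a field, vanishes when they are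
  dependent.\<close>

definition cofactors :: "(nat \<Rightarrow> 'a::comm_ring_1) list \<Rightarrow> nat \<Rightarrow> 'a" where
  "cofactors us l = vdet (us @ [\<lambda>a. if a = l then 1 else 0])"

lemma dot_cofactors: "Suc (length us) = s \<Longrightarrow> dot s (cofactors us) x = vdet (us @ [x])"
  by (subst vdet_cofactor_snoc) (auto simp: dot_def cofactors_def mult.commute)

text \<open>The subspace of the column \<open>v\<close> is intersected with the hyperplane \<open>dot s g x = 0\<close>.\<close>

definition elim ::
  "nat \<Rightarrow> (nat \<Rightarrow> 'k::comm_ring_1) \<Rightarrow> nat \<Rightarrow> (nat \<Rightarrow> nat) \<Rightarrow> 'k frame \<Rightarrow>
    nat \<Rightarrow> nat \<Rightarrow> nat \<Rightarrow> 'k" where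
  "elim s g v k q = q(v := (\<lambda>i l. dot s g (pivot k q v) * q v i l - dot s g (q v i) * pivot k q v l))"

text \<open>The linear form \<open>dot s g\<close> applied to the generic column \<open>v\<close>,
  expanded in the coordinates of that column.\<close>

definition linform ::
  "nat \<Rightarrow> (nat \<Rightarrow> 'k) \<Rightarrow> nat \<Rightarrow> (nat \<Rightarrow> nat) \<Rightarrow> 'k frame \<Rightarrow> 'k::field polynomial" where
  "linform s g v k q = (\<Sum>i\<in>{k v<..s}. var_poly i v * const_poly (dot s g (q v i)))"

text \<open>The last clause follows the one situation in which \<open>std\<close> raises
  \<open>k\<close>: exactly \<open>s - 1\<close> pivots of new columns occur, and the glued column
  is restricted to the hyperplane that they span.\<close>

fun gen_pos :: "nat \<Rightarrow> nat set list \<Rightarrow> (nat \<Rightarrow> nat) \<Rightarrow> 'k::field frame \<Rightarrow> bool" where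
  "gen_pos s [] k q \<longleftrightarrow> True"
| "gen_pos s (B # Bs) k q \<longleftrightarrow>
    (\<forall>js. distinct js \<and> length js = s \<and> set js \<subseteq> {j \<in> B. k j < s} \<longrightarrow>
      vdet (map (pivot k q) js) \<noteq> 0) \<and>
    gen_pos s Bs k q \<and>
    (\<forall>us v. distinct us \<and> Suc (length us) = s \<and> set us \<subseteq> {j \<in> B - \<Union>(set Bs). k j < s} \<and>
        v \<in> B \<inter> \<Union>(set Bs) \<and> k v < s \<longrightarrow>
      gen_pos s Bs (k(v := Suc (k v))) (elim s (cofactors (map (pivot k q) us)) v k q))"

lemma homog_poly_subst:
  assumes \<phi>: "\<And>i j. homog (single j 1) (\<phi> i j)" and p: "homog a p"
  shows "homog a (poly_subst \<phi> p)"
proof -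
  have pow: "homog (single j n) (\<phi> i j ^ n)" for i j n
  proof (induction n)
    case (Suc n)
    have "single j (Suc n) = single j 1 + single j n"
      by (metis plus_1_eq_Suc single_add)
    then show ?case using homog_mult[OF \<phi> Suc] by simp
  qed (simp add: homog_def)
  have "homog (mdeg t) (monom_eval (\<lambda>(i, j). \<phi> i j) t)" for t
    unfolding monom_eval_def mdeg_def by (intro homog_prod) (auto simp: pow)
  then show ?thesis
    using p unfolding poly_subst_eq_poly_eval poly_eval_def
    by (intro homog_sum homog_const_mult) (auto simp: homog_def)
qed

text \<open>In the degree \<open>a\<close>, the cofactor \<open>r\<close> may be replaced by its
  component of degree \<open>a - b\<close>. If \<open>a\<close> is not of the form
  \<open>a' + b\<close>, a multiple of \<open>L\<close> has no component of degree \<open>a\<close>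
  at all, and \<open>0\<close> serves as cofactor.\<close>

lemma homog_gen_ideal_insert:
  fixes x :: "'k::field polynomial"
  assumes G: "\<And>g. g \<in> G \<Longrightarrow> \<exists>b. homog b g" and L: "homog b L"
    and x: "x \<in> gen_ideal (insert L G)" "homog a x"
  obtains r where "x - r * L \<in> gen_ideal G" "r = 0 \<or> (\<exists>a'. a = a' + b \<and> homog a' r)"
proof -
  obtain r where r: "x - r * L \<in> gen_ideal G" using x(1) by (rule gen_ideal_insert)
  have c: "x - hom_component a (r * L) \<in> gen_ideal G"
    using hom_component_gen_ideal[OF G r, of a] x(2) by (simp add: hom_component_diff hom_component_of_homog)
  show ?thesis
  proof (cases "\<exists>a'. a = a' + b")
    case True
    then obtain a' where a': "a = a' + b" by blast
    then have "hom_component a (r * L) = hom_component a' r * L"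
      by (simp add: hom_component_mult_homog[OF L])
    then show ?thesis using c a' by (intro that[of "hom_component a' r"]) auto
  next
    case False
    have "mdeg t \<noteq> a" if t: "t \<in> keys (r * L)" for t
    proof -
      obtain u w where "t = u + w" "w \<in> keys L"
        using t Poly_Mapping.keys_mult[of r L] by blast
      then have "mdeg t = mdeg u + b" using L by (auto simp: homog_def mdeg_add)
      then show ?thesis using False by auto
    qed
    then have "hom_component a (r * L) = 0"
      by (intro poly_mapping_eqI) (auto simp: lookup_hom_component in_keys_iff)
    then show ?thesis using c by (intro that[of 0]) auto
  qed
qed

text \<open>The monomial in the expansion of a minor that takes the variable in row
  \<open>f b\<close> from the column \<open>js ! b\<close>.\<close>

definition choice_monomial :: "nat list \<Rightarrow> (nat \<Rightarrow> nat) \<Rightarrow> monomial" where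
  "choice_monomial js f = (\<Sum>b = 0..<length js. single (f b, js ! b) 1)"

lemma mdeg_sum: "mdeg (sum f A) = (\<Sum>x\<in>A. mdeg (f x))"
  by (induction A rule: infinite_finite_induct) (auto simp: mdeg_add)

lemma mdeg_choice_monomial:
  "mdeg (choice_monomial js f) = (\<Sum>b = 0..<length js. single (js ! b) 1)"
  by (simp add: choice_monomial_def mdeg_sum)

lemma mono_poly_sum: "mono_poly (sum f A) = (\<Prod>x\<in>A. mono_poly (f x))"
  by (induction A rule: infinite_finite_induct) (auto simp: mono_poly_add)

lemma block_minor_expand:
  assumes "length js = s"
  shows "block_minor s k q js = (\<Sum>f\<in>PiE {0..<s} (\<lambda>b. {k (js ! b)<..s}).
    mono_poly (choice_monomial js f) * const_poly (vdet (map (\<lambda>b. q (js ! b) (f b)) [0..<s])))"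
proof -
  have "map (gcol s k q) js = map (\<lambda>b l. \<Sum>i\<in>{k (js ! b)<..s}.
      var_poly i (js ! b) * const_poly (q (js ! b) i l)) [0..<s]"
    using assms by (intro nth_equalityI) (auto simp: gcol_def column_def)
  then show ?thesis
    unfolding block_minor_def
    by (simp add: vdet_expand choice_monomial_def assms mono_poly_sum var_poly_def
        ring_map_vdet[OF const_poly_ring_map] comp_def)
qed

lemma homog_block_minor:
  "length js = s \<Longrightarrow> homog (\<Sum>b = 0..<length js. single (js ! b) 1) (block_minor s k q js)"
  unfolding block_minor_expand
  using homog_mult[OF _ homog_const] by (intro homog_sum) (fastforce simp: mdeg_choice_monomial)

lemma homog_hyp_gens: "g \<in> hyp_gens s Bs k q \<Longrightarrow> \<exists>b. homog b g"
  unfolding hyp_gens_def using homog_var homog_block_minor by blast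

lemma homog_linform: "homog (single v 1) (linform s g v k q)"
  unfolding linform_def using homog_mult[OF homog_var homog_const] by (intro homog_sum) simp

lemma hyp_gens_Cons: "hyp_gens s Bs k q \<subseteq> hyp_gens s (B # Bs) k q"
  unfolding hyp_gens_def by (auto simp: cells_def)

lemma hyp_ideal_Cons: "x \<in> hyp_ideal s Bs k q \<Longrightarrow> x \<in> hyp_ideal s (B # Bs) k q"
  using poly_module.span_mono[OF hyp_gens_Cons] by blast

lemma block_minor_mem:
  "B \<in> set Bs \<Longrightarrow> set js \<subseteq> B \<Longrightarrow> distinct js \<Longrightarrow> length js = s \<Longrightarrow>
    block_minor s k q js \<in> hyp_ideal s Bs k q"
  by (intro poly_module.span_base) (auto simp: hyp_gens_def)

lemma mono_poly_mem_hyp_ideal: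
  assumes "(i, j) \<in> keys t" "j \<in> \<Union>(set Bs)" "(i, j) \<notin> cells s (\<Union>(set Bs)) k"
  shows "mono_poly t \<in> hyp_ideal s Bs k q"
proof -
  let ?x = "single (i, j) (1::nat)"
  have "t = (t - ?x) + ?x"
    using assms(1) by (intro poly_mapping_eqI) (auto simp: lookup_add lookup_minus lookup_single in_keys_iff when_def)
  then have "mono_poly t = mono_poly (t - ?x) * (var_poly i j :: 'a polynomial)"
    by (metis mono_poly_add var_poly_def)
  moreover have "(var_poly i j :: 'a polynomial) \<in> hyp_gens s Bs k q"
    using assms(2,3) by (auto simp: hyp_gens_def)
  ultimately show ?thesis by (simp add: poly_module.span_base gen_ideal_mult)
qed


subsection \<open>Elimination in one column\<close>

lemma vdet_snoc_diff: "vdet (us @ [\<lambda>l. a * x l - b * y l]) = a * vdet (us @ [x]) - b * vdet (us @ [y])"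
  using vdet_snoc_sum[of "{0, 1::nat}" us "\<lambda>i. if i = 0 then a else - b" "\<lambda>i. if i = 0 then x else y"]
  by simp

text \<open>A change of coordinates in the column \<open>v\<close>. The pivot variable, which
  becomes a generator of the ideal when \<open>k v\<close> is raised, is carried to the linear
  form.\<close>

definition elim_map ::
  "nat \<Rightarrow> (nat \<Rightarrow> 'k) \<Rightarrow> nat \<Rightarrow> (nat \<Rightarrow> nat) \<Rightarrow> 'k frame \<Rightarrow>
    'k::field polynomial \<Rightarrow> 'k polynomial" where
  "elim_map s g v k q =
    poly_subst (\<lambda>i j. if i = Suc (k v) \<and> j = v then linform s g v k q else var_poly i j)"

lemma elim_map_ring_map: "ring_map (elim_map s g v k q)"
  unfolding elim_map_def by (rule poly_subst_ring_map)

lemma elim_map_simps: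
  "elim_map s g v k q (const_poly c) = const_poly c"
  "elim_map s g v k q (var_poly i j) =
    (if i = Suc (k v) \<and> j = v then linform s g v k q else var_poly i j)"
  by (simp_all add: elim_map_def)

text \<open>The image of the eliminated column \<open>v\<close> is \<open>hp * x_v - L * p\<close>,
  where \<open>p\<close> is the pivot and \<open>hp\<close> the value of the linear form at it. So a
  minor is carried to \<open>hp\<close> times the old minor, up to a multiple of
  \<open>L\<close>.\<close>

lemma elim_map_gens:
  assumes kv: "k v < s"
    and x: "x \<in> hyp_gens s Bs (k(v := Suc (k v))) (elim s g v k q)"
  shows "elim_map s g v k q x \<in> gen_ideal (insert (linform s g v k q) (hyp_gens s Bs k q))"
    (is "?\<alpha> x \<in> gen_ideal (insert ?L ?G)")
proof -
  let ?k = "k(v := Suc (k v))" and ?q = "elim s g v k q"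
  let ?V = "\<Union>(set Bs)"
  from x consider (var) i j where "x = var_poly i j" "j \<in> ?V" "(i, j) \<notin> cells s ?V ?k"
    | (minor) js B where "x = block_minor s ?k ?q js" "B \<in> set Bs" "set js \<subseteq> B" "distinct js" "length js = s"
    unfolding hyp_gens_def by blast
  then show ?thesis
  proof cases
    case var
    show ?thesis
    proof (cases "i = Suc (k v) \<and> j = v")
      case True
      then show ?thesis using var by (simp add: elim_map_simps poly_module.span_base)
    next
      case False
      then have "(i, j) \<notin> cells s ?V k"
        using var(3) by (auto simp: cells_def split: if_splits)
      then have "var_poly i j \<in> ?G" using var(2) by (auto simp: hyp_gens_def)
      moreover have "?\<alpha> x = var_poly i j" using False var(1) by (auto simp: elim_map_simps)
      ultimately show ?thesis by (simp add: poly_module.span_base)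
    qed
  next
    case minor
    let ?c = "\<lambda>j l. ?\<alpha> (gcol s ?k ?q j l)"
    have cj: "?c j = gcol s k q j" if "j \<noteq> v" for j
    proof
      fix l show "?c j l = gcol s k q j l"
        using that by (simp add: gcol_def column_def ring_map_sum[OF elim_map_ring_map]
            ring_mapD[OF elim_map_ring_map] elim_map_simps elim_def)
    qed
    let ?p = "\<lambda>l. const_poly (pivot k q v l)"
    let ?hp = "const_poly (dot s g (pivot k q v))"
    have cv: "?c v = (\<lambda>l. ?hp * gcol s k q v l - ?L * ?p l)"
    proof
      fix l
      let ?t = "\<lambda>i. var_poly i v * const_poly (dot s g (pivot k q v) * q v i l - dot s g (q v i) * pivot k q v l)"
      have "?c v l = (\<Sum>i\<in>{Suc (k v)<..s}. ?t i)"
        by (simp add: gcol_def column_def ring_map_sum[OF elim_map_ring_map]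
            ring_mapD[OF elim_map_ring_map] elim_map_simps elim_def)
      also have "\<dots> = (\<Sum>i\<in>{k v<..s}. ?t i)"
      proof -
        have "{k v<..s} = insert (Suc (k v)) {Suc (k v)<..s}" using kv by auto
        \<comment> \<open>Elimination turns the pivot itself into the zero vector, so the sum may
          start one row earlier.\<close>
        moreover have "?t (Suc (k v)) = 0" by (simp add: pivot_def)
        ultimately show ?thesis by simp
      qed
      also have "\<dots> = ?hp * gcol s k q v l - ?L * ?p l"
        by (simp add: gcol_def column_def linform_def sum_distrib_left sum_distrib_right sum_subtractf
            ring_mapD(3,6)[OF const_poly_ring_map] algebra_simps)
      finally show "?c v l = ?hp * gcol s k q v l - ?L * ?p l" .
    qed
    have ax: "?\<alpha> x = vdet (map ?c js)"
      unfolding minor(1) block_minor_def by (simp add: ring_map_vdet[OF elim_map_ring_map] comp_def)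
    show ?thesis
    proof (cases "v \<in> set js")
      case False
      then have "map ?c js = map (gcol s k q) js" by (intro map_cong refl cj) metis
      then have "?\<alpha> x = block_minor s k q js" by (simp only: ax block_minor_def)
      moreover have "block_minor s k q js \<in> gen_ideal ?G" using minor by (intro block_minor_mem) auto
      ultimately show ?thesis using poly_module.span_mono[of ?G "insert ?L ?G"] by auto
    next
      case True
      let ?us = "remove1 v js"
      have vus: "v \<notin> set ?us" using minor(4) by simp
      have "mset js = mset (?us @ [v])" using True by simp
      then have m: "mset (map ?c js) = mset (map ?c (?us @ [v]))" by (simp only: mset_map)
      have us: "map ?c ?us = map (gcol s k q) ?us"
        using vus cj by (intro map_cong refl) metis
      have "vdet (map ?c (?us @ [v])) =
          ?hp * block_minor s k q (?us @ [v]) - ?L * vdet (map (gcol s k q) ?us @ [?p])"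
        unfolding map_append list.map us cv block_minor_def by (rule vdet_snoc_diff)
      moreover have "block_minor s k q (?us @ [v]) \<in> gen_ideal ?G"
      proof (rule block_minor_mem[OF minor(2)])
        show "set (?us @ [v]) \<subseteq> B" using minor(3) True set_remove1_subset[of v js] by auto
        show "distinct (?us @ [v])" using minor(4) vus by simp
        show "length (?us @ [v]) = s"
          using minor(5) True length_pos_if_in_set[OF True] by (simp add: length_remove1)
      qed
      ultimately have "vdet (map ?c (?us @ [v])) \<in> gen_ideal (insert ?L ?G)"
        using poly_module.span_mono[of ?G "insert ?L ?G"]
        by (auto intro!: poly_module.span_diff gen_ideal_mult
            simp: mult.commute[of ?L] poly_module.span_base)
      then show ?thesis
        using vdet_mset[OF m] ax poly_module.span_neg[of "vdet (map ?c (?us @ [v]))"] by auto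
    qed
  qed
qed

text \<open>The pivot variable has the coefficient \<open>dot s g (pivot k q v)\<close> in the
  linear form. As this is invertible, the linear form can be solved for the pivot variable.\<close>

lemma elim_map_surj:
  assumes kv: "k v < s" and g: "dot s g (pivot k q v) \<noteq> 0" and p: "homog a p"
  obtains p' where "homog a p'" "elim_map s g v k q p' = p"
proof -
  let ?hp = "dot s g (pivot k q v)"
  let ?y = "const_poly (inverse ?hp) *
    (var_poly (Suc (k v)) v - (\<Sum>i\<in>{Suc (k v)<..s}. var_poly i v * const_poly (dot s g (q v i))))"
  let ?\<phi> = "\<lambda>i j. if i = Suc (k v) \<and> j = v then ?y else var_poly i j"
  let ?\<alpha> = "elim_map s g v k q"
  have hy: "homog (single v 1) ?y"
    using homog_mult[OF homog_var homog_const]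
    by (intro homog_const_mult homog_diff homog_var homog_sum) simp
  have "homog (single j 1) (?\<phi> i j)" for i j
    using hy homog_var[of j i] by (cases "i = Suc (k v) \<and> j = v") auto
  then have "homog a (poly_subst ?\<phi> p)" using p by (rule homog_poly_subst)
  moreover have "?\<alpha> (poly_subst ?\<phi> p) = p"
  proof (rule ring_map_eqI[OF ring_map_comp[OF elim_map_ring_map poly_subst_ring_map] ring_map_id])
    fix i j
    have "{k v<..s} = insert (Suc (k v)) {Suc (k v)<..s}" using kv by auto
    then have "linform s g v k q = var_poly (Suc (k v)) v * const_poly ?hp +
        (\<Sum>i\<in>{Suc (k v)<..s}. var_poly i v * const_poly (dot s g (q v i)))"
      by (simp add: linform_def pivot_def)
    moreover have "const_poly (inverse ?hp) * (var_poly (Suc (k v)) v * const_poly ?hp) =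
        (var_poly (Suc (k v)) v :: 'a polynomial)"
    proof -
      have "const_poly (inverse ?hp) * const_poly ?hp = (1 :: 'a polynomial)"
        using g by (simp flip: ring_mapD(3)[OF const_poly_ring_map])
      then show ?thesis unfolding mult.left_commute[of "const_poly (inverse ?hp)"] by (simp only: mult_1_right)
    qed
    ultimately have "?\<alpha> ?y = var_poly (Suc (k v)) v"
      by (simp add: ring_mapD[OF elim_map_ring_map] ring_map_sum[OF elim_map_ring_map] elim_map_simps)
    then show "?\<alpha> (poly_subst ?\<phi> (var_poly i j)) = var_poly i j"
      by (simp add: elim_map_simps)
  qed (simp add: elim_map_simps)
  ultimately show ?thesis by (rule that)
qed

lemma elim_map_std:
  assumes "keys d \<subseteq> std_set s Bs (k(v := Suc (k v))) a"
  shows "elim_map s g v k q d = d"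
proof -
  have "elim_map s g v k q d = poly_subst var_poly d"
    unfolding elim_map_def poly_subst_eq_poly_eval
  proof (rule poly_eval_cong)
    fix t x assume "t \<in> keys d" "x \<in> keys t"
    then have "x \<in> cells s (\<Union>(set Bs)) (k(v := Suc (k v)))"
      using assms std_cells[of s Bs] unfolding std_set_def by blast
    then show "(case x of (i, j) \<Rightarrow> if i = Suc (k v) \<and> j = v then linform s g v k q else var_poly i j) =
        (case x of (i, j) \<Rightarrow> var_poly i j)"
      by (auto simp: cells_def)
  qed
  then show ?thesis by (simp add: poly_subst_var)
qed


subsection \<open>Standard monomials span\<close>

text \<open>Degrees are confined to the columns of the blocks, since a variable of any other column
  is neither in a cell nor among the generators.\<close>

definition std_spans ::
  "nat \<Rightarrow> nat set list \<Rightarrow> (nat \<Rightarrow> nat) \<Rightarrow> 'k::field frame \<Rightarrow> bool" where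
  "std_spans s Bs k q \<longleftrightarrow> (\<forall>a p. keys a \<subseteq> \<Union>(set Bs) \<longrightarrow> homog a p \<longrightarrow>
    (\<exists>d. keys d \<subseteq> std_set s Bs k a \<and> p - d \<in> hyp_ideal s Bs k q))"

lemma homog_std: "keys d \<subseteq> std_set s Bs k a \<Longrightarrow> homog a d"
  by (auto simp: homog_def std_set_def)

text \<open>A polynomial is pulled back along \<open>elim_map\<close>, reduced for the restricted
  column and pushed forward again; the standard monomials obtained do not contain the pivot variable
  and are fixed. The price is a multiple of the linear form, with control of its degree.\<close>

lemma std_spans_elim:
  assumes sp: "std_spans s Bs (k(v := Suc (k v))) (elim s g v k q)"
    and kv: "k v < s" and g: "dot s g (pivot k q v) \<noteq> 0"
    and a: "keys a \<subseteq> \<Union>(set Bs)" and p: "homog a p"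
  obtains d r where "keys d \<subseteq> std_set s Bs (k(v := Suc (k v))) a"
    "p - d - r * linform s g v k q \<in> hyp_ideal s Bs k q"
    "r = 0 \<or> (\<exists>a'. a = a' + single v 1 \<and> homog a' r)"
proof -
  obtain p' where p': "homog a p'" "elim_map s g v k q p' = p"
    using elim_map_surj[OF kv g p] by blast
  obtain d where d: "keys d \<subseteq> std_set s Bs (k(v := Suc (k v))) a"
    "p' - d \<in> hyp_ideal s Bs (k(v := Suc (k v))) (elim s g v k q)"
    using sp a p'(1) unfolding std_spans_def by blast
  have "elim_map s g v k q (p' - d) \<in> gen_ideal (insert (linform s g v k q) (hyp_gens s Bs k q))"
    using elim_map_gens[where k = k and v = v and s = s, OF kv] d(2)
    by (rule gen_ideal_image[OF elim_map_ring_map])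
  then have "p - d \<in> gen_ideal (insert (linform s g v k q) (hyp_gens s Bs k q))"
    using p'(2) elim_map_std[OF d(1)] by (simp add: ring_mapD[OF elim_map_ring_map])
  moreover have "homog a (p - d)" using p homog_std[OF d(1)] by (rule homog_diff)
  ultimately show ?thesis
    using that[OF d(1)]
    by (elim homog_gen_ideal_insert[OF homog_hyp_gens homog_linform, rotated 1]) blast+
qed

section \<open>Splitting monomials by columns, and the pivot degree\<close>

definition restrict_cols :: "nat set \<Rightarrow> monomial \<Rightarrow> monomial" where
  "restrict_cols X t =
    (\<Sum>v\<in>{v \<in> keys t. snd v \<in> X}. single v (lookup t v))"

lemma lookup_restrict_cols:
  "lookup (restrict_cols X t) v = (if snd v \<in> X then lookup t v else 0)"
  by (auto simp: restrict_cols_def lookup_sum lookup_single when_def in_keys_iff)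

lemma keys_restrict_cols: "keys (restrict_cols X t) = {v \<in> keys t. snd v \<in> X}"
  by (auto simp: in_keys_iff lookup_restrict_cols split: if_splits)

lemma restrict_cols_split: "restrict_cols X t + restrict_cols (- X) t = t"
  by (intro poly_mapping_eqI) (auto simp: lookup_add lookup_restrict_cols)

text \<open>The termination measure for rewriting with minors; \<open>W\<close> will be the set of
  new columns of the last block.\<close>

definition pivot_degree :: "(nat \<Rightarrow> nat) \<Rightarrow> nat set \<Rightarrow> monomial \<Rightarrow> nat" where
  "pivot_degree k W t = (\<Sum>j\<in>W. lookup t (Suc (k j), j))"

lemma pivot_degree_add: "pivot_degree k W (t + u) = pivot_degree k W t + pivot_degree k W u"
  by (simp add: pivot_degree_def lookup_add sum.distrib)

lemma lookup_choice_monomial: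
  "lookup (choice_monomial js f) v = card {b. b < length js \<and> (f b, js ! b) = v}"
proof -
  have "lookup (choice_monomial js f) v = (\<Sum>b = 0..<length js. if (f b, js ! b) = v then 1 else (0::nat))"
    by (simp add: choice_monomial_def lookup_sum lookup_single when_def cong: if_cong)
  also have "\<dots> = card ({0..<length js} \<inter> {b. (f b, js ! b) = v})"
    by (simp add: sum.If_cases)
  also have "{0..<length js} \<inter> {b. (f b, js ! b) = v} = {b. b < length js \<and> (f b, js ! b) = v}"
    by auto
  finally show ?thesis .
qed

lemma pivot_degree_choice_monomial:
  assumes "finite W"
  shows "pivot_degree k W (choice_monomial js f) =
    card {b. b < length js \<and> js ! b \<in> W \<and> f b = Suc (k (js ! b))}"
proof -
  have "pivot_degree k W (choice_monomial js f) =
      card (\<Union>j\<in>W. {b. b < length js \<and> (f b, js ! b) = (Suc (k j), j)})"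
    unfolding pivot_degree_def lookup_choice_monomial
    using assms by (intro card_UN_disjoint[symmetric]) auto
  also have "(\<Union>j\<in>W. {b. b < length js \<and> (f b, js ! b) = (Suc (k j), j)}) =
      {b. b < length js \<and> js ! b \<in> W \<and> f b = Suc (k (js ! b))}"
    by auto
  finally show ?thesis .
qed

lemma sub_monomial:
  fixes t m :: monomial
  assumes "\<And>v. lookup m v \<le> lookup t v"
  shows "t - m + m = t"
  using assms by (intro poly_mapping_eqI) (simp add: lookup_add lookup_minus)

lemma choice_monomial_le:
  assumes "distinct js" "\<And>b. b < length js \<Longrightarrow> (f b, js ! b) \<in> keys t"
  shows "t - choice_monomial js f + choice_monomial js f = t"
proof (rule sub_monomial)
  fix v
  have sub: "{b. b < length js \<and> (f b, js ! b) = v} \<subseteq> {b. b < length js \<and> js ! b = snd v}" by auto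
  have "card {b. b < length js \<and> (f b, js ! b) = v} \<le> 1"
    unfolding One_nat_def using assms(1)
    by (subst card_le_Suc0_iff_eq) (auto simp: nth_eq_iff_index_eq)
  moreover have "card {b. b < length js \<and> (f b, js ! b) = v} = 0 \<or> v \<in> keys t"
    using assms(2) by (cases "{b. b < length js \<and> (f b, js ! b) = v} = {}") auto
  ultimately show "lookup (choice_monomial js f) v \<le> lookup t v"
    unfolding lookup_choice_monomial in_keys_iff by arith
qed

lemma gen_pos_pivots:
  assumes "gen_pos s (B # Bs) k q" "distinct js" "length js = s" "set js \<subseteq> {j \<in> B. k j < s}"
  shows "vdet (map (pivot k q) js) \<noteq> 0"
  using assms by simp

text \<open>The new columns alone decide which pivots occur, and hence which \<open>k\<close> is
  passed on. The part in the old columns may therefore be replaced by any monomial \<open>w\<close>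
  of the same degree that is standard for this \<open>k\<close>.\<close>

lemma std_block_mult:
  assumes "keys a \<subseteq> B \<union> \<Union>(set Bs)" "mdeg t = a"
    and cells: "keys t \<subseteq> cells s (B \<union> \<Union>(set Bs)) k"
    and U: "card {j \<in> B - \<Union>(set Bs). (Suc (k j), j) \<in> keys t} < s"
    and w: "w \<in> std_set s Bs
      (if card {j \<in> B - \<Union>(set Bs). (Suc (k j), j) \<in> keys t} = s - 1 then bump B k else k)
      (mdeg (restrict_cols (\<Union>(set Bs)) t))"
  shows "restrict_cols (- \<Union>(set Bs)) t + w \<in> std_set s (B # Bs) k a"
proof -
  let ?A = "\<Union>(set Bs)"
  let ?r = "restrict_cols (- ?A) t"
  let ?k = "if card {j \<in> B - ?A. (Suc (k j), j) \<in> keys t} = s - 1 then bump B k else k"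
  have wc: "keys w \<subseteq> cells s ?A ?k" using w std_cells by (auto simp: std_set_def)
  then have wc': "keys w \<subseteq> cells s ?A k"
    by (fastforce simp: cells_def bump_def split: if_splits)
  have keys: "keys (?r + w) = {v \<in> keys t. snd v \<notin> ?A} \<union> keys w"
    by (auto simp: in_keys_iff lookup_add lookup_restrict_cols split: if_splits)
  have A: "snd v \<in> ?A" if "v \<in> keys w" for v
    using subsetD[OF wc that] by (cases v) (simp add: cells_def)
  have "keys (?r + w) \<subseteq> cells s (B \<union> ?A) k"
    using keys cells wc' by (auto simp: cells_def)
  moreover have "{j \<in> B - ?A. (Suc (k j), j) \<in> keys (?r + w)} =
      {j \<in> B - ?A. (Suc (k j), j) \<in> keys t}"
    unfolding keys using A by fastforce
  moreover have "{v \<in> keys (?r + w). snd v \<in> ?A} = keys w"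
    unfolding keys using A by auto
  ultimately have "std s (B # Bs) k (keys (?r + w))"
    using U w by (simp add: std_set_def)
  moreover have "mdeg (?r + w) = a"
    using w restrict_cols_split[of ?A t] assms(2)
    by (simp add: std_set_def mdeg_add) (metis add.commute mdeg_add)
  ultimately show ?thesis by (simp add: std_set_def)
qed

text \<open>The right-hand side collects those terms of the minor on \<open>us\<close> and
  \<open>v\<close> that use the pivot in every column of \<open>us\<close>. A choice function in
  this set is determined by its last value, and the sum over that value is the expansion of the
  determinant along the last row.\<close>

lemma block_minor_snoc:
  assumes "Suc (length us) = s" and kus: "\<And>j. j \<in> set us \<Longrightarrow> k j < s"
  shows "mono_poly (choice_monomial us (\<lambda>b. Suc (k (us ! b)))) *
      linform s (cofactors (map (pivot k q) us)) v k q =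
    (\<Sum>f\<in>{f \<in> PiE {0..<s} (\<lambda>b. {k ((us @ [v]) ! b)<..s}). \<forall>b<length us. f b = Suc (k (us ! b))}.
      mono_poly (choice_monomial (us @ [v]) f) *
      const_poly (vdet (map (\<lambda>b. q ((us @ [v]) ! b) (f b)) [0..<s])))" (is "?l = sum ?t ?F")
proof -
  let ?n = "length us"
  let ?ext = "\<lambda>i. \<lambda>b\<in>{0..<s}. if b < ?n then Suc (k (us ! b)) else i"
  have s: "s = Suc ?n" using assms by simp
  have "sum ?t ?F = (\<Sum>i\<in>{k v<..s}. ?t (?ext i))"
  proof (rule sum.reindex_bij_witness[of _ ?ext "\<lambda>f. f ?n"])
    fix f assume f: "f \<in> ?F"
    have "f b = ?ext (f ?n) b" for b
    proof (cases "b < s")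
      case True
      then show ?thesis using f s by (cases "b = ?n") auto
    next
      case False
      then show ?thesis using f by (auto simp: PiE_def extensional_def)
    qed
    then show eq: "?ext (f ?n) = f" by (intro ext) simp
    show "f ?n \<in> {k v<..s}" using f s by (fastforce simp: PiE_def Pi_def nth_append)
    show "?t (?ext (f ?n)) = ?t f" using eq by simp
  next
    fix i assume i: "i \<in> {k v<..s}"
    show "?ext i ?n = i" using s by simp
    show "?ext i \<in> ?F" using i s kus[OF nth_mem] by (auto simp: PiE_def Pi_def nth_append Suc_le_eq)
  qed
  also have "\<dots> = (\<Sum>i\<in>{k v<..s}. mono_poly (choice_monomial us (\<lambda>b. Suc (k (us ! b)))) *
      (var_poly i v * const_poly (dot s (cofactors (map (pivot k q) us)) (q v i))))"
  proof (rule sum.cong[OF refl])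
    fix i assume "i \<in> {k v<..s}"
    have "choice_monomial (us @ [v]) (?ext i) = choice_monomial us (\<lambda>b. Suc (k (us ! b))) + single (i, v) 1"
      using s by (simp add: choice_monomial_def nth_append)
    moreover have "map (\<lambda>b. q ((us @ [v]) ! b) (?ext i b)) [0..<s] = map (pivot k q) us @ [q v i]"
      using s by (intro nth_equalityI) (auto simp: nth_append pivot_def)
    ultimately show "?t (?ext i) = mono_poly (choice_monomial us (\<lambda>b. Suc (k (us ! b)))) *
      (var_poly i v * const_poly (dot s (cofactors (map (pivot k q) us)) (q v i)))"
      using s by (simp add: mono_poly_add var_poly_def dot_cofactors mult.assoc)
  qed
  finally show ?thesis by (simp add: linform_def sum_distrib_left)
qed

text \<open>Besides products of \<open>s\<close> pivots, products of \<open>s - 1\<close> pivots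
  call for rewriting: the minor that also contains the glued column equals the product of these
  pivots times a linear form of the glued column, up to terms with fewer pivots. The old part of the
  monomial may thus be reduced modulo this linear form, which is reduction for the restricted
  column.\<close>

lemma std_spans:
  assumes "forest_blocks Bs" "s \<ge> 1" "gen_pos s Bs k q"
  shows "std_spans s Bs k q"
  using assms
proof (induction Bs arbitrary: k q)
  case Nil
  show ?case
    unfolding std_spans_def
  proof (intro allI impI)
    fix a and p :: "'a polynomial"
    assume a: "keys a \<subseteq> \<Union>(set [])" and p: "homog a p"
    have "keys p \<subseteq> std_set s [] k a"
    proof
      fix t assume "t \<in> keys p"
      then have "mdeg t = a" using p by (simp add: homog_def)
      moreover then have "keys t = {}" using a keys_mdeg[of t] by auto
      ultimately show "t \<in> std_set s [] k a" by (simp add: std_set_def)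
    qed
    then show "\<exists>d. keys d \<subseteq> std_set s [] k a \<and> p - d \<in> hyp_ideal s [] k q"
      by (intro exI[of _ p]) (simp add: poly_module.span_zero)
  qed
next
  case (Cons B Bs)
  let ?A = "\<Union>(set Bs)" and ?V = "\<Union>(set (B # Bs))"
  let ?W = "B - ?A"
  let ?I = "hyp_ideal s (B # Bs) k q"
  have finW: "finite ?W" and blocks: "forest_blocks Bs" using Cons.prems(1) by auto
  have s: "s \<ge> 1" by fact
  have gp: "gen_pos s Bs k q" using Cons.prems(3) by simp
  have AB: "card (B \<inter> ?A) \<le> 1" using Cons.prems(1) by simp
  have V: "?V = B \<union> ?A" by simp
  show ?case
    unfolding std_spans_def
  proof (intro allI impI)
    fix a and p :: "'a polynomial"
    assume a: "keys a \<subseteq> ?V" and p: "homog a p"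
    define NF where "NF = {p. \<exists>d. keys d \<subseteq> std_set s (B # Bs) k a \<and> p - d \<in> ?I}"
    have NF_I: "x \<in> NF" if "x \<in> ?I" for x
      unfolding NF_def using that by (intro CollectI exI[of _ 0]) simp
    have NF_add: "x + y \<in> NF" if xy: "x \<in> NF" "y \<in> NF" for x y
    proof -
      obtain d e where "keys d \<subseteq> std_set s (B # Bs) k a" "x - d \<in> ?I"
        "keys e \<subseteq> std_set s (B # Bs) k a" "y - e \<in> ?I"
        using xy by (auto simp: NF_def)
      then have "keys (d + e) \<subseteq> std_set s (B # Bs) k a" "x + y - (d + e) \<in> ?I"
        using Poly_Mapping.keys_add[of d e] poly_module.span_add[of "x - d" _ "y - e"]
        by (auto simp: algebra_simps)
      then show ?thesis unfolding NF_def by blast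
    qed
    have NF_scale: "const_poly c * x \<in> NF" if x: "x \<in> NF" for c x
    proof -
      obtain d where "keys d \<subseteq> std_set s (B # Bs) k a" "x - d \<in> ?I"
        using x by (auto simp: NF_def)
      then have "keys (const_poly c * d) \<subseteq> std_set s (B # Bs) k a"
        "const_poly c * x - const_poly c * d \<in> ?I"
        using keys_const_mult[of c d] gen_ideal_mult[of "x - d" _ "const_poly c"]
        by (auto simp: algebra_simps)
      then show ?thesis unfolding NF_def by blast
    qed
    have NF_uminus: "- x \<in> NF" if "x \<in> NF" for x
      using NF_scale[OF that, of "-1"] by (simp add: ring_mapD(5)[OF const_poly_ring_map])
    have NF_diff: "x - y \<in> NF" if "x \<in> NF" "y \<in> NF" for x y
      using NF_add[OF that(1) NF_uminus[OF that(2)]] by simp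
    have NF_sum: "sum f X \<in> NF" if "\<And>x. x \<in> X \<Longrightarrow> f x \<in> NF" for f and X :: "'i set"
      using that by (induction X rule: infinite_finite_induct)
        (auto intro: NF_add NF_I poly_module.span_zero)
    have NF_std: "d \<in> NF" if "keys d \<subseteq> std_set s (B # Bs) k a" for d
      unfolding NF_def using that by (intro CollectI exI[of _ d]) (simp add: poly_module.span_zero)
    have main: "mono_poly t \<in> NF" if "mdeg t = a" for t
      using that
    proof (induction "pivot_degree k ?W t" arbitrary: t rule: less_induct)
      case less
      let ?U = "{j \<in> ?W. (Suc (k j), j) \<in> keys t}"
      have IH: "mono_poly u \<in> NF" if "pivot_degree k ?W u < pivot_degree k ?W t" "mdeg u = a" for u
        using less.hyps that by blast
      have snd_t: "snd v \<in> ?V" if "v \<in> keys t" for v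
        using a that unfolding less.prems[symmetric] keys_mdeg by blast
      show ?case
      proof (cases "keys t \<subseteq> cells s ?V k")
        case False
        then obtain i j where ij: "(i, j) \<in> keys t" "(i, j) \<notin> cells s ?V k"
          by (meson subrelI)
        then show ?thesis using snd_t[OF ij(1)] by (intro NF_I mono_poly_mem_hyp_ideal[OF ij(1) _ ij(2)]) auto
      next
        case cells: True
        have finU: "finite ?U" by (rule finite_subset[OF _ finW]) auto
        have kU: "k j < s" if "j \<in> ?U" for j using cells that by (auto simp: cells_def)
        \<comment> \<open>In the third case the old columns are reduced with \<open>k\<close>
          unchanged. If \<open>s - 1\<close> pivots occur there, either no column is glued or the
          glued one has no coordinates left, so that \<open>bump\<close> has no effect.\<close>
        consider "card ?U \<ge> s"
          | v where "card ?U = s - 1" "v \<in> B \<inter> ?A" "k v < s"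
          | "card ?U < s" "card ?U = s - 1 \<Longrightarrow> (\<forall>v\<in>B \<inter> ?A. s \<le> k v)"
          using s not_le by blast
        then show ?thesis
        proof cases
          case 1
          then obtain U' where U': "U' \<subseteq> ?U" "card U' = s" by (rule obtain_subset_with_card_n)
          obtain js where js: "set js = U'" "distinct js"
            using finite_distinct_list finite_subset[OF U'(1) finU] by blast
          have len: "length js = s" using js U' distinct_card by fastforce
          have jsU: "js ! b \<in> ?U" if "b < s" for b using that len js(1) U'(1) nth_mem by blast
          let ?P = "PiE {0..<s} (\<lambda>b. {k (js ! b)<..s})"
          let ?f0 = "\<lambda>b\<in>{0..<s}. Suc (k (js ! b))"
          let ?m = "t - choice_monomial js ?f0"
          let ?D = "\<lambda>f. vdet (map (\<lambda>b. q (js ! b) (f b)) [0..<s])"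
          have f0: "?f0 \<in> ?P" using jsU kU by (auto simp: PiE_def Pi_def Suc_le_eq)
          have tm: "?m + choice_monomial js ?f0 = t"
            using js jsU len by (intro choice_monomial_le) auto
          have D0: "?D ?f0 \<noteq> 0"
          proof -
            have "map (\<lambda>b. q (js ! b) (?f0 b)) [0..<s] = map (pivot k q) js"
              using len by (intro nth_equalityI) (auto simp: pivot_def)
            moreover have "set js \<subseteq> {j \<in> B. k j < s}" using js U' kU by blast
            ultimately show ?thesis using gen_pos_pivots[OF Cons.prems(3) js(2) len] by simp
          qed
          have finP: "finite ?P" by (intro finite_PiE) auto
          have "mono_poly ?m * block_minor s k q js =
              (\<Sum>f\<in>?P. const_poly (?D f) * mono_poly (?m + choice_monomial js f))"
            unfolding block_minor_expand[OF len] sum_distrib_left by (simp add: mono_poly_add mult_ac)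
          also have "\<dots> = const_poly (?D ?f0) * mono_poly t +
              (\<Sum>f\<in>?P - {?f0}. const_poly (?D f) * mono_poly (?m + choice_monomial js f))"
            using sum.remove[OF finP f0, of "\<lambda>f. const_poly (?D f) * mono_poly (?m + choice_monomial js f) :: 'a polynomial"]
            unfolding tm .
          finally have eq: "const_poly (?D ?f0) * mono_poly t = mono_poly ?m * block_minor s k q js -
              (\<Sum>f\<in>?P - {?f0}. const_poly (?D f) * mono_poly (?m + choice_monomial js f))"
            by simp
          have "const_poly (?D ?f0) * mono_poly t \<in> NF"
            unfolding eq
          proof (intro NF_diff NF_sum NF_scale IH)
            have "block_minor s k q js \<in> ?I"
              using js U' len by (intro block_minor_mem[of B]) auto
            then show "mono_poly ?m * block_minor s k q js \<in> NF" by (intro NF_I gen_ideal_mult)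
            fix f assume f: "f \<in> ?P - {?f0}"
            have "\<exists>b<s. f b \<noteq> Suc (k (js ! b))"
            proof (rule ccontr)
              assume "\<not> ?thesis"
              then have "f b = ?f0 b" for b
                using f by (cases "b < s") (auto simp: PiE_def extensional_def)
              then show False using f by auto
            qed
            then have "{b. b < length js \<and> js ! b \<in> ?W \<and> f b = Suc (k (js ! b))} \<subset>
                {b. b < length js \<and> js ! b \<in> ?W \<and> ?f0 b = Suc (k (js ! b))}"
              using len jsU by auto
            then have "pivot_degree k ?W (choice_monomial js f) < pivot_degree k ?W (choice_monomial js ?f0)"
              unfolding pivot_degree_choice_monomial[OF finW] by (intro psubset_card_mono) auto
            then show "pivot_degree k ?W (?m + choice_monomial js f) < pivot_degree k ?W t"
              using arg_cong[OF tm, of "pivot_degree k ?W"] by (simp add: pivot_degree_add)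
            show "mdeg (?m + choice_monomial js f) = a"
              using arg_cong[OF tm, of mdeg] less.prems by (simp add: mdeg_add mdeg_choice_monomial)
          qed
          then have "const_poly (inverse (?D ?f0)) * (const_poly (?D ?f0) * mono_poly t) \<in> NF"
            by (rule NF_scale)
          then show ?thesis
            using D0 by (simp flip: mult.assoc ring_mapD(3)[OF const_poly_ring_map])
        next
          case 2
          obtain us where us: "set us = ?U" "distinct us" using finite_distinct_list[OF finU] by blast
          have len: "Suc (length us) = s" using us 2 s distinct_card[OF us(2)] by simp
          let ?n = "length us"
          let ?g = "cofactors (map (pivot k q) us)"
          let ?L = "linform s ?g v k q"
          let ?r = "restrict_cols (- ?A) t" and ?tA = "restrict_cols ?A t"
          have usU: "us ! b \<in> ?U" if "b < ?n" for b using that us(1) nth_mem by blast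
          have vus: "v \<notin> set us" using us 2 by auto
          have ABv: "B \<inter> ?A = {v}"
          proof -
            have "card (B \<inter> ?A) \<le> 1" by (rule AB)
            moreover have "finite (B \<inter> ?A)" using Cons.prems(1) by simp
            ultimately show ?thesis using 2(2) card_le_Suc0_iff_eq[of "B \<inter> ?A"] by auto
          qed
          have gp': "gen_pos s Bs (k(v := Suc (k v))) (elim s ?g v k q)"
          proof -
            have "set us \<subseteq> {j \<in> B - ?A. k j < s}" using us(1) kU by auto
            then show ?thesis using Cons.prems(3) us(2) len 2(2,3) by auto
          qed
          have gpv: "dot s ?g (pivot k q v) \<noteq> 0"
          proof -
            have "dot s ?g (pivot k q v) = vdet (map (pivot k q) (us @ [v]))"
              using len by (simp add: dot_cofactors)
            also have "\<dots> \<noteq> 0"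
              using us vus len 2 kU by (intro gen_pos_pivots[OF Cons.prems(3)]) auto
            finally show ?thesis .
          qed
          have homA: "homog (mdeg ?tA) (mono_poly ?tA :: 'a polynomial)" by simp
          have keysA: "keys (mdeg ?tA) \<subseteq> ?A" by (auto simp: keys_mdeg keys_restrict_cols)
          obtain d r where d: "keys d \<subseteq> std_set s Bs (k(v := Suc (k v))) (mdeg ?tA)"
            and i: "mono_poly ?tA - d - r * ?L \<in> hyp_ideal s Bs k q"
            and r: "r = 0 \<or> (\<exists>a'. mdeg ?tA = a' + single v 1 \<and> homog a' r)"
            using std_spans_elim[OF Cons.IH[OF blocks s gp'] 2(3) gpv keysA homA] by blast
          let ?i = "mono_poly ?tA - d - r * ?L"
          have t_eq: "mono_poly t = mono_poly ?r * d + mono_poly ?r * ?i + mono_poly ?r * (r * ?L)"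
          proof -
            have "mono_poly t = mono_poly ?r * (mono_poly ?tA :: 'a polynomial)"
              using restrict_cols_split[of ?A t] by (metis add.commute mono_poly_add)
            then show ?thesis by (simp add: algebra_simps)
          qed
          have "mono_poly ?r * d \<in> NF"
          proof (rule NF_std, rule subsetI)
            fix u assume "u \<in> keys (mono_poly ?r * d)"
            then obtain w where w: "u = ?r + w" "w \<in> keys d"
              using keys_mono_mult[of ?r d] by auto
            have "std s Bs (k(v := Suc (k v))) S \<longleftrightarrow> std s Bs (bump B k) S" for S
              using ABv by (intro std_cong) (auto simp: bump_def)
            then have "w \<in> std_set s Bs (if card ?U = s - 1 then bump B k else k) (mdeg ?tA)"
              using d w(2) 2(1) unfolding std_set_def by auto
            then show "u \<in> std_set s (B # Bs) k a"
              unfolding w(1) using a less.prems cells 2(1) s by (intro std_block_mult) auto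
          qed
          moreover have "mono_poly ?r * ?i \<in> NF"
            using i by (intro NF_I gen_ideal_mult hyp_ideal_Cons)
          moreover have "mono_poly ?r * (r * ?L) \<in> NF"
          proof (cases "r = 0")
            case False
            then obtain a' where a': "mdeg ?tA = a' + single v 1" "homog a' r" using r by blast
            let ?c = "choice_monomial us (\<lambda>b. Suc (k (us ! b)))"
            let ?m = "?r - ?c"
            have rm: "?m + ?c = ?r"
              using us usU by (intro choice_monomial_le) (auto simp: keys_restrict_cols)
            have step: "mono_poly ?r * ?L * mono_poly u \<in> NF" if u: "u \<in> keys r" for u
            proof -
              let ?js = "us @ [v]"
              let ?P = "PiE {0..<s} (\<lambda>b. {k (?js ! b)<..s})"
              let ?F = "{f \<in> ?P. \<forall>b<?n. f b = Suc (k (us ! b))}"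
              let ?D = "\<lambda>f. vdet (map (\<lambda>b. q (?js ! b) (f b)) [0..<s])"
              let ?T = "\<lambda>f. mono_poly (choice_monomial ?js f) * const_poly (?D f) :: 'a polynomial"
              have mu: "mdeg u = a'" using a'(2) u by (simp add: homog_def)
              have finP: "finite ?P" by (intro finite_PiE) auto
              have len': "length ?js = s" using len by simp
              have "block_minor s k q ?js = sum ?T ?F + sum ?T (?P - ?F)"
                unfolding block_minor_expand[OF len'] using finP
                by (subst sum.subset_diff[of ?F ?P]) auto
              also have "sum ?T ?F = mono_poly ?c * ?L"
                using block_minor_snoc[OF len, of k q v] us(1) kU by auto
              finally have "mono_poly ?c * ?L = block_minor s k q ?js - sum ?T (?P - ?F)" by simp
              then have "mono_poly ?m * mono_poly u * (mono_poly ?c * ?L) =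
                  mono_poly ?m * mono_poly u * block_minor s k q ?js -
                  (\<Sum>f\<in>?P - ?F. const_poly (?D f) * mono_poly (?m + u + choice_monomial ?js f))"
                by (simp add: right_diff_distrib sum_distrib_left mono_poly_add mult_ac)
              moreover have "mono_poly ?m * mono_poly u * (mono_poly ?c * ?L) = mono_poly ?r * ?L * mono_poly u"
                by (subst rm[symmetric]) (simp only: mono_poly_add mult_ac)
              ultimately have eq: "mono_poly ?r * ?L * mono_poly u =
                  mono_poly ?m * mono_poly u * block_minor s k q ?js -
                  (\<Sum>f\<in>?P - ?F. const_poly (?D f) * mono_poly (?m + u + choice_monomial ?js f))" by simp
              \<comment> \<open>The cofactor \<open>r\<close> lives in the old columns, so
                multiplying by its monomials does not contribute to the pivot degree of the new
                ones.\<close>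
              have snd_u: "snd w \<in> ?A" if "w \<in> keys u" for w
              proof -
                have "snd w \<in> keys (mdeg u)" using that by (simp add: keys_mdeg)
                then have "snd w \<in> keys (mdeg ?tA)"
                  unfolding a'(1) mu by (simp add: in_keys_iff lookup_add)
                then show ?thesis using keysA by blast
              qed
              show ?thesis
                unfolding eq
              proof (intro NF_diff NF_sum NF_scale IH)
                have "block_minor s k q ?js \<in> ?I"
                  using us(1) 2(2) vus us(2) len' by (intro block_minor_mem[of B]) auto
                then show "mono_poly ?m * mono_poly u * block_minor s k q ?js \<in> NF"
                  by (intro NF_I gen_ideal_mult)
                fix f assume f: "f \<in> ?P - ?F"
                then obtain b where b: "b < ?n" "f b \<noteq> Suc (k (us ! b))" by auto
                \<comment> \<open>The last position belongs to \<open>v\<close>, which is not a new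
                  column and never counts; and \<open>b\<close> is a position among the others where
                  the pivot is missed.\<close>
                have "{b. b < length ?js \<and> ?js ! b \<in> ?W \<and> f b = Suc (k (?js ! b))} \<subset> {..<?n}"
                proof (rule psubsetI)
                  show "{b. b < length ?js \<and> ?js ! b \<in> ?W \<and> f b = Suc (k (?js ! b))} \<subseteq> {..<?n}"
                    using 2(2) by (auto simp: nth_append split: if_splits)
                  have "b \<notin> {b. b < length ?js \<and> ?js ! b \<in> ?W \<and> f b = Suc (k (?js ! b))}"
                    using b by (auto simp: nth_append)
                  then show "{b. b < length ?js \<and> ?js ! b \<in> ?W \<and> f b = Suc (k (?js ! b))} \<noteq> {..<?n}"
                    using b by blast
                qed
                from psubset_card_mono[OF finite_lessThan this]
                have "card {b. b < length ?js \<and> ?js ! b \<in> ?W \<and> f b = Suc (k (?js ! b))} < ?n"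
                  by (simp only: card_lessThan)
                then have "pivot_degree k ?W (choice_monomial ?js f) < ?n"
                  unfolding pivot_degree_choice_monomial[OF finW] .
                moreover have "pivot_degree k ?W ?c = ?n"
                proof -
                  have "{b. b < length us \<and> us ! b \<in> ?W \<and> Suc (k (us ! b)) = Suc (k (us ! b))} = {..<?n}"
                    using usU by auto
                  then show ?thesis unfolding pivot_degree_choice_monomial[OF finW] by simp
                qed
                moreover have "pivot_degree k ?W u = 0"
                  unfolding pivot_degree_def
                proof (rule sum.neutral, rule ballI)
                  fix j assume "j \<in> ?W"
                  then have "(Suc (k j), j) \<notin> keys u"
                    using snd_u[of "(Suc (k j), j)"] by (metis DiffE snd_conv)
                  then show "lookup u (Suc (k j), j) = 0"
                    unfolding in_keys_iff by blast
                qed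
                moreover have "pivot_degree k ?W ?r = pivot_degree k ?W t"
                  by (simp add: pivot_degree_def lookup_restrict_cols)
                ultimately show "pivot_degree k ?W (?m + u + choice_monomial ?js f) < pivot_degree k ?W t"
                  using arg_cong[OF rm, of "pivot_degree k ?W"] by (simp add: pivot_degree_add)
                have "mdeg (choice_monomial ?js f) = mdeg ?c + single v 1"
                  by (simp add: mdeg_choice_monomial nth_append)
                then have "mdeg (?m + u + choice_monomial ?js f) = mdeg ?r + mdeg ?tA"
                  using arg_cong[OF rm, of mdeg] unfolding a'(1) mdeg_add mu by (simp only: add_ac)
                also have "\<dots> = a"
                  using restrict_cols_split[of ?A t] less.prems by (metis add.commute mdeg_add)
                finally show "mdeg (?m + u + choice_monomial ?js f) = a" .
              qed
            qed
            have "mono_poly ?r * (r * ?L) = (\<Sum>u\<in>keys r.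
                const_poly (lookup r u) * (mono_poly ?r * ?L * mono_poly u))"
              by (subst homog_eq_sum[OF a'(2)]) (simp add: sum_distrib_left sum_distrib_right mult_ac)
            then show ?thesis using step by (simp only:) (intro NF_sum NF_scale)
          qed (simp add: NF_I poly_module.span_zero)
          ultimately show ?thesis unfolding t_eq by (intro NF_add)
        next
          case 3
          let ?r = "restrict_cols (- ?A) t" and ?tA = "restrict_cols ?A t"
          have homA: "homog (mdeg ?tA) (mono_poly ?tA :: 'a polynomial)" by simp
          have keysA: "keys (mdeg ?tA) \<subseteq> ?A" by (auto simp: keys_mdeg keys_restrict_cols)
          obtain d where d: "keys d \<subseteq> std_set s Bs k (mdeg ?tA)"
            and i: "mono_poly ?tA - d \<in> hyp_ideal s Bs k q"
            using Cons.IH[OF blocks s gp] keysA homA unfolding std_spans_def by blast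
          have t_eq: "mono_poly t = mono_poly ?r * d + mono_poly ?r * (mono_poly ?tA - d)"
          proof -
            have "mono_poly t = mono_poly ?r * (mono_poly ?tA :: 'a polynomial)"
              using restrict_cols_split[of ?A t] by (metis add.commute mono_poly_add)
            then show ?thesis by (simp add: algebra_simps)
          qed
          have "mono_poly ?r * d \<in> NF"
          proof (rule NF_std, rule subsetI)
            fix u assume "u \<in> keys (mono_poly ?r * d)"
            then obtain w where w: "u = ?r + w" "w \<in> keys d"
              using keys_mono_mult[of ?r d] by auto
            have "std s Bs (bump B k) S \<longleftrightarrow> std s Bs k S" if c: "card ?U = s - 1" for S
            proof (rule std_cong)
              fix j assume "j \<in> ?A"
              then have "j \<in> B \<Longrightarrow> s \<le> k j" using 3(2)[OF c] by blast
              then show "min s (bump B k j) = min s (k j)"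
                by (auto simp: bump_def)
            qed
            then have "w \<in> std_set s Bs (if card ?U = s - 1 then bump B k else k) (mdeg ?tA)"
              using d w(2) unfolding std_set_def by auto
            then show "u \<in> std_set s (B # Bs) k a"
              unfolding w(1) using a less.prems cells 3(1) by (intro std_block_mult) auto
          qed
          moreover have "mono_poly ?r * (mono_poly ?tA - d) \<in> NF"
            using i by (intro NF_I gen_ideal_mult hyp_ideal_Cons)
          ultimately show ?thesis unfolding t_eq by (rule NF_add)
        qed
      qed
    qed
    have "p = (\<Sum>t\<in>keys p. const_poly (lookup p t) * mono_poly t)"
      by (rule homog_eq_sum[OF p])
    moreover have "\<dots> \<in> NF"
      using p by (intro NF_sum NF_scale main) (simp add: homog_def)
    ultimately show "\<exists>d. keys d \<subseteq> std_set s (B # Bs) k a \<and> p - d \<in> ?I"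
      by (simp add: NF_def)
  qed
qed

subsection \<open>Multiplication by a linear form of one column\<close>

interpretation poly_vs: vector_space "poly_scale :: 'k::field \<Rightarrow> 'k polynomial \<Rightarrow> 'k polynomial"
  by (rule poly_scale_vector_space)

definition std_indep ::
  "nat \<Rightarrow> nat set list \<Rightarrow> (nat \<Rightarrow> nat) \<Rightarrow> 'k::field frame \<Rightarrow> bool" where
  "std_indep s Bs k q \<longleftrightarrow>
    (\<forall>a d. keys d \<subseteq> std_set s Bs k a \<longrightarrow> d \<in> hyp_ideal s Bs k q \<longrightarrow> d = 0)"

lemma inj_mono_poly: "inj (mono_poly :: monomial \<Rightarrow> 'k::field polynomial)"
proof (rule injI)
  fix t u assume "mono_poly t = (mono_poly u :: 'k polynomial)"
  then have "keys (mono_poly t :: 'k polynomial) = keys (mono_poly u :: 'k polynomial)"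
    by simp
  then show "t = u" by (simp add: mono_poly_def)
qed

lemma independent_mono_poly: "poly_vs.independent (mono_poly ` X :: 'k::field polynomial set)" if "finite X"
proof (rule poly_vs.independent_if_scalars_zero)
  fix f :: "'k polynomial \<Rightarrow> 'k" and x :: "'k polynomial"
  assume sum: "(\<Sum>x\<in>mono_poly ` X. poly_scale (f x) x) = 0" and x: "x \<in> mono_poly ` X"
  obtain t where t: "t \<in> X" "x = mono_poly t" using x by blast
  have "(\<Sum>x\<in>mono_poly ` X. poly_scale (f x) x) = (\<Sum>u\<in>X. poly_scale (f (mono_poly u)) (mono_poly u))"
    by (subst sum.reindex) (auto intro: inj_on_subset[OF inj_mono_poly])
  then have "0 = lookup (\<Sum>u\<in>X. poly_scale (f (mono_poly u)) (mono_poly u)) t"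
    using sum by simp
  also have "\<dots> = f x"
    using that t by (simp add: lookup_sum poly_scale_def mono_poly_def lookup_single when_def
        if_distrib cong: if_cong)
  finally show "f x = 0" by simp
qed (use that in simp)

lemma poly_span_mono_poly:
  assumes "keys p \<subseteq> S" "\<And>t. t \<in> S \<Longrightarrow> mono_poly t \<in> poly_vs.span X"
  shows "p \<in> poly_vs.span X"
proof -
  have "p = (\<Sum>t\<in>keys p. poly_scale (lookup p t) (mono_poly t))"
    using sum_single[of p] by (simp add: single_eq_const_mono poly_scale_def)
  moreover have "\<dots> \<in> poly_vs.span X"
    using assms by (intro poly_vs.span_sum poly_vs.span_scale) auto
  ultimately show ?thesis by simp
qed

lemma linform_nonzerodivisor:
  fixes d :: "'k::field polynomial"
  assumes blocks: "forest_blocks Bs" and v: "v \<in> \<Union>(set Bs)" and kv: "k v < s"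
    and sp: "std_spans s Bs k q" and sp': "std_spans s Bs (k(v := Suc (k v))) (elim s g v k q)"
    and ind: "std_indep s Bs k q" and g: "dot s g (pivot k q v) \<noteq> 0"
    and a: "keys a \<subseteq> \<Union>(set Bs)" and av: "lookup a v \<ge> 1"
    and d: "keys d \<subseteq> std_set s Bs k a"
    and dL: "d * linform s g v k q \<in> hyp_ideal s Bs k q"
  shows "d = 0"
proof (rule ccontr)
  assume "d \<noteq> 0"
  then obtain t0 where t0: "t0 \<in> keys d" by (metis keys_eq_empty ex_in_conv)
  let ?L = "linform s g v k q" and ?I = "hyp_ideal s Bs k q"
  let ?a = "a + single v 1"
  let ?X = "std_set s Bs k ?a" and ?Y = "std_set s Bs k a"
  let ?Y' = "std_set s Bs (k(v := Suc (k v))) ?a"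
  have a': "keys ?a \<subseteq> \<Union>(set Bs)"
    using a v Poly_Mapping.keys_add[of a "single v 1"] by auto
  define w where "w t = (SOME e. keys e \<subseteq> ?X \<and> mono_poly t * ?L - e \<in> ?I)" for t
  have w: "keys (w t) \<subseteq> ?X" "mono_poly t * ?L - w t \<in> ?I" if t: "t \<in> ?Y" for t
  proof -
    have "homog ?a (mono_poly t * ?L)"
      using t homog_linform by (intro homog_mult) (auto simp: std_set_def)
    then have "\<exists>e. keys e \<subseteq> ?X \<and> mono_poly t * ?L - e \<in> ?I"
      using sp a' unfolding std_spans_def by blast
    then have "keys (w t) \<subseteq> ?X \<and> mono_poly t * ?L - w t \<in> ?I"
      unfolding w_def by (rule someI_ex)
    then show "keys (w t) \<subseteq> ?X" "mono_poly t * ?L - w t \<in> ?I" by auto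
  qed
  define N where "N e = (\<Sum>t\<in>keys e. const_poly (lookup e t) * w t)" for e
  have N: "keys (N e) \<subseteq> ?X" "e * ?L - N e \<in> ?I"
    if e: "keys e \<subseteq> ?Y" for e :: "'k polynomial"
  proof -
    show "keys (N e) \<subseteq> ?X"
      unfolding N_def using e w(1) keys_const_mult by (intro keys_sum_subset) blast
    have "e * ?L = (\<Sum>t\<in>keys e. const_poly (lookup e t) * mono_poly t) * ?L"
      by (subst homog_eq_sum[OF homog_std[OF e]]) simp
    also have "\<dots> = (\<Sum>t\<in>keys e. const_poly (lookup e t) * (mono_poly t * ?L))"
      by (simp only: sum_distrib_right mult.assoc)
    finally have eL: "e * ?L = \<dots>" .
    have "e * ?L - N e =
        (\<Sum>t\<in>keys e. const_poly (lookup e t) * (mono_poly t * ?L - w t))"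
      unfolding eL N_def right_diff_distrib sum_subtractf by (rule refl)
    moreover have "\<dots> \<in> ?I"
      using e w(2) by (intro poly_module.span_sum gen_ideal_mult) blast
    ultimately show "e * ?L - N e \<in> ?I" by simp
  qed
  have zero: "e = 0" if "keys e \<subseteq> ?X" "e \<in> ?I" for e
    using ind that unfolding std_indep_def by blast
  let ?T = "w ` (?Y - {t0}) \<union> mono_poly ` ?Y'"
  have t0Y: "t0 \<in> ?Y" using t0 d by blast
  have Nd: "N d = 0"
  proof (rule zero)
    show "keys (N d) \<subseteq> ?X" by (rule N(1)[OF d])
    have "d * ?L - (d * ?L - N d) \<in> ?I" using dL N(2)[OF d] by (rule poly_module.span_diff)
    then show "N d \<in> ?I" by simp
  qed
  \<comment> \<open>Here \<open>N d = 0\<close> is used: it expresses \<open>w t0\<close> by the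
    other images, so that \<open>t0\<close> can be dispensed with.\<close>
  have w_span: "w t \<in> poly_vs.span ?T" if t: "t \<in> ?Y" for t
  proof (cases "t = t0")
    case True
    let ?c = "lookup d t0"
    have "N d = const_poly ?c * w t0 +
        (\<Sum>t\<in>keys d - {t0}. const_poly (lookup d t) * w t)"
      unfolding N_def by (rule sum.remove[OF finite_keys t0])
    then have "poly_scale ?c (w t0) =
        - (\<Sum>t\<in>keys d - {t0}. poly_scale (lookup d t) (w t))"
      using Nd unfolding poly_scale_def by (simp only: eq_neg_iff_add_eq_0)
    moreover have "\<dots> \<in> poly_vs.span ?T"
      using d by (intro poly_vs.span_neg poly_vs.span_sum poly_vs.span_scale poly_vs.span_base) blast
    ultimately have "poly_scale ?c (w t0) \<in> poly_vs.span ?T" by (simp only:)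
    then have "poly_scale (inverse ?c) (poly_scale ?c (w t0)) \<in> poly_vs.span ?T"
      by (rule poly_vs.span_scale)
    moreover have "?c \<noteq> 0" using t0 by (simp add: in_keys_iff)
    ultimately show ?thesis using True by simp
  next
    case False
    then show ?thesis using t by (intro poly_vs.span_base) blast
  qed
  have "mono_poly x \<in> poly_vs.span ?T" if x: "x \<in> ?X" for x
  proof -
    have hx: "homog ?a (mono_poly x :: 'k polynomial)" using x by (simp add: std_set_def)
    obtain e r where e: "keys e \<subseteq> ?Y'" and er: "mono_poly x - e - r * ?L \<in> ?I"
      and r: "r = 0 \<or> (\<exists>b. ?a = b + single v 1 \<and> homog b r)"
      using std_spans_elim[OF sp' kv g a' hx] by blast
    have "homog a r" using r by auto
    then obtain r' where r': "keys r' \<subseteq> ?Y" "r - r' \<in> ?I"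
      using sp a unfolding std_spans_def by blast
    have eX: "keys e \<subseteq> ?X"
    proof
      fix t assume "t \<in> keys e"
      then have t: "std s Bs (k(v := Suc (k v))) (keys t)" "mdeg t = ?a"
        using e by (auto simp: std_set_def)
      have "keys t \<subseteq> cells s (\<Union>(set Bs)) (k(v := Suc (k v)))" by (rule std_cells[OF t(1)])
      then have "std s Bs k (keys t)"
        by (intro std_dominated[OF blocks t(1)]) (auto simp: dominated_def cells_def)
      then show "t \<in> ?X" using t(2) by (simp add: std_set_def)
    qed
    let ?y = "mono_poly x - e - N r'"
    have "?y = 0"
    proof (rule zero)
      show "keys ?y \<subseteq> ?X"
        using keys_diff[of "mono_poly x - e" "N r'"] keys_diff[of "mono_poly x" e] eX N(1)[OF r'(1)] x
        by (auto simp: mono_poly_def)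
      have "?y = (mono_poly x - e - r * ?L) + ?L * (r - r') + (r' * ?L - N r')"
        by (simp add: algebra_simps)
      then show "?y \<in> ?I"
        using er r'(2) N(2)[OF r'(1)] by (simp only:) (intro poly_module.span_add gen_ideal_mult)
    qed
    then have "mono_poly x = e + N r'" by (simp add: algebra_simps)
    moreover have "e \<in> poly_vs.span ?T"
      using e by (rule poly_span_mono_poly) (intro poly_vs.span_base, blast)
    moreover have "N r' \<in> poly_vs.span ?T"
    proof -
      have "N r' = (\<Sum>t\<in>keys r'. poly_scale (lookup r' t) (w t))"
        by (simp add: N_def poly_scale_def)
      also have "\<dots> \<in> poly_vs.span ?T"
        using r'(1) w_span by (intro poly_vs.span_sum poly_vs.span_scale) blast
      finally show ?thesis .
    qed
    ultimately show ?thesis by (simp add: poly_vs.span_add)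
  qed
  then have "mono_poly ` ?X \<subseteq> poly_vs.span ?T" by blast
  moreover have "finite ?T" by (simp add: finite_std_set)
  ultimately have "card (mono_poly ` ?X :: 'k polynomial set) \<le> card ?T"
    using poly_vs.independent_span_bound independent_mono_poly[OF finite_std_set] by blast
  also have "card ?T \<le> card (?Y - {t0}) + card ?Y'"
    using card_Un_le[of "w ` (?Y - {t0})" "mono_poly ` ?Y' :: 'k polynomial set"]
      card_image_le[of "?Y - {t0}" w] card_image_le[of ?Y' "mono_poly :: _ \<Rightarrow> 'k polynomial"]
    by (simp add: finite_std_set)
  also have "\<dots> < card ?Y + card ?Y'"
    using t0Y card_Diff1_less[OF finite_std_set t0Y] by simp
  also have "\<dots> = card ?X" using card_std_set_Suc[where k = k and v = v and s = s, OF blocks v kv av] by simp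
  also have "\<dots> = card (mono_poly ` ?X :: 'k polynomial set)"
    by (simp add: card_image inj_on_subset[OF inj_mono_poly])
  finally show False by simp
qed

text \<open>The degree in \<open>v\<close> only grows, so the factors can be multiplied on one at a
  time. The product is replaced by a normal form \<open>d'\<close> because the induction over the
  blocks provides points only for combinations of standard monomials.\<close>

lemma linforms_nonzerodivisor:
  fixes d :: "'k::field polynomial"
  assumes blocks: "forest_blocks Bs" and v: "v \<in> \<Union>(set Bs)" and kv: "k v < s"
    and sp: "std_spans s Bs k q" and ind: "std_indep s Bs k q"
    and g: "\<And>g. g \<in> set gs \<Longrightarrow> dot s g (pivot k q v) \<noteq> 0 \<and>
        std_spans s Bs (k(v := Suc (k v))) (elim s g v k q)"
    and a: "keys a \<subseteq> \<Union>(set Bs)" and av: "lookup a v \<ge> 1"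
    and d: "keys d \<subseteq> std_set s Bs k a" "d \<noteq> 0"
  shows "\<exists>a' d'. keys d' \<subseteq> std_set s Bs k a' \<and> d' \<noteq> 0 \<and>
    d' - d * prod_list (map (\<lambda>g. linform s g v k q) gs) \<in> hyp_ideal s Bs k q"
  using g a av d
proof (induction gs arbitrary: a d)
  case Nil
  then show ?case by (intro exI[of _ a] exI[of _ d]) (simp add: poly_module.span_zero)
next
  case (Cons g gs)
  let ?L = "linform s g v k q" and ?I = "hyp_ideal s Bs k q"
  let ?a = "a + single v 1"
  have a': "keys ?a \<subseteq> \<Union>(set Bs)"
    using Cons.prems(2) v Poly_Mapping.keys_add[of a "single v 1"] by auto
  have "homog ?a (d * ?L)" by (rule homog_mult[OF homog_std[OF Cons.prems(4)] homog_linform])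
  then obtain e where e: "keys e \<subseteq> std_set s Bs k ?a" "d * ?L - e \<in> ?I"
    using sp a' unfolding std_spans_def by blast
  have g1: "dot s g (pivot k q v) \<noteq> 0"
    and g2: "std_spans s Bs (k(v := Suc (k v))) (elim s g v k q)"
    using Cons.prems(1)[of g] list.set_intros(1)[of g gs] by blast+
  have "e \<noteq> 0"
  proof
    assume "e = 0"
    then have "d * ?L \<in> ?I" using e(2) by simp
    then show False
      using linform_nonzerodivisor[OF blocks v kv sp g2 ind g1 Cons.prems(2-4)] Cons.prems(5) by blast
  qed
  moreover have "lookup ?a v \<ge> 1" by (simp add: lookup_add)
  ultimately obtain a2 d' where d': "keys d' \<subseteq> std_set s Bs k a2" "d' \<noteq> 0"
    "d' - e * prod_list (map (\<lambda>g. linform s g v k q) gs) \<in> ?I"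
    using Cons.IH[OF _ a' _ e(1)] Cons.prems(1) by auto
  let ?P = "prod_list (map (\<lambda>g. linform s g v k q) gs)"
  have "d' - d * (?L * ?P) = (d' - e * ?P) - ?P * (d * ?L - e)"
    by (simp add: algebra_simps)
  then have "d' - d * prod_list (map (\<lambda>g. linform s g v k q) (g # gs)) \<in> ?I"
    using poly_module.span_diff[OF d'(3) gen_ideal_mult[OF e(2), of ?P]]
    by (simp only: list.map prod_list.Cons)
  then show ?case using d' by blast
qed


section \<open>Points of the variety\<close>

abbreviation pt_column ::
  "nat \<Rightarrow> (nat \<Rightarrow> nat) \<Rightarrow> 'k::field frame \<Rightarrow> (nat \<times> nat \<Rightarrow> 'k) \<Rightarrow> nat \<Rightarrow> nat \<Rightarrow> 'k" where
  "pt_column s k q z \<equiv> column s (\<lambda>x. x) k q z"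

abbreviation peval :: "(nat \<times> nat \<Rightarrow> 'k::field) \<Rightarrow> 'k polynomial \<Rightarrow> 'k" where
  "peval \<equiv> poly_eval (\<lambda>x. x)"

definition hyp_points ::
  "nat \<Rightarrow> nat set list \<Rightarrow> (nat \<Rightarrow> nat) \<Rightarrow> 'k::field frame \<Rightarrow> (nat \<times> nat \<Rightarrow> 'k) set" where
  "hyp_points s Bs k q = {z.
    (\<forall>i j. j \<in> \<Union>(set Bs) \<longrightarrow> (i, j) \<notin> cells s (\<Union>(set Bs)) k \<longrightarrow> z (i, j) = 0) \<and>
    (\<forall>B\<in>set Bs. \<forall>js. set js \<subseteq> B \<longrightarrow> distinct js \<longrightarrow> length js = s \<longrightarrow>
      vdet (map (pt_column s k q z) js) = 0)}"

lemma peval_ring_map: "ring_map (peval z)"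
  by (rule poly_eval_ring_map[OF ring_map_id])

lemma peval_gcol: "peval z (gcol s k q j l) = pt_column s k q z j l"
  by (simp add: gcol_def column_def ring_map_sum[OF peval_ring_map] ring_mapD[OF peval_ring_map]
      ring_map_id)

lemma peval_linform: "peval z (linform s g v k q) = dot s g (pt_column s k q z v)"
  unfolding column_def dot_sum
  by (simp add: linform_def ring_map_sum[OF peval_ring_map] ring_mapD[OF peval_ring_map] ring_map_id)

lemma peval_hyp_ideal:
  assumes z: "z \<in> hyp_points s Bs k q" and x: "x \<in> hyp_ideal s Bs k q"
  shows "peval z x = 0"
  using x
proof (induction rule: poly_module.span_induct_alt)
  case base
  then show ?case by (simp add: ring_mapD[OF peval_ring_map])
next
  case (step c g y)
  from step(1) consider (var) i j where "g = var_poly i j" "j \<in> \<Union>(set Bs)" "(i, j) \<notin> cells s (\<Union>(set Bs)) k"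
    | (minor) js B where "g = block_minor s k q js" "B \<in> set Bs" "set js \<subseteq> B" "distinct js" "length js = s"
    unfolding hyp_gens_def by blast
  then have "peval z g = 0"
  proof cases
    case var
    then show ?thesis using z unfolding hyp_points_def by (simp add: ring_map_id)
  next
    case minor
    have "peval z g = vdet (map (pt_column s k q z) js)"
      unfolding minor(1) block_minor_def
      unfolding ring_map_vdet[OF peval_ring_map] map_map comp_def peval_gcol by (rule refl)
    moreover have "vdet (map (pt_column s k q z) js) = 0"
      using z minor(2-) by (simp add: hyp_points_def)
    ultimately show ?thesis by (simp only:)
  qed
  then show ?case using step by (simp add: ring_mapD[OF peval_ring_map])
qed

definition has_section ::
  "nat \<Rightarrow> nat set list \<Rightarrow> (nat \<Rightarrow> nat) \<Rightarrow> 'k::field frame \<Rightarrow> 'k polynomial \<Rightarrow> bool" where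
  "has_section s Bs k q f \<longleftrightarrow> (\<exists>z. (\<forall>v. regular (\<lambda>x. z x v)) \<and>
    (\<forall>x. z x \<in> hyp_points s Bs k (fst x)) \<and> peval (z (q, 0)) f \<noteq> 0)"

lemma has_section_not_mem: "has_section s Bs k q f \<Longrightarrow> f \<notin> hyp_ideal s Bs k q"
  unfolding has_section_def by (metis fst_conv peval_hyp_ideal)

lemma hyp_points_zero_cols:
  assumes "z \<in> hyp_points s Bs k q"
  shows "(\<lambda>v. if snd v \<in> C then 0 else z v) \<in> hyp_points s Bs k q" (is "?z \<in> _")
  unfolding hyp_points_def
proof (intro CollectI conjI allI ballI impI)
  fix i j assume "j \<in> \<Union>(set Bs)" "(i, j) \<notin> cells s (\<Union>(set Bs)) k"
  then show "?z (i, j) = 0" using assms by (auto simp: hyp_points_def)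
next
  fix B js assume js: "B \<in> set Bs" "set js \<subseteq> B" "distinct js" "length js = s"
  show "vdet (map (pt_column s k q ?z) js) = 0"
  proof (cases "set js \<inter> C = {}")
    case True
    then have "j \<notin> C" if "j \<in> set js" for j using that by blast
    then have "map (pt_column s k q ?z) js = map (pt_column s k q z) js"
      by (intro map_cong refl) (simp add: column_def)
    moreover have "vdet (map (pt_column s k q z) js) = 0"
      using assms js by (simp add: hyp_points_def)
    ultimately show ?thesis by (simp only:)
  next
    case False
    then obtain j where "j \<in> set js" "j \<in> C" by blast
    show ?thesis
    proof (rule vdet_zero_vector)
      show "pt_column s k q ?z j \<in> set (map (pt_column s k q ?z) js)"
        unfolding set_map using \<open>j \<in> set js\<close> by (rule imageI)
      show "pt_column s k q ?z j l = 0" for l using \<open>j \<in> C\<close> by (simp add: column_def)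
    qed
  qed
qed

text \<open>A lexicographic choice: among the elements with the least value at \<open>y\<close>, the
  remaining coordinates select \<open>t0\<close>. The weight of \<open>y\<close> exceeds the
  weighted sum of \<open>t0\<close> over the other coordinates, so that any larger value at
  \<open>y\<close> loses.\<close>

lemma unique_minimal_weight:
  fixes val :: "'m \<Rightarrow> 'x \<Rightarrow> nat"
  assumes "finite X" "finite T" "T \<noteq> {}"
    and "\<And>t t'. t \<in> T \<Longrightarrow> t' \<in> T \<Longrightarrow> (\<And>x. x \<in> X \<Longrightarrow> val t x = val t' x) \<Longrightarrow> t = t'"
  shows "\<exists>w t0. (\<forall>x. w x \<ge> (1::nat)) \<and> t0 \<in> T \<and>
    (\<forall>t\<in>T - {t0}. (\<Sum>x\<in>X. w x * val t0 x) < (\<Sum>x\<in>X. w x * val t x))"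
  using assms
proof (induction X arbitrary: T rule: finite_induct)
  case empty
  then obtain t0 where "t0 \<in> T" by blast
  then show ?case using empty.prems(3) by (intro exI[of _ "\<lambda>_. 1"] exI[of _ t0]) auto
next
  case (insert y X)
  define m where "m = Min ((\<lambda>t. val t y) ` T)"
  define T' where "T' = {t \<in> T. val t y = m}"
  have m_le: "m \<le> val t y" if "t \<in> T" for t using insert.prems(1) that by (auto simp: m_def)
  have "m \<in> (\<lambda>t. val t y) ` T" unfolding m_def using insert.prems by (intro Min_in) auto
  then have "T' \<noteq> {}" by (auto simp: T'_def)
  have "finite T'" using insert.prems(1) by (simp add: T'_def)
  have inj: "t = t'" if "t \<in> T'" "t' \<in> T'" "\<And>x. x \<in> X \<Longrightarrow> val t x = val t' x" for t t'
    using that by (intro insert.prems(3)) (auto simp: T'_def)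
  have "\<exists>w t0. (\<forall>x. w x \<ge> (1::nat)) \<and> t0 \<in> T' \<and>
    (\<forall>t\<in>T' - {t0}. (\<Sum>x\<in>X. w x * val t0 x) < (\<Sum>x\<in>X. w x * val t x))"
    by (rule insert.IH) (fact \<open>finite T'\<close>, fact \<open>T' \<noteq> {}\<close>, rule inj)
  then obtain w t0 where w: "\<forall>x. w x \<ge> 1" "t0 \<in> T'"
    "\<forall>t\<in>T' - {t0}. (\<Sum>x\<in>X. w x * val t0 x) < (\<Sum>x\<in>X. w x * val t x)"
    by blast
  let ?M = "Suc (\<Sum>x\<in>X. w x * val t0 x)"
  let ?w = "w(y := ?M)"
  have S: "(\<Sum>x\<in>insert y X. ?w x * val t x) = ?M * val t y + (\<Sum>x\<in>X. w x * val t x)" for t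
  proof -
    have "(\<Sum>x\<in>X. ?w x * val t x) = (\<Sum>x\<in>X. w x * val t x)"
      using insert.hyps by (intro sum.cong) auto
    then show ?thesis using insert.hyps by simp
  qed
  have "(\<Sum>x\<in>insert y X. ?w x * val t0 x) < (\<Sum>x\<in>insert y X. ?w x * val t x)" if t: "t \<in> T - {t0}" for t
  proof (cases "val t y = m")
    case True
    then have "t \<in> T' - {t0}" using t by (simp add: T'_def)
    then show ?thesis using w(2,3) True unfolding S by (auto simp: T'_def)
  next
    case False
    then have "Suc m \<le> val t y" using m_le[of t] t by simp
    then have "?M * Suc m \<le> ?M * val t y" by (rule mult_le_mono2)
    moreover have "val t0 y = m" using w(2) by (simp add: T'_def)
    ultimately show ?thesis unfolding S by simp
  qed
  then show ?case using w(1,2) by (intro exI[of _ ?w] exI[of _ t0]) (auto simp: T'_def)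
qed

section \<open>Sections of the variety\<close>

lemma ring_map_poly_eval:
  assumes "ring_map F"
  shows "F (poly_eval c z p) = poly_eval (\<lambda>a. F (c a)) (\<lambda>v. F (z v)) p"
  by (simp add: poly_eval_def monom_eval_def ring_map_sum[OF assms] ring_mapD[OF assms]
      ring_map_prod[OF assms])

text \<open>The coefficient of \<open>u\<close> when \<open>f\<close> is read as a polynomial in the
  columns outside of \<open>A\<close>; it is a polynomial in the columns of
  \<open>A\<close>.\<close>

definition fiber :: "nat set \<Rightarrow> 'k::field polynomial \<Rightarrow> monomial \<Rightarrow> 'k polynomial" where
  "fiber A f u = (\<Sum>t\<in>{t \<in> keys f. restrict_cols (- A) t = u}.
    single (restrict_cols A t) (lookup f t))"

lemma poly_eval_fiber:
  assumes c: "ring_map c"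
  shows "poly_eval c z f = (\<Sum>u\<in>restrict_cols (- A) ` keys f.
    monom_eval z u * poly_eval c z (fiber A f u))"
proof -
  let ?r = "restrict_cols (- A)"
  let ?h = "\<lambda>t. c (lookup f t) * monom_eval z t"
  have t: "monom_eval z t = monom_eval z (?r t) * monom_eval z (restrict_cols A t)" for t
    using restrict_cols_split[of A t] by (metis add.commute monom_eval_add)
  have u: "monom_eval z u * poly_eval c z (fiber A f u) =
      (\<Sum>t\<in>{t \<in> keys f. ?r t = u}. ?h t)" for u
    unfolding fiber_def ring_map_sum[OF poly_eval_ring_map[OF c]] poly_eval_single[OF c] sum_distrib_left
  proof (rule sum.cong[OF refl])
    fix t assume "t \<in> {t \<in> keys f. ?r t = u}"
    then have "?r t = u" by simp
    then show "monom_eval z u * (c (lookup f t) * monom_eval z (restrict_cols A t)) = ?h t"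
      unfolding t[of t] by (simp only: mult_ac)
  qed
  have "(\<Sum>u\<in>?r ` keys f. \<Sum>t\<in>{t \<in> keys f. ?r t = u}. ?h t) =
      (\<Sum>t\<in>keys f. ?h t)"
    by (rule sum.group) auto
  moreover have "poly_eval c z f = (\<Sum>t\<in>keys f. ?h t)" by (simp only: poly_eval_def)
  ultimately show ?thesis by (simp only: u)
qed

lemma keys_fiber:
  "v \<in> keys (fiber A f u) \<Longrightarrow>
    \<exists>t\<in>keys f. restrict_cols (- A) t = u \<and> restrict_cols A t = v"
  using keys_sum[of "\<lambda>t. single (restrict_cols A t) (lookup f t)"
      "{t \<in> keys f. restrict_cols (- A) t = u}"]
  unfolding fiber_def by (fastforce split: if_splits)

lemma fiber_nonzero:
  assumes "t \<in> keys f"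
  shows "fiber A f (restrict_cols (- A) t) \<noteq> 0"
proof -
  let ?S = "{t' \<in> keys f. restrict_cols (- A) t' = restrict_cols (- A) t}"
  have "lookup (fiber A f (restrict_cols (- A) t)) (restrict_cols A t) =
      (\<Sum>t'\<in>?S. if restrict_cols A t' = restrict_cols A t then lookup f t' else 0)"
    by (simp add: fiber_def lookup_sum lookup_single when_def)
  also have "\<dots> = (\<Sum>t'\<in>?S. if t' = t then lookup f t' else 0)"
    using restrict_cols_split[of A] by (intro sum.cong refl) (metis (mono_tags, lifting) mem_Collect_eq)
  also have "\<dots> = lookup f t" using assms by simp
  also have "\<dots> \<noteq> 0" using assms by (simp add: in_keys_iff)
  finally show ?thesis by auto
qed

lemma monom_eval_mult: "monom_eval (\<lambda>v. a v * b v) u = monom_eval a u * monom_eval b u"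
  by (simp add: monom_eval_def power_mult_distrib prod.distrib)

text \<open>Along the curve \<open>Z\<close> the contribution of \<open>u\<close> is divisible by
  the power \<open>wsum u\<close> of the parameter. The least power is attained by \<open>u0\<close>
  alone, and its coefficient at \<open>0\<close> is nonzero by \<open>r0\<close> and
  \<open>F\<close>.\<close>

lemma fiber_eval_nonzero:
  fixes Z r :: "nat \<times> nat \<Rightarrow> 'k::field poly" and w :: "nat \<times> nat \<Rightarrow> nat"
  defines "wsum \<equiv> \<lambda>u :: monomial. \<Sum>v\<in>keys u. w v * lookup u v"
  assumes u0: "u0 \<in> restrict_cols (- A) ` keys f"
    and min: "\<And>u. u \<in> restrict_cols (- A) ` keys f \<Longrightarrow> u \<noteq> u0 \<Longrightarrow> wsum u0 < wsum u"
    and Z: "\<And>v. snd v \<notin> A \<Longrightarrow> Z v = [:0, 1:] ^ w v * r v"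
    and r0: "\<And>v. v \<in> keys u0 \<Longrightarrow> poly (r v) 0 \<noteq> 0"
    and F: "peval (\<lambda>v. poly (Z v) 0) (fiber A f u0) \<noteq> 0"
  shows "poly_eval (\<lambda>c. [:c:]) Z f \<noteq> 0"
proof -
  let ?T = "restrict_cols (- A) ` keys f"
  let ?X = "[:0, 1:] :: 'k poly"
  let ?\<phi> = "\<lambda>u. poly_eval (\<lambda>c. [:c:]) Z (fiber A f u)"
  have mZ: "monom_eval Z u = ?X ^ wsum u * monom_eval r u" if u: "u \<in> ?T" for u
  proof -
    have "monom_eval Z u = monom_eval (\<lambda>v. ?X ^ w v * r v) u"
      using u Z by (intro monom_eval_cong) (auto simp: keys_restrict_cols)
    also have "\<dots> = monom_eval (\<lambda>v. ?X ^ w v) u * monom_eval r u" by (rule monom_eval_mult)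
    also have "monom_eval (\<lambda>v. ?X ^ w v) u = ?X ^ wsum u"
      by (simp add: monom_eval_def wsum_def power_sum power_mult)
    finally show ?thesis .
  qed
  let ?Q = "monom_eval r u0 * ?\<phi> u0 + (\<Sum>u\<in>?T - {u0}. ?X ^ (wsum u - wsum u0) * (monom_eval r u * ?\<phi> u))"
  have "poly_eval (\<lambda>c. [:c:]) Z f = (\<Sum>u\<in>?T. ?X ^ wsum u * (monom_eval r u * ?\<phi> u))"
    unfolding poly_eval_fiber[OF pCons_ring_map, of Z f A]
    by (intro sum.cong refl) (simp add: mZ mult.assoc)
  also have "\<dots> = ?X ^ wsum u0 * (monom_eval r u0 * ?\<phi> u0) +
      (\<Sum>u\<in>?T - {u0}. ?X ^ wsum u * (monom_eval r u * ?\<phi> u))"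
    using u0 by (intro sum.remove) auto
  also have "(\<Sum>u\<in>?T - {u0}. ?X ^ wsum u * (monom_eval r u * ?\<phi> u)) =
      ?X ^ wsum u0 * (\<Sum>u\<in>?T - {u0}. ?X ^ (wsum u - wsum u0) * (monom_eval r u * ?\<phi> u))"
    unfolding sum_distrib_left
  proof (rule sum.cong[OF refl])
    fix u assume "u \<in> ?T - {u0}"
    then have "wsum u = wsum u0 + (wsum u - wsum u0)" using min[of u] by simp
    then show "?X ^ wsum u * (monom_eval r u * ?\<phi> u) =
        ?X ^ wsum u0 * (?X ^ (wsum u - wsum u0) * (monom_eval r u * ?\<phi> u))"
      by (simp only: mult.assoc[symmetric] power_add[symmetric])
  qed
  finally have eq: "poly_eval (\<lambda>c. [:c:]) Z f = ?X ^ wsum u0 * ?Q" by (simp only: distrib_left)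
  have "poly (\<Sum>u\<in>?T - {u0}. ?X ^ (wsum u - wsum u0) * (monom_eval r u * ?\<phi> u)) 0 = 0"
    unfolding poly_sum
  proof (rule sum.neutral, rule ballI)
    fix u assume "u \<in> ?T - {u0}"
    then have "wsum u - wsum u0 > 0" using min[of u] by simp
    then show "poly (?X ^ (wsum u - wsum u0) * (monom_eval r u * ?\<phi> u)) 0 = 0"
      by (simp add: poly_power zero_power)
  qed
  moreover have p0: "ring_map (\<lambda>p :: 'k poly. poly p 0)" by (simp add: ring_map_def)
  moreover have "poly (?\<phi> u0) 0 = peval (\<lambda>v. poly (Z v) 0) (fiber A f u0)"
    by (simp add: ring_map_poly_eval[OF p0])
  moreover have "poly (monom_eval r u0) 0 \<noteq> 0"
    unfolding monom_eval_def using r0 by (simp add: poly_prod)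
  ultimately have "poly ?Q 0 \<noteq> 0" using F by simp
  then have "?Q \<noteq> 0" by (metis poly_0)
  then show ?thesis unfolding eq by simp
qed

lemma sum_Suc_greaterThanAtMost:
  fixes F :: "nat \<Rightarrow> 'a::comm_monoid_add"
  assumes "m < n"
  shows "(\<Sum>i\<in>{m<..n}. F i) = F (Suc m) + (\<Sum>i\<in>{Suc m<..n}. F i)"
proof -
  have "{m<..n} = insert (Suc m) {Suc m<..n}" using assms by auto
  then show ?thesis by simp
qed

text \<open>
  The pivot of the column \<open>j\<close> is tilted by powers of the scalar parameter. The weights make the
  tilted columns span a hyperplane which isolates a single fibre of the polynomial to be tested.
\<close>

definition tilt ::
  "nat \<Rightarrow> (nat \<Rightarrow> nat) \<Rightarrow> (nat \<times> nat \<Rightarrow> nat) \<Rightarrow> 'k::field param \<Rightarrow> nat \<Rightarrow> nat \<Rightarrow> 'k" where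
  "tilt s k w x j = (\<lambda>l. pivot k (fst x) j l +
    (\<Sum>i\<in>{Suc (k j)<..s}. snd x ^ w (i, j) * fst x j i l))"

lemma tilt_0:
  assumes "\<And>v. w v \<ge> (1::nat)"
  shows "tilt s k w (q, 0) = pivot k q"
proof
  fix j
  have "(0::'a) ^ w (i, j) = 0" for i using assms[of "(i, j)"] by (simp add: power_0_left)
  then show "tilt s k w (q, 0) j = pivot k q j"
    unfolding tilt_def by (simp only: fst_conv snd_conv mult_zero_left sum.neutral_const add_0_right)
qed

lemma regular_tilt: "regular (\<lambda>x. tilt s k w x j l)"
  unfolding tilt_def pivot_def
  by (intro regular_add regular_sum regular_mult regular_power regular_coord regular_snd)

lemma regular_dot:
  "(\<And>l. regular (\<lambda>x. h x l)) \<Longrightarrow> (\<And>l. regular (\<lambda>x. y x l)) \<Longrightarrow> regular (\<lambda>x. dot s (h x) (y x))"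
  unfolding dot_def by (intro regular_sum regular_mult)

text \<open>The columns in \<open>Up\<close> are placed on their tilted pivots, and
  \<open>h x\<close> is normal to these and to the glued column; the other new columns are projected
  into the hyperplane. The assumption \<open>hz\<close> takes care of parameters at which the normal
  vector vanishes: then fewer than \<open>s\<close> columns of the block can be nonzero, and the
  minors still vanish.\<close>

lemma glue_section:
  fixes f :: "'k::field polynomial" and zA :: "'k param \<Rightarrow> nat \<times> nat \<Rightarrow> 'k"
    and h :: "'k param \<Rightarrow> nat \<Rightarrow> 'k" and q :: "'k frame"
  defines "A \<equiv> \<lambda>Bs :: nat set list. \<Union>(set Bs)"
  assumes inf: "infinite (UNIV :: 'k set)"
    and f: "keys f \<subseteq> std_set s (B # Bs) k a"
    and u0: "u0 \<in> restrict_cols (- A Bs) ` keys f"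
    and w: "\<And>v. w v \<ge> (1::nat)"
    and min: "\<And>u. u \<in> restrict_cols (- A Bs) ` keys f \<Longrightarrow> u \<noteq> u0 \<Longrightarrow>
      (\<Sum>v\<in>{(i, j). j \<in> B - A Bs \<and> Suc (k j) < i \<and> i \<le> s}. w v * lookup u0 v) <
      (\<Sum>v\<in>{(i, j). j \<in> B - A Bs \<and> Suc (k j) < i \<and> i \<le> s}. w v * lookup u v)"
    and finB: "finite B"
    and Up: "Up \<subseteq> {j \<in> B - A Bs. k j < s}"
    and U: "\<And>j. j \<in> B - A Bs \<Longrightarrow> (Suc (k j), j) \<in> keys u0 \<Longrightarrow> j \<in> Up"
    and zA: "\<And>v. regular (\<lambda>x. zA x v)" "\<And>x. zA x \<in> hyp_points s Bs k (fst x)"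
    and h: "\<And>l. regular (\<lambda>x. h x l)"
    and orth1: "\<And>x j. j \<in> Up \<Longrightarrow> dot s (h x) (tilt s k w x j) = 0"
    and orth2: "\<And>x v. v \<in> B \<inter> A Bs \<Longrightarrow> dot s (h x) (pt_column s k (fst x) (zA x) v) = 0"
    and hz: "\<And>x. (\<And>l. l < s \<Longrightarrow> h x l = 0) \<Longrightarrow> \<exists>N. finite N \<and> card N < s \<and> Up \<subseteq> N \<and>
      (\<forall>v\<in>B \<inter> A Bs. v \<in> N \<or> (\<forall>l<s. pt_column s k (fst x) (zA x) v l = 0))"
    and h0: "\<And>j. j \<in> B - A Bs \<Longrightarrow> j \<notin> Up \<Longrightarrow> k j < s \<Longrightarrow> dot s (h (q, 0)) (pivot k q j) \<noteq> 0"
    and F: "peval (zA (q, 0)) (fiber (A Bs) f u0) \<noteq> 0"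
  shows "has_section s (B # Bs) k q f"
proof -
  let ?A = "A Bs" and ?W = "B - A Bs"
  \<comment> \<open>For \<open>j\<close> outside \<open>Up\<close>, let \<open>y\<close> be the sum
    of the nonpivot frame vectors weighted by powers of the scalar, and \<open>p\<close> the pivot.
    The column becomes \<open>h(p) * y - h(y) * p\<close>, the projection of \<open>y\<close> along
    \<open>p\<close> into the hyperplane, cleared of the denominator \<open>h(p)\<close>.\<close>
  define Z where "Z x v = (if snd v \<in> ?A then zA x v
    else if v \<notin> cells s ?W k then 0
    else if snd v \<in> Up then (if fst v = Suc (k (snd v)) then 1 else snd x ^ w v)
    else if fst v = Suc (k (snd v)) then
      - (\<Sum>i\<in>{Suc (k (snd v))<..s}. dot s (h x) (fst x (snd v) i) * snd x ^ w (i, snd v))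
    else dot s (h x) (pivot k (fst x) (snd v)) * snd x ^ w v)" for x v
  have regZ: "regular (\<lambda>x. Z x v)" for v
    unfolding Z_def pivot_def
    by (intro regular_if zA regular_const regular_power regular_snd regular_uminus regular_sum
        regular_mult regular_dot h regular_coord)
  have col_A: "pt_column s k q' (Z x) j = pt_column s k q' (zA x) j" if "j \<in> ?A" for x q' j
    using that by (simp add: column_def Z_def)
  have col_out: "pt_column s k q' (Z x) j = (\<lambda>l. 0)" if "k j \<ge> s" for x q' j
    using that by (simp add: column_def)
  have ZW: "Z x (i, j) = (if j \<in> Up then (if i = Suc (k j) then 1 else snd x ^ w (i, j))
      else if i = Suc (k j) then - (\<Sum>i\<in>{Suc (k j)<..s}. dot s (h x) (fst x j i) * snd x ^ w (i, j))
      else dot s (h x) (pivot k (fst x) j) * snd x ^ w (i, j))"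
    if "j \<in> ?W" "k j < i" "i \<le> s" for x i j
    using that by (simp add: Z_def cells_def)
  have col_Up: "pt_column s k (fst x) (Z x) j = tilt s k w x j" if j: "j \<in> Up" for x j
  proof
    fix l
    have jW: "j \<in> ?W" "k j < s" using j Up by auto
    show "pt_column s k (fst x) (Z x) j l = tilt s k w x j l"
      unfolding column_def tilt_def pivot_def sum_Suc_greaterThanAtMost[OF jW(2)]
      using j jW by (auto simp: ZW intro!: sum.cong)
  qed
  have col_W: "dot s (h x) (pt_column s k (fst x) (Z x) j) = 0" if j: "j \<in> ?W" "j \<notin> Up" "k j < s" for x j
  proof -
    let ?d = "\<lambda>i. dot s (h x) (fst x j i)"
    let ?p = "?d (Suc (k j))"
    have "dot s (h x) (pt_column s k (fst x) (Z x) j) = (\<Sum>i\<in>{k j<..s}. Z x (i, j) * ?d i)"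
      unfolding column_def by (rule dot_sum)
    also have "\<dots> = - (\<Sum>i\<in>{Suc (k j)<..s}. ?d i * snd x ^ w (i, j)) * ?p +
        (\<Sum>i\<in>{Suc (k j)<..s}. ?p * snd x ^ w (i, j) * ?d i)"
      unfolding sum_Suc_greaterThanAtMost[OF j(3)]
      using j by (auto simp: ZW pivot_def intro!: sum.cong)
    also have "(\<Sum>i\<in>{Suc (k j)<..s}. ?p * snd x ^ w (i, j) * ?d i) =
        (\<Sum>i\<in>{Suc (k j)<..s}. ?d i * snd x ^ w (i, j)) * ?p"
      unfolding sum_distrib_right by (intro sum.cong refl) (simp only: mult_ac)
    also have "- (\<Sum>i\<in>{Suc (k j)<..s}. ?d i * snd x ^ w (i, j)) * ?p + \<dots> = 0"
      by simp
    finally show ?thesis .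
  qed
  have points: "Z x \<in> hyp_points s (B # Bs) k (fst x)" for x
    unfolding hyp_points_def
  proof (intro CollectI conjI allI ballI impI)
    fix i j assume j: "j \<in> \<Union>(set (B # Bs))" "(i, j) \<notin> cells s (\<Union>(set (B # Bs))) k"
    show "Z x (i, j) = 0"
    proof (cases "j \<in> ?A")
      case True
      then have "(i, j) \<notin> cells s ?A k" using j by (auto simp: cells_def)
      then have "zA x (i, j) = 0" using zA(2)[of x] True by (auto simp: hyp_points_def A_def)
      then show ?thesis using True by (simp add: Z_def)
    next
      case False
      then have "(i, j) \<notin> cells s ?W k" using j by (auto simp: cells_def)
      then show ?thesis using False by (simp add: Z_def)
    qed
  next
    fix B' js assume js: "B' \<in> set (B # Bs)" "set js \<subseteq> B'" "distinct js" "length js = s"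
    let ?c = "pt_column s k (fst x) (Z x)"
    show "vdet (map ?c js) = 0"
    proof (cases "B' \<in> set Bs")
      case True
      then have "map ?c js = map (pt_column s k (fst x) (zA x)) js"
        using js by (intro map_cong refl col_A) (auto simp: A_def)
      moreover have "vdet (map (pt_column s k (fst x) (zA x)) js) = 0"
        using zA(2)[of x] True js by (simp add: hyp_points_def)
      ultimately show ?thesis by (simp only:)
    next
      case False
      then have jsB: "set js \<subseteq> B" using js by auto
      show ?thesis
      proof (cases "\<exists>l<s. h x l \<noteq> 0")
        case True
        have "dot s (h x) (?c j) = 0" if jm: "j \<in> set js" for j
        proof -
          consider "j \<in> B \<inter> ?A" | "j \<in> Up" | "j \<in> ?W" "j \<notin> Up" "k j < s" | "k j \<ge> s"
            using jm jsB by fastforce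
          then show ?thesis
          proof cases
            case 1
            then show ?thesis using col_A orth2 by simp
          next
            case 2
            then show ?thesis using col_Up orth1 by simp
          next
            case 3
            then show ?thesis by (rule col_W)
          next
            case 4
            then show ?thesis using col_out by (simp add: dot_def)
          qed
        qed
        then have "\<exists>g. (\<exists>l<s. g l \<noteq> 0) \<and> (\<forall>y\<in>set (map ?c js). dot s g y = 0)"
          using True by (intro exI[of _ "h x"]) auto
        then show ?thesis using vdet_eq_0_iff[of "map ?c js" s] js(4) by simp
      next
        case False
        then obtain N where N: "finite N" "card N < s" "Up \<subseteq> N"
          "\<forall>v\<in>B \<inter> ?A. v \<in> N \<or> (\<forall>l<s. pt_column s k (fst x) (zA x) v l = 0)"
          using hz[of x] by blast
        have "card (set js) = s" using js distinct_card by fastforce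
        then have "\<not> set js \<subseteq> N" using N card_mono[of N "set js"] by auto
        then obtain j where j: "j \<in> set js" "j \<notin> N" by blast
        have d0: "dot s (h x) y = 0" for y using False by (simp add: dot_def)
        have "?c j l = 0" if "l < s" for l
        proof -
          consider "j \<in> B \<inter> ?A" | "j \<in> ?W" "j \<notin> Up" "k j < s" | "k j \<ge> s"
            using j jsB N(3) by fastforce
          then show ?thesis
          proof cases
            case 1
            then show ?thesis using col_A N(4) j that by auto
          next
            case 2
            then show ?thesis unfolding column_def by (intro sum.neutral) (simp add: ZW d0)
          next
            case 3
            then show ?thesis using col_out by simp
          qed
        qed
        then show ?thesis using j js(4) by (intro vdet_zero_vector[of "?c j"]) auto
      qed
    qed
  qed
  have "\<exists>p. \<forall>t. zA (q, t) v = poly p t" for v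
    using regular_curve[OF zA(1)[of v], of "\<lambda>j i l. [:q j i l:]" "[:0, 1:]"] by auto
  then obtain \<zeta> where \<zeta>: "\<And>v t. zA (q, t) v = poly (\<zeta> v) t" by metis
  have "\<exists>p. \<forall>t. dot s (h (q, t)) (q j i) = poly p t" for j i
  proof -
    have "regular (\<lambda>x. dot s (h x) (fst x j i))" by (intro regular_dot h regular_coord)
    from regular_curve[OF this, of "\<lambda>j i l. [:q j i l:]" "[:0, 1:]"] show ?thesis by auto
  qed
  then obtain \<eta> where \<eta>: "\<And>j i t. dot s (h (q, t)) (q j i) = poly (\<eta> j i) t" by metis
  let ?X = "[:0, 1:] :: 'k poly"
  \<comment> \<open>On \<open>Up\<close> the pivot coordinate is the constant \<open>1\<close>,
    whence the weight \<open>0\<close>. In the other new columns it is left entirely to the factor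
    \<open>r\<close>; it may vanish at \<open>0\<close> there, but by \<open>U\<close> such a pivot
    does not occur in \<open>u0\<close>.\<close>
  define w' where "w' v = (if fst v = Suc (k (snd v)) then 0 else w v)" for v
  define r where "r v = (if v \<notin> cells s ?W k then 0
    else if snd v \<in> Up then 1
    else if fst v = Suc (k (snd v)) then - (\<Sum>i\<in>{Suc (k (snd v))<..s}. \<eta> (snd v) i * ?X ^ w (i, snd v))
    else \<eta> (snd v) (Suc (k (snd v))))" for v
  define P where "P v = (if snd v \<in> ?A then \<zeta> v else ?X ^ w' v * r v)" for v
  have ZP: "Z (q, t) v = poly (P v) t" for t v
    by (auto simp: Z_def P_def r_def w'_def \<zeta> \<eta> poly_sum pivot_def)
  have keys_u: "keys u \<subseteq> cells s ?W k" if u: "u \<in> restrict_cols (- ?A) ` keys f" for u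
  proof -
    obtain t where t: "t \<in> keys f" "u = restrict_cols (- ?A) t" using u by blast
    have "keys t \<subseteq> cells s (\<Union>(set (B # Bs))) k"
      using f t(1) std_cells[of s "B # Bs" k] unfolding std_set_def by blast
    then show ?thesis unfolding t(2) keys_restrict_cols by (auto simp: cells_def A_def)
  qed
  have wsum: "(\<Sum>v\<in>keys u. w' v * lookup u v) =
      (\<Sum>v\<in>{(i, j). j \<in> ?W \<and> Suc (k j) < i \<and> i \<le> s}. w v * lookup u v)"
    if u: "u \<in> restrict_cols (- ?A) ` keys f" for u
  proof -
    let ?N = "{(i, j). j \<in> ?W \<and> Suc (k j) < i \<and> i \<le> s}"
    have "finite ?N"
      by (rule finite_subset[of _ "{..s} \<times> B"]) (use finB in auto)
    have "(\<Sum>v\<in>keys u. w' v * lookup u v) =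
        (\<Sum>v\<in>keys u \<inter> ?N. w v * lookup u v)"
      using keys_u[OF u] by (intro sum.mono_neutral_cong_right) (auto simp: w'_def cells_def Suc_lessI)
    also have "\<dots> = (\<Sum>v\<in>?N. w v * lookup u v)"
      using \<open>finite ?N\<close> by (intro sum.mono_neutral_left) (auto simp: in_keys_iff)
    finally show ?thesis .
  qed
  have "poly_eval (\<lambda>c. [:c:]) P f \<noteq> 0"
  proof (rule fiber_eval_nonzero[OF u0, of w' P r])
    fix u assume u: "u \<in> restrict_cols (- ?A) ` keys f" "u \<noteq> u0"
    show "(\<Sum>v\<in>keys u0. w' v * lookup u0 v) <
        (\<Sum>v\<in>keys u. w' v * lookup u v)"
      unfolding wsum[OF u(1)] wsum[OF u0] by (rule min[OF u])
  next
    fix v assume v: "v \<in> keys u0"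
    have c: "v \<in> cells s ?W k" using keys_u[OF u0] v by blast
    show "poly (r v) 0 \<noteq> 0"
    proof (cases "snd v \<in> Up")
      case False
      obtain i j where v': "v = (i, j)" by (cases v)
      have j: "j \<in> ?W" "k j < s" "j \<notin> Up" using c False v' by (auto simp: cells_def)
      have "i \<noteq> Suc (k j)" using U[OF j(1)] v v' j(3) by blast
      then show ?thesis using c False h0[OF j(1,3,2)] v' \<eta>[of 0 j "Suc (k j)"]
        by (simp add: r_def pivot_def)
    qed (use c in \<open>simp add: r_def\<close>)
  next
    have "peval (\<lambda>v. poly (P v) 0) (fiber ?A f u0) = peval (zA (q, 0)) (fiber ?A f u0)"
    proof (rule poly_eval_cong)
      fix t v assume "t \<in> keys (fiber ?A f u0)" "v \<in> keys t"
      then have "snd v \<in> ?A" using keys_fiber by (fastforce simp: keys_restrict_cols)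
      then show "poly (P v) 0 = zA (q, 0) v" by (simp add: P_def \<zeta>)
    qed
    then show "peval (\<lambda>v. poly (P v) 0) (fiber ?A f u0) \<noteq> 0" using F by simp
  qed (simp add: P_def)
  \<comment> \<open>The scalar is frozen at a nonroot, so the section produced depends on the frame
    alone.\<close>
  then obtain e where e: "poly (poly_eval (\<lambda>c. [:c:]) P f) e \<noteq> 0" using poly_nonroot[OF inf] by blast
  have "ring_map (\<lambda>p :: 'k poly. poly p e)" by (simp add: ring_map_def)
  then have "peval (Z (q, e)) f \<noteq> 0"
    using e by (simp add: ring_map_poly_eval[of "\<lambda>p. poly p e"] ZP[abs_def])
  then show ?thesis
    unfolding has_section_def
    using regular_fix_snd[OF regZ] points[of "(_, e)"]
    by (intro exI[of _ "\<lambda>x. Z (fst x, e)"]) auto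
qed

text \<open>Rewrites coordinates with respect to the eliminated frame as coordinates with respect to
  the original one, so that the columns themselves remain the same.\<close>

definition elim_lift ::
  "nat \<Rightarrow> (nat \<Rightarrow> 'k::field) \<Rightarrow> nat \<Rightarrow> (nat \<Rightarrow> nat) \<Rightarrow> 'k frame \<Rightarrow>
    (nat \<times> nat \<Rightarrow> 'k) \<Rightarrow> nat \<times> nat \<Rightarrow> 'k" where
  "elim_lift s g v k q z y = (if snd y \<noteq> v then z y
    else if fst y = Suc (k v) then - (\<Sum>i\<in>{Suc (k v)<..s}. dot s g (q v i) * z (i, v))
    else if Suc (k v) < fst y \<and> fst y \<le> s then dot s g (pivot k q v) * z y else 0)"

lemma elim_lift_column:
  assumes kv: "k v < s"
  shows "pt_column s k q (elim_lift s g v k q z) j =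
    pt_column s (k(v := Suc (k v))) (elim s g v k q) z j"
proof (cases "j = v")
  case False
  then show ?thesis by (simp add: column_def elim_lift_def elim_def)
next
  case True
  let ?d = "\<lambda>i. dot s g (q v i)" and ?p = "pivot k q v"
  let ?S = "{Suc (k v)<..s}"
  show ?thesis
  proof
    fix l
    have "pt_column s k q (elim_lift s g v k q z) v l =
        - (\<Sum>i\<in>?S. ?d i * z (i, v)) * ?p l + (\<Sum>i\<in>?S. dot s g ?p * z (i, v) * q v i l)"
      unfolding column_def sum_Suc_greaterThanAtMost[OF kv]
      by (auto simp: elim_lift_def pivot_def intro!: sum.cong)
    also have "\<dots> = (\<Sum>i\<in>?S. dot s g ?p * z (i, v) * q v i l - ?d i * z (i, v) * ?p l)"
      unfolding sum_subtractf sum_distrib_right by (simp add: sum_distrib_right)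
    also have "\<dots> = pt_column s (k(v := Suc (k v))) (elim s g v k q) z v l"
      unfolding column_def by (intro sum.cong) (auto simp: elim_def algebra_simps)
    finally show "pt_column s k q (elim_lift s g v k q z) j l =
        pt_column s (k(v := Suc (k v))) (elim s g v k q) z j l"
      using True by simp
  qed
qed

lemma elim_lift_points:
  assumes kv: "k v < s" and z: "z \<in> hyp_points s Bs (k(v := Suc (k v))) (elim s g v k q)"
  shows "elim_lift s g v k q z \<in> hyp_points s Bs k q"
  unfolding hyp_points_def
proof (intro CollectI conjI allI ballI impI)
  fix i j assume j: "j \<in> \<Union>(set Bs)" "(i, j) \<notin> cells s (\<Union>(set Bs)) k"
  show "elim_lift s g v k q z (i, j) = 0"
  proof (cases "j = v")
    case True
    then show ?thesis using j kv by (auto simp: elim_lift_def cells_def)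
  next
    case False
    then have "(i, j) \<notin> cells s (\<Union>(set Bs)) (k(v := Suc (k v)))" using j by (auto simp: cells_def)
    then have "z (i, j) = 0" using z j(1) by (auto simp: hyp_points_def)
    then show ?thesis using False by (simp add: elim_lift_def)
  qed
next
  fix B js assume js: "B \<in> set Bs" "set js \<subseteq> B" "distinct js" "length js = s"
  have "map (pt_column s k q (elim_lift s g v k q z)) js =
      map (pt_column s (k(v := Suc (k v))) (elim s g v k q) z) js"
    by (intro map_cong refl elim_lift_column[where k = k and v = v and s = s, OF kv])
  moreover have "vdet (map (pt_column s (k(v := Suc (k v))) (elim s g v k q) z) js) = 0"
    using z js by (simp add: hyp_points_def)
  ultimately show "vdet (map (pt_column s k q (elim_lift s g v k q z)) js) = 0" by (simp only:)
qed

lemma dot_diff: "dot s g (\<lambda>l. a * x l - b * y l) = a * dot s g x - b * dot s g y"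
  by (simp add: dot_def sum_distrib_left sum_subtractf right_diff_distrib mult_ac)

lemma dot_elim: "dot s g (elim s g v k q v i) = 0"
  by (simp only: elim_def fun_upd_same dot_diff) (simp add: mult.commute)

lemma elim_lift_orth:
  assumes kv: "k v < s"
  shows "dot s g (pt_column s k q (elim_lift s g v k q z) v) = 0"
  unfolding elim_lift_column[where k = k and v = v and s = s, OF kv]
  unfolding column_def dot_sum by (simp add: dot_elim)

text \<open>On monomials without the pivot variable the lift only rescales the coordinates of the
  column \<open>v\<close> by one common factor, and all monomials of \<open>F\<close> have the same
  degree in that column.\<close>

lemma peval_elim_lift:
  assumes F: "keys F \<subseteq> std_set s Bs (k(v := Suc (k v))) a"
  shows "peval (elim_lift s g v k q z) F =
    dot s g (pivot k q v) ^ lookup a v * peval z F"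
proof -
  let ?c = "dot s g (pivot k q v)"
  have "monom_eval (elim_lift s g v k q z) t = ?c ^ lookup a v * monom_eval z t"
    if t: "t \<in> keys F" for t
  proof -
    have tk: "keys t \<subseteq> cells s (\<Union>(set Bs)) (k(v := Suc (k v)))" and ta: "mdeg t = a"
      using F t std_cells[of s Bs] unfolding std_set_def by blast+
    have "monom_eval (elim_lift s g v k q z) t =
        monom_eval (\<lambda>y. (if snd y = v then ?c else 1) * z y) t"
      by (rule monom_eval_cong) (use tk in \<open>auto simp: elim_lift_def cells_def\<close>)
    also have "\<dots> = monom_eval (\<lambda>y. if snd y = v then ?c else 1) t * monom_eval z t"
      by (rule monom_eval_mult)
    also have "monom_eval (\<lambda>y. if snd y = v then ?c else 1) t =
        (\<Prod>y\<in>{y \<in> keys t. snd y = v}. ?c ^ lookup t y)"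
      unfolding monom_eval_def by (intro prod.mono_neutral_cong_right) auto
    also have "\<dots> = ?c ^ lookup a v"
      by (simp add: power_sum ta[symmetric] lookup_mdeg)
    finally show ?thesis .
  qed
  then show ?thesis
    unfolding poly_eval_def sum_distrib_left by (intro sum.cong refl) (simp add: mult_ac)
qed

lemma regular_cofactors:
  assumes "\<And>f a. f \<in> set fs \<Longrightarrow> regular (\<lambda>x. f x a)"
  shows "regular (\<lambda>x. cofactors (map (\<lambda>f. f x) fs) l)"
proof -
  have "regular (\<lambda>x. vdet (map (\<lambda>f. f x) (fs @ [\<lambda>_ a. if a = l then 1 else 0])))"
    using assms by (intro regular_vdet) auto
  then show ?thesis by (simp add: cofactors_def)
qed

lemma regular_cofactors_tilt: "regular (\<lambda>x. cofactors (map (tilt s k w x) us) l)"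
proof -
  have "regular (\<lambda>x. cofactors (map (\<lambda>f. f x) (map (\<lambda>j x. tilt s k w x j) us)) l)"
    by (intro regular_cofactors) (auto simp: regular_tilt)
  then show ?thesis by (simp add: comp_def)
qed

lemma dot_cofactors_mem: "Suc (length us) = s \<Longrightarrow> y \<in> set us \<Longrightarrow> dot s (cofactors us) y = 0"
  by (simp add: dot_cofactors vdet_snoc_mem)

lemma lookup_mdeg_cells:
  assumes "keys u \<subseteq> cells s W k"
  shows "lookup (mdeg u) j = (\<Sum>i\<in>{k j<..s}. lookup u (i, j))"
proof -
  have "lookup (mdeg u) j = (\<Sum>v\<in>(\<lambda>i. (i, j)) ` {k j<..s}. lookup u v)"
    unfolding lookup_mdeg
  proof (rule sum.mono_neutral_left)
    show "{v \<in> keys u. snd v = j} \<subseteq> (\<lambda>i. (i, j)) ` {k j<..s}"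
      using subsetD[OF assms] by (fastforce simp: cells_def)
  qed (auto simp: in_keys_iff)
  also have "\<dots> = (\<Sum>i\<in>{k j<..s}. lookup u (i, j))"
    by (subst sum.reindex) (auto simp: inj_on_def)
  finally show ?thesis .
qed

lemma extend_subset:
  assumes "finite W" "U \<subseteq> W" "card U \<le> m"
  obtains X where "U \<subseteq> X" "X \<subseteq> W" "card X \<le> m" "card X = m \<or> X = W"
proof (cases "m \<le> card W")
  case True
  then show ?thesis using exists_subset_between[OF assms(3) True assms(2,1)] that by blast
next
  case False
  then show ?thesis using that[of W] assms by auto
qed

text \<open>The hyperplane is chosen in three ways. If the isolated fibre does not involve the glued
  column, this column is set to zero and pivots alone span. If it does and \<open>s - 1\<close>
  pivots occur, the column is confined to their hyperplane. Otherwise the hyperplane is spanned by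
  \<open>s - 2\<close> pivots and the column itself. Where too few new columns are available, the
  zero normal vector is used, because no nonzero minor of the block can arise.\<close>

lemma std_has_section:
  fixes f :: "'k::field polynomial"
  assumes inf: "infinite (UNIV :: 'k set)" and s: "s \<ge> 1"
    and "forest_blocks Bs" "gen_pos s Bs k q" "keys f \<subseteq> std_set s Bs k a" "f \<noteq> 0"
  shows "has_section s Bs k q f"
  using assms(3-)
proof (induction Bs arbitrary: k q f a)
  case Nil
  have "keys f \<subseteq> {0}" using Nil.prems by (auto simp: std_set_def)
  moreover have "keys f \<noteq> {}" using Nil.prems by simp
  ultimately have kf: "keys f = {0}" by blast
  have "peval (\<lambda>_. 0) f \<noteq> 0" unfolding poly_eval_def kf using kf by (simp add: in_keys_iff[symmetric])
  then show ?case unfolding has_section_def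
    by (intro exI[of _ "\<lambda>_ _. 0"]) (simp add: hyp_points_def)
next
  case (Cons B Bs)
  let ?A = "\<Union>(set Bs)" and ?W = "B - \<Union>(set Bs)"
  let ?N = "{(i, j). j \<in> ?W \<and> Suc (k j) < i \<and> i \<le> s}"
  let ?T = "restrict_cols (- ?A) ` keys f"
  let ?Wf = "{j \<in> ?W. k j < s}"
  note f = Cons.prems(3)
  have finB: "finite B" and blocks: "forest_blocks Bs" and AB: "card (B \<inter> ?A) \<le> 1"
    using Cons.prems(1) by auto
  have finW0: "finite ?Wf" using finB by simp
  have gp: "gen_pos s Bs k q" using Cons.prems(2) by simp
  have std_t: "std s (B # Bs) k (keys t)" "mdeg t = a" if "t \<in> keys f" for t
    using f that by (auto simp only: std_set_def)
  have keys_u: "keys u \<subseteq> cells s ?W k" if u: "u \<in> ?T" for u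
  proof -
    obtain t where t: "t \<in> keys f" "u = restrict_cols (- ?A) t" using u by blast
    have "keys t \<subseteq> cells s (\<Union>(set (B # Bs))) k" by (rule std_cells[OF std_t(1)[OF t(1)]])
    then show ?thesis unfolding t(2) keys_restrict_cols by (auto simp: cells_def)
  qed
  have finN: "finite ?N"
    by (rule finite_subset[of _ "{..s} \<times> B"]) (use finB in auto)
  \<comment> \<open>All monomials of \<open>f\<close> have the same degree in each column, so the
    exponents off the pivot rows determine those in the pivot rows. Weights on \<open>?N\<close>
    therefore suffice to isolate one fibre.\<close>
  have T_inj: "u = u'" if u: "u \<in> ?T" "u' \<in> ?T"
    and eq: "\<And>v. v \<in> ?N \<Longrightarrow> lookup u v = lookup u' v" for u u'
  proof (rule poly_mapping_eqI)
    fix v :: "nat \<times> nat"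
    obtain i j where v: "v = (i, j)" by (cases v)
    have deg: "lookup (mdeg y) j = lookup a j" if y: "y \<in> ?T" "j \<notin> ?A" for y
    proof -
      obtain t where t: "t \<in> keys f" "y = restrict_cols (- ?A) t" using y by blast
      have "{v \<in> keys y. snd v = j} = {v \<in> keys t. snd v = j}"
        unfolding t(2) keys_restrict_cols using y(2) by auto
      then have "lookup (mdeg y) j = lookup (mdeg t) j"
        unfolding lookup_mdeg using y(2) by (auto simp: t(2) lookup_restrict_cols intro!: sum.cong)
      then show ?thesis using std_t(2)[OF t(1)] by simp
    qed
    show "lookup u v = lookup u' v"
    proof (cases "v \<in> cells s ?W k")
      case False
      then have "v \<notin> keys u" "v \<notin> keys u'" using keys_u u by blast+
      then show ?thesis by (simp add: in_keys_iff)
    next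
      case True
      then have j: "j \<in> ?W" "k j < i" "i \<le> s" "j \<notin> ?A" using v by (auto simp: cells_def)
      then have kj: "k j < s" by simp
      show ?thesis
      proof (cases "i = Suc (k j)")
        case False
        then show ?thesis using j v by (intro eq) auto
      next
        case True
        have "(\<Sum>i\<in>{Suc (k j)<..s}. lookup u (i, j)) =
            (\<Sum>i\<in>{Suc (k j)<..s}. lookup u' (i, j))"
          using j by (intro sum.cong refl eq) auto
        moreover have "(\<Sum>i\<in>{k j<..s}. lookup u (i, j)) = (\<Sum>i\<in>{k j<..s}. lookup u' (i, j))"
          using deg[OF u(1) j(4)] deg[OF u(2) j(4)] lookup_mdeg_cells[OF keys_u[OF u(1)]]
            lookup_mdeg_cells[OF keys_u[OF u(2)]] by simp
        ultimately show ?thesis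
          unfolding sum_Suc_greaterThanAtMost[OF kj] using v True by simp
      qed
    qed
  qed
  have "?T \<noteq> {}" using Cons.prems(4) by simp
  have "\<exists>w u0. (\<forall>x. w x \<ge> (1::nat)) \<and> u0 \<in> ?T \<and>
    (\<forall>u\<in>?T - {u0}. (\<Sum>v\<in>?N. w v * lookup u0 v) < (\<Sum>v\<in>?N. w v * lookup u v))"
    by (rule unique_minimal_weight[OF finN]) (simp, fact \<open>?T \<noteq> {}\<close>, rule T_inj)
  then obtain w u0 where w: "\<And>v. w v \<ge> (1::nat)" and u0: "u0 \<in> ?T"
    and min: "\<And>u. u \<in> ?T \<Longrightarrow> u \<noteq> u0 \<Longrightarrow>
      (\<Sum>v\<in>?N. w v * lookup u0 v) < (\<Sum>v\<in>?N. w v * lookup u v)"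
    by blast
  obtain t0 where t0: "t0 \<in> keys f" "u0 = restrict_cols (- ?A) t0" using u0 by blast
  let ?F = "fiber ?A f u0"
  let ?U = "{j \<in> ?W. (Suc (k j), j) \<in> keys u0}"
  let ?a = "mdeg (restrict_cols ?A t0)"
  have F0: "?F \<noteq> 0" unfolding t0(2) by (rule fiber_nonzero[OF t0(1)])
  have aA: "keys ?a \<subseteq> ?A" by (auto simp: keys_mdeg keys_restrict_cols)
  have U_t: "{j \<in> ?W. (Suc (k j), j) \<in> keys t} = ?U"
    if "restrict_cols (- ?A) t = u0" for t
    unfolding that[symmetric] keys_restrict_cols by auto
  have cU: "card ?U < s" using std_t(1)[OF t0(1)] U_t[of t0] t0(2) by simp
  have UW0: "?U \<subseteq> ?Wf" using keys_u[OF u0] by (auto simp: cells_def)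
  have F_std: "keys ?F \<subseteq> std_set s Bs (if card ?U = s - 1 then bump B k else k) ?a"
  proof
    fix y assume "y \<in> keys ?F"
    then obtain t where t: "t \<in> keys f" "restrict_cols (- ?A) t = u0" "restrict_cols ?A t = y"
      using keys_fiber by blast
    have "std s Bs (if card ?U = s - 1 then bump B k else k) {v \<in> keys t. snd v \<in> ?A}"
      using std_t(1)[OF t(1)] U_t[OF t(2)] by simp
    moreover have "{v \<in> keys t. snd v \<in> ?A} = keys y"
      unfolding t(3)[symmetric] keys_restrict_cols ..
    moreover have "mdeg y + mdeg u0 = ?a + mdeg u0"
      using std_t(2)[OF t(1)] std_t(2)[OF t0(1)] restrict_cols_split[of ?A t] restrict_cols_split[of ?A t0]
        t(2,3) t0(2) by (metis mdeg_add)
    ultimately show "y \<in> std_set s Bs (if card ?U = s - 1 then bump B k else k) ?a"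
      by (simp add: std_set_def)
  qed
  have F_std_k: "keys ?F \<subseteq> std_set s Bs k ?a"
  proof
    fix y assume "y \<in> keys ?F"
    then have y: "std s Bs (if card ?U = s - 1 then bump B k else k) (keys y)" "mdeg y = ?a"
      using F_std by (auto simp only: std_set_def)
    have "std s Bs k (keys y)"
      by (rule std_dominated[OF blocks y(1)])
        (use std_cells[OF y(1)] in \<open>auto simp: dominated_def bump_def cells_def\<close>)
    then show "y \<in> std_set s Bs k ?a" using y(2) by (simp add: std_set_def)
  qed
  have piv_nz: "vdet (map (pivot k q) js) \<noteq> 0"
    if "distinct js" "length js = s" "set js \<subseteq> {j \<in> B. k j < s}" for js
    using Cons.prems(2) that by simp
  show ?case
  proof (cases "\<forall>v\<in>B \<inter> ?A. lookup ?a v = 0")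
    case True
    obtain z0 where z0: "\<And>v. regular (\<lambda>x. z0 x v)" "\<And>x. z0 x \<in> hyp_points s Bs k (fst x)"
      "peval (z0 (q, 0)) ?F \<noteq> 0"
      using Cons.IH[OF blocks gp F_std_k F0] unfolding has_section_def by blast
    define zA where "zA x v = (if snd v \<in> B \<inter> ?A then 0 else z0 x v)" for x v
    have zA_reg: "regular (\<lambda>x. zA x v)" for v
      unfolding zA_def by (intro regular_if regular_const z0)
    have zA_pt: "zA x \<in> hyp_points s Bs k (fst x)" for x
      using hyp_points_zero_cols[OF z0(2)[of x], of "B \<inter> ?A"] unfolding zA_def .
    have zA_col: "pt_column s k (fst x) (zA x) v = (\<lambda>l. 0)" if "v \<in> B \<inter> ?A" for x v
      using that by (simp add: column_def zA_def)
    have "peval (zA (q, 0)) ?F = peval (z0 (q, 0)) ?F"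
    proof (rule poly_eval_cong)
      fix t v assume tv: "t \<in> keys ?F" "v \<in> keys t"
      then have "snd v \<in> keys ?a"
        using F_std_k keys_mdeg[of t] by (auto simp: std_set_def)
      then have "lookup ?a (snd v) \<noteq> 0" by (simp add: in_keys_iff)
      then have "snd v \<notin> B \<inter> ?A" using True by metis
      then show "zA (q, 0) v = z0 (q, 0) v" unfolding zA_def by (rule if_not_P)
    qed
    then have FA: "peval (zA (q, 0)) ?F \<noteq> 0" using z0(3) by simp
    have cU': "card ?U \<le> s - 1" using cU by simp
    \<comment> \<open>Extra pivots complete those of \<open>u0\<close> to a spanning set of a
      hyperplane; they may be used as their coordinate is \<open>1\<close>. If there are not enough
      columns, all are taken and none is left to be projected.\<close>
    obtain Up where Up: "?U \<subseteq> Up" "Up \<subseteq> ?Wf" "card Up \<le> s - 1" "card Up = s - 1 \<or> Up = ?Wf"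
      by (rule extend_subset[OF finW0 UW0 cU'])
    have finUp: "finite Up" using finite_subset[OF Up(2) finW0] .
    obtain us where us: "set us = Up" "distinct us" using finite_distinct_list[OF finUp] by blast
    define h where "h x = (if card Up = s - 1 then cofactors (map (tilt s k w x) us) else (\<lambda>_. 0))"
      for x :: "'k param"
    have len: "Suc (length us) = s" if "card Up = s - 1"
      using that us distinct_card[of us] s by simp
    show ?thesis
    proof (rule glue_section[OF inf f u0 w min finB, where Up = Up and zA = zA and h = h])
      show "regular (\<lambda>x. h x l)" for l
        using regular_cofactors_tilt[of s k w us l] by (cases "card Up = s - 1") (simp_all add: h_def)
      show "dot s (h x) (tilt s k w x j) = 0" if "j \<in> Up" for x j
        using that us(1) len
        by (cases "card Up = s - 1") (auto simp: h_def dot_def[of s "\<lambda>_. 0"] intro!: dot_cofactors_mem)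
      show "dot s (h x) (pt_column s k (fst x) (zA x) v) = 0" if "v \<in> B \<inter> ?A" for x v
        by (simp add: zA_col[OF that] dot_def)
      show "\<exists>N. finite N \<and> card N < s \<and> Up \<subseteq> N \<and>
        (\<forall>v\<in>B \<inter> ?A. v \<in> N \<or> (\<forall>l<s. pt_column s k (fst x) (zA x) v l = 0))" for x
        using finUp Up(3) s zA_col by (intro exI[of _ Up]) auto
      show "dot s (h (q, 0)) (pivot k q j) \<noteq> 0" if j: "j \<in> ?W" "j \<notin> Up" "k j < s" for j
      proof -
        have c: "card Up = s - 1" using Up(4) j by auto
        have "dot s (h (q, 0)) (pivot k q j) = vdet (map (pivot k q) (us @ [j]))"
          using len[OF c] c by (simp add: h_def tilt_0[of w, OF w] dot_cofactors)
        also have "\<dots> \<noteq> 0" using us Up(2) j len[OF c] by (intro piv_nz) auto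
        finally show ?thesis .
      qed
    qed (use Up UW0 zA_reg zA_pt FA in auto)
  next
    case False
    then obtain v where v: "v \<in> B \<inter> ?A" "lookup ?a v \<ge> 1" by force
    have ABv: "B \<inter> ?A = {v}"
    proof -
      have "finite (B \<inter> ?A)" using finB by simp
      then show ?thesis using v(1) AB card_le_Suc0_iff_eq[of "B \<inter> ?A"] by auto
    qed
    have vA: "v \<in> ?A" "v \<notin> ?W" using v(1) by auto
    have kv: "k v < s"
    proof -
      have "v \<in> keys ?a" using v(2) by (simp add: in_keys_iff)
      then obtain i where "(i, v) \<in> keys t0" by (auto simp: keys_mdeg keys_restrict_cols)
      then show ?thesis using std_cells[OF std_t(1)[OF t0(1)]] by (auto simp: cells_def)
    qed
    have gpe: "gen_pos s Bs (k(v := Suc (k v))) (elim s (cofactors (map (pivot k q) us)) v k q)"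
      if "distinct us" "Suc (length us) = s" "set us \<subseteq> ?Wf" for us
      using Cons.prems(2) that v(1) kv by auto
    have gpv: "dot s (cofactors (map (pivot k q) us)) (pivot k q v) \<noteq> 0"
      if "distinct us" "Suc (length us) = s" "set us \<subseteq> ?Wf" for us
    proof -
      have "dot s (cofactors (map (pivot k q) us)) (pivot k q v) = vdet (map (pivot k q) (us @ [v]))"
        using that by (simp add: dot_cofactors)
      also have "\<dots> \<noteq> 0" using that v(1) kv vA by (intro piv_nz) auto
      finally show ?thesis .
    qed
    show ?thesis
    proof (cases "card ?U = s - 1")
      case True
      have finU: "finite ?U" using finite_subset[OF UW0 finW0] .
      obtain us where us: "set us = ?U" "distinct us" using finite_distinct_list[OF finU] by blast
      have len: "Suc (length us) = s" using us True s distinct_card[of us] by simp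
      have usW0: "set us \<subseteq> ?Wf" using us(1) UW0 by simp
      let ?k = "k(v := Suc (k v))"
      have "std s Bs (bump B k) S \<longleftrightarrow> std s Bs ?k S" for S
        using ABv by (intro std_cong) (auto simp: bump_def)
      then have Fk: "keys ?F \<subseteq> std_set s Bs ?k ?a"
        using F_std True by (simp add: std_set_def)
      let ?q = "elim s (cofactors (map (pivot k q) us)) v k q"
      obtain z0 where z0: "\<And>v. regular (\<lambda>x. z0 x v)" "\<And>x. z0 x \<in> hyp_points s Bs ?k (fst x)"
        "peval (z0 (?q, 0)) ?F \<noteq> 0"
        using Cons.IH[OF blocks gpe[OF us(2) len usW0] Fk F0] unfolding has_section_def by blast
      define h where "h x = cofactors (map (tilt s k w x) us)" for x :: "'k param"
      have h_reg: "regular (\<lambda>x. h x l)" for l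
        unfolding h_def by (rule regular_cofactors_tilt)
      have h_0: "h (q, 0) = cofactors (map (pivot k q) us)"
        by (simp add: h_def tilt_0[of w, OF w])
      \<comment> \<open>The section for the restricted column is evaluated at the frame eliminated
        along the tilted hyperplane, which moves with the scalar. Here it pays that sections are
        defined and polynomial for all frames.\<close>
      define zA where "zA x = elim_lift s (h x) v k (fst x) (z0 (elim s (h x) v k (fst x), 0))" for x
      have elim_reg: "regular (\<lambda>x. elim s (h x) v k (fst x) j i l)" for j i l
      proof (cases "j = v")
        case True
        then show ?thesis unfolding elim_def pivot_def
          by (simp, intro regular_diff regular_mult regular_dot h_reg regular_coord)
      qed (simp add: elim_def)
      have z0_reg: "regular (\<lambda>x. z0 (elim s (h x) v k (fst x), 0) y)" for y
        using regular_comp[OF z0(1) elim_reg regular_const] .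
      have zA_reg: "regular (\<lambda>x. zA x y)" for y
        unfolding zA_def elim_lift_def pivot_def
        by (intro regular_if regular_const regular_uminus regular_sum regular_mult regular_dot
            h_reg regular_coord z0_reg)
      have zA_pt: "zA x \<in> hyp_points s Bs k (fst x)" for x
        unfolding zA_def using z0(2)[of "(elim s (h x) v k (fst x), 0)"]
        by (intro elim_lift_points[where k = k and v = v and s = s, OF kv]) simp
      have zA_orth: "dot s (h x) (pt_column s k (fst x) (zA x) v) = 0" for x
        unfolding zA_def by (rule elim_lift_orth[where k = k and v = v and s = s, OF kv])
      have FA: "peval (zA (q, 0)) ?F \<noteq> 0"
        unfolding zA_def peval_elim_lift[OF Fk] fst_conv h_0
        using z0(3) gpv[OF us(2) len usW0] by simp
      show ?thesis
      proof (rule glue_section[OF inf f u0 w min finB, where Up = ?U and zA = zA and h = h])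
        show "dot s (h x) (tilt s k w x j) = 0" if "j \<in> ?U" for x j
          using that us(1) len unfolding h_def by (intro dot_cofactors_mem) auto
        show "dot s (h x) (pt_column s k (fst x) (zA x) y) = 0" if "y \<in> B \<inter> ?A" for x y
          using zA_orth that ABv by auto
        show "\<exists>N. finite N \<and> card N < s \<and> ?U \<subseteq> N \<and>
          (\<forall>v\<in>B \<inter> ?A. v \<in> N \<or> (\<forall>l<s. pt_column s k (fst x) (zA x) v l = 0))"
          if hx: "\<And>l. l < s \<Longrightarrow> h x l = 0" for x
        proof -
          have d0: "dot s (h x) y = 0" for y using hx by (simp add: dot_def)
          \<comment> \<open>When the normal vector vanishes, elimination sends all vectors of the
            column \<open>v\<close> to zero.\<close>
          have "pt_column s k (fst x) (zA x) v l = 0" for l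
            unfolding zA_def elim_lift_column[where k = k and v = v and s = s, OF kv] by (simp add: column_def elim_def d0)
          then show ?thesis using finU cU ABv by (intro exI[of _ ?U]) auto
        qed
        show "dot s (h (q, 0)) (pivot k q j) \<noteq> 0" if j: "j \<in> ?W" "j \<notin> ?U" "k j < s" for j
        proof -
          have "dot s (h (q, 0)) (pivot k q j) = vdet (map (pivot k q) (us @ [j]))"
            using len by (simp add: h_0 dot_cofactors)
          also have "\<dots> \<noteq> 0" using us usW0 j len by (intro piv_nz) auto
          finally show ?thesis .
        qed
      qed (use UW0 zA_reg zA_pt FA h_reg in auto)
    next
      case False
      have cU': "card ?U \<le> s - 2" and s2: "s \<ge> 2" using cU False by auto
      obtain Up where Up: "?U \<subseteq> Up" "Up \<subseteq> ?Wf" "card Up \<le> s - 2" "card Up = s - 2 \<or> Up = ?Wf"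
        by (rule extend_subset[OF finW0 UW0 cU'])
      have finUp: "finite Up" using finite_subset[OF Up(2) finW0] .
      obtain us where us: "set us = Up" "distinct us" using finite_distinct_list[OF finUp] by blast
      have len: "Suc (Suc (length us)) = s" if "card Up = s - 2"
        using that us distinct_card[of us] s2 by simp
      have vUp: "v \<notin> Up" using vA Up(2) by blast
      have usj: "distinct (us @ [j])" "Suc (length (us @ [j])) = s" "set (us @ [j]) \<subseteq> ?Wf"
        if "card Up = s - 2" "j \<in> ?Wf - Up" for j
        using that us Up(2) len by auto
      let ?g = "\<lambda>j. cofactors (map (pivot k q) (us @ [j]))"
      have fin_diff: "finite (?Wf - Up)" using finW0 by simp
      obtain ws where ws: "set ws = ?Wf - Up" using finite_list[OF fin_diff] by blast
      have ind: "std_indep s Bs k q"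
        unfolding std_indep_def
        using Cons.IH[OF blocks gp] has_section_not_mem by blast
      have spans: "std_spans s Bs k q" by (rule std_spans[OF blocks s gp])
      \<comment> \<open>The factor for \<open>j\<close> is the determinant of the pivots of
        \<open>Up\<close>, the pivot of \<open>j\<close> and the column \<open>v\<close>. A point at
        which the product does not vanish keeps the fibre nonzero and every remaining pivot off the
        hyperplane. If \<open>Up\<close> has fewer than \<open>s - 2\<close> elements, nothing
        remains and the product is empty.\<close>
      obtain b f' where f': "keys f' \<subseteq> std_set s Bs k b" "f' \<noteq> 0"
        "f' - ?F * prod_list (map (\<lambda>g. linform s g v k q) (map ?g ws)) \<in> hyp_ideal s Bs k q"
      proof (cases "card Up = s - 2")
        case True
        have "dot s g (pivot k q v) \<noteq> 0 \<and> std_spans s Bs (k(v := Suc (k v))) (elim s g v k q)"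
          if "g \<in> set (map ?g ws)" for g
        proof -
          obtain j where j: "j \<in> ?Wf - Up" "g = ?g j" using \<open>g \<in> set (map ?g ws)\<close> ws by auto
          show ?thesis unfolding j(2)
            using gpv[OF usj[OF True j(1)]] std_spans[OF blocks s gpe[OF usj[OF True j(1)]]] by blast
        qed
        from linforms_nonzerodivisor[OF blocks vA(1) kv spans ind this aA v(2) F_std_k F0]
        show ?thesis using that by blast
      next
        case False
        then have "ws = []" using Up(4) ws by simp
        then show ?thesis using that[OF F_std_k F0] by (simp add: poly_module.span_zero)
      qed
      obtain z0 where z0: "\<And>v. regular (\<lambda>x. z0 x v)" "\<And>x. z0 x \<in> hyp_points s Bs k (fst x)"
        "peval (z0 (q, 0)) f' \<noteq> 0"
        using Cons.IH[OF blocks gp f'(1,2)] unfolding has_section_def by blast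
      let ?z = "z0 (q, 0)"
      have "peval ?z (f' - ?F * prod_list (map (\<lambda>g. linform s g v k q) (map ?g ws))) = 0"
        using z0(2)[of "(q, 0)"] by (intro peval_hyp_ideal[OF _ f'(3)]) simp
      then have nz: "peval ?z ?F * peval ?z (prod_list (map (\<lambda>g. linform s g v k q) (map ?g ws))) \<noteq> 0"
        using z0(3) by (simp add: ring_mapD[OF peval_ring_map])
      have prod: "peval ?z (prod_list xs) = prod_list (map (peval ?z) xs)" for xs
        by (induction xs) (auto simp: ring_mapD[OF peval_ring_map])
      have nzj: "dot s (?g j) (pt_column s k q ?z v) \<noteq> 0" if "j \<in> ?Wf - Up" for j
        using nz that ws unfolding prod by (auto simp: prod_list_zero_iff peval_linform image_iff)
      define h where "h x = (if card Up = s - 2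
        then cofactors (map (tilt s k w x) us @ [pt_column s k (fst x) (z0 x) v]) else (\<lambda>_. 0))"
        for x :: "'k param"
      show ?thesis
      proof (rule glue_section[OF inf f u0 w min finB, where Up = Up and zA = z0 and h = h])
        have col_reg: "regular (\<lambda>x. pt_column s k (fst x) (z0 x) v l)" for l
          unfolding column_def by (intro regular_sum regular_mult z0 regular_coord)
        have "regular (\<lambda>x. cofactors (map (\<lambda>f. f x)
            (map (\<lambda>j x. tilt s k w x j) us @ [\<lambda>x. pt_column s k (fst x) (z0 x) v])) l)" for l
          using regular_tilt col_reg by (intro regular_cofactors) auto
        then show "regular (\<lambda>x. h x l)" for l
          by (cases "card Up = s - 2") (simp_all add: h_def comp_def)
        show "dot s (h x) (tilt s k w x j) = 0" if "j \<in> Up" for x j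
          using that us(1) len
          by (cases "card Up = s - 2") (auto simp: h_def dot_def[of s "\<lambda>_. 0"] intro!: dot_cofactors_mem)
        show "dot s (h x) (pt_column s k (fst x) (z0 x) y) = 0" if "y \<in> B \<inter> ?A" for x y
          using that ABv len
          by (cases "card Up = s - 2") (auto simp: h_def dot_def[of s "\<lambda>_. 0"] intro!: dot_cofactors_mem)
        show "\<exists>N. finite N \<and> card N < s \<and> Up \<subseteq> N \<and>
          (\<forall>v\<in>B \<inter> ?A. v \<in> N \<or> (\<forall>l<s. pt_column s k (fst x) (z0 x) v l = 0))" for x
          using finUp Up(3) s2 ABv vUp by (intro exI[of _ "insert v Up"]) auto
        show "dot s (h (q, 0)) (pivot k q j) \<noteq> 0" if j: "j \<in> ?W" "j \<notin> Up" "k j < s" for j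
        proof -
          have jW: "j \<in> ?Wf - Up" using j by simp
          have c: "card Up = s - 2" using Up(4) jW by auto
          let ?x = "pt_column s k q ?z v" and ?P = "map (pivot k q) us"
          have "dot s (h (q, 0)) (pivot k q j) = vdet (?P @ [?x] @ [pivot k q j])"
            using len[OF c] c by (simp add: h_def tilt_0[of w, OF w] dot_cofactors)
          moreover have "dot s (?g j) ?x = vdet (?P @ [pivot k q j] @ [?x])"
            using len[OF c] by (simp add: dot_cofactors)
          moreover have "mset (?P @ [?x] @ [pivot k q j]) = mset (?P @ [pivot k q j] @ [?x])" by simp
          ultimately show ?thesis using nzj[OF jW] vdet_mset by fastforce
        qed
      qed (use Up UW0 z0 nz in auto)
    qed
  qed
qed

lemma std_indep:
  assumes "infinite (UNIV :: 'k::field set)" "s \<ge> 1" "forest_blocks Bs"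
    and "gen_pos s Bs k (q :: 'k frame)"
  shows "std_indep s Bs k q"
  unfolding std_indep_def using std_has_section[OF assms] has_section_not_mem by blast

section \<open>Existence of coordinates in general position\<close>

text \<open>Vectors outside the cells of the blocks never enter. This locality leaves the frame free
  elsewhere when the eliminated vectors are prescribed.\<close>

lemma gen_pos_cong:
  assumes "\<And>j i. j \<in> \<Union>(set Bs) \<Longrightarrow> k j < i \<Longrightarrow> i \<le> s \<Longrightarrow> q j i = q' j i"
  shows "gen_pos s Bs k q \<longleftrightarrow> gen_pos s Bs k q'"
  using assms
proof (induction Bs arbitrary: k q q')
  case (Cons B Bs)
  let ?A = "\<Union>(set Bs)"
  have piv: "pivot k q j = pivot k q' j" if "j \<in> B \<union> ?A" "k j < s" for j
    using Cons.prems[of j "Suc (k j)"] that by (simp add: pivot_def)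
  have pivs: "map (pivot k q) js = map (pivot k q') js" if "set js \<subseteq> {j \<in> B. k j < s}" for js
    using that by (intro map_cong refl piv) auto
  have rec: "gen_pos s Bs (k(v := Suc (k v))) (elim s (cofactors (map (pivot k q) us)) v k q) \<longleftrightarrow>
      gen_pos s Bs (k(v := Suc (k v))) (elim s (cofactors (map (pivot k q') us)) v k q')"
    if us: "set us \<subseteq> {j \<in> B - ?A. k j < s}" and v: "v \<in> B \<inter> ?A" "k v < s" for us v
  proof (rule Cons.IH)
    fix j i assume j: "j \<in> ?A" "(k(v := Suc (k v))) j < i" "i \<le> s"
    have m: "map (pivot k q) us = map (pivot k q') us" using us by (intro pivs) auto
    have p: "pivot k q v = pivot k q' v" using v by (intro piv) auto
    have ji: "q j i = q' j i" using j by (intro Cons.prems) (auto split: if_splits)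
    show "elim s (cofactors (map (pivot k q) us)) v k q j i =
        elim s (cofactors (map (pivot k q') us)) v k q' j i"
    proof (cases "j = v")
      case True
      show ?thesis using ji unfolding True elim_def m p fun_upd_same by (simp only:)
    next
      case False
      then show ?thesis using ji by (simp add: elim_def)
    qed
  qed
  have "gen_pos s Bs k q \<longleftrightarrow> gen_pos s Bs k q'" using Cons.prems by (intro Cons.IH) auto
  moreover have "vdet (map (pivot k q) js) = vdet (map (pivot k q') js)"
    if "set js \<subseteq> {j \<in> B. k j < s}" for js
    by (simp only: pivs[OF that])
  ultimately show ?case
    unfolding gen_pos.simps by (intro conj_cong iff_allI imp_cong refl) (use rec in auto)
qed simp

lemma vdet_unit_vectors:
  assumes "distinct js" "length js = s"
  shows "vdet (map (\<lambda>j l. if j = js ! l then 1 else 0) js) = (1 :: 'a::field)"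
proof -
  have "mat s s (\<lambda>(b, a). (map (\<lambda>j l. if j = js ! l then 1 else 0) js ! b) a) = (1\<^sub>m s :: 'a mat)"
    using assms by (intro eq_matI) (auto simp: nth_eq_iff_index_eq)
  then show ?thesis using assms by (simp add: vdet_def)
qed

lemma generic_vdet:
  assumes "distinct js" "length js = s"
  shows "generic (\<lambda>q :: nat \<Rightarrow> nat \<Rightarrow> nat \<Rightarrow> 'k::field. vdet (map (\<lambda>j. q j (c j)) js) \<noteq> 0)"
  unfolding generic_def
proof (intro exI[of _ "\<lambda>x. vdet (map (\<lambda>j. fst x j (c j)) js)"] conjI
    exI[of _ "\<lambda>j i l. if j = js ! l then 1 else 0"])
  have "regular (\<lambda>x. vdet (map (\<lambda>f. f x) (map (\<lambda>j (x :: 'k param). fst x j (c j)) js)))"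
    by (intro regular_vdet) auto
  then show "regular (\<lambda>x :: 'k param. vdet (map (\<lambda>j. fst x j (c j)) js))" by (simp add: comp_def)
  show "vdet (map (\<lambda>j. fst (\<lambda>j i l. if j = js ! l then 1 else 0 :: 'k, 0 :: 'k) j (c j)) js) \<noteq> 0"
    using vdet_unit_vectors[OF assms, where 'a = 'k] by simp
qed auto

lemma generic_basis:
  "generic (\<lambda>q :: nat \<Rightarrow> nat \<Rightarrow> nat \<Rightarrow> 'k::field. vdet (map (q j) [1..<Suc s]) \<noteq> 0)"
  unfolding generic_def
proof (intro exI[of _ "\<lambda>x. vdet (map (fst x j) [1..<Suc s])"] conjI
    exI[of _ "\<lambda>_ i l. if i = [1..<Suc s] ! l then 1 else 0"])
  have "regular (\<lambda>x. vdet (map (\<lambda>f. f x) (map (\<lambda>i (x :: 'k param). fst x j i) [1..<Suc s])))"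
    by (intro regular_vdet) auto
  then show "regular (\<lambda>x :: 'k param. vdet (map (fst x j) [1..<Suc s]))" by (simp only: map_map comp_def)
  show "vdet (map (fst (\<lambda>_ i l. if i = [1..<Suc s] ! l then 1 else 0 :: 'k, 0 :: 'k) j) [1..<Suc s]) \<noteq> 0"
    using vdet_unit_vectors[of "[1..<Suc s]" s, where 'a = 'k] by (simp del: upt_Suc)
qed auto

text \<open>
  The elimination is generic because the vectors remaining in the eliminated column can be
  prescribed: being fewer than \<open>s\<close>, they lie in a hyperplane, and this hyperplane can be taken as
  the span of the pivots used for the elimination, which belong to other columns.
\<close>

lemma generic_elim:
  fixes P :: "'k::field frame \<Rightarrow> bool"
  assumes P: "generic P"
    and cong: "\<And>q q'. (\<And>j i. j \<in> A \<Longrightarrow> (k(v := Suc (k v))) j < i \<Longrightarrow> i \<le> s \<Longrightarrow> q j i = q' j i) \<Longrightarrow> P q \<Longrightarrow> P q'"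
    and us: "distinct us" "Suc (length us) = s" "set us \<inter> A = {}" and v: "v \<in> A" "k v < s"
  shows "generic (\<lambda>q. P (elim s (cofactors (map (pivot k q) us)) v k q))"
proof -
  obtain f \<theta> where f: "regular f" "f (\<theta>, 0) \<noteq> 0" "\<And>q. f (q, 0) \<noteq> 0 \<Longrightarrow> P q"
    using P unfolding generic_def by blast
  \<comment> \<open>\<open>M q\<close> agrees with the eliminated frame wherever \<open>P\<close>
    looks and with the good frame \<open>\<theta>\<close> elsewhere. It then suffices to find one
    \<open>q\<close> with \<open>M q = \<theta>\<close>.\<close>
  define M where "M q j i l = (if j = v \<and> Suc (k v) < i \<and> i \<le> s
      then elim s (cofactors (map (pivot k q) us)) v k q v i l
      else if j \<in> A \<and> j \<noteq> v \<and> k j < i \<and> i \<le> s then q j i l else \<theta> j i l)" for q :: "'k frame" and j i l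
  have "regular (\<lambda>x. cofactors (map (\<lambda>f. f x) (map (\<lambda>j (x :: 'k param). pivot k (fst x) j) us)) l)" for l
    by (intro regular_cofactors) (auto simp: pivot_def)
  then have cof: "regular (\<lambda>x :: 'k param. cofactors (map (pivot k (fst x)) us) l)" for l
    by (simp add: comp_def)
  have M_reg: "regular (\<lambda>x. M (fst x) j i l)" for j i l
    unfolding M_def elim_def pivot_def[of k _ v] fun_upd_same
    by (intro regular_if regular_diff regular_mult regular_dot cof regular_coord regular_const)
  have reg: "regular (\<lambda>x. f (M (fst x), 0))"
    by (rule regular_comp[OF f(1) M_reg regular_const])
  have imp: "P (elim s (cofactors (map (pivot k q) us)) v k q)" if "f (M q, 0) \<noteq> 0" for q
  proof (rule cong[OF _ f(3)[OF that]])
    fix j i assume j: "j \<in> A" "(k(v := Suc (k v))) j < i" "i \<le> s"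
    then show "M q j i = elim s (cofactors (map (pivot k q) us)) v k q j i"
      by (cases "j = v") (auto simp: M_def elim_def)
  qed
  let ?Y = "map (\<theta> v) [Suc (Suc (k v))..<Suc s]"
  have "length ?Y < s" using v(2) by (simp del: upt_Suc)
  then obtain h l where h: "l < s" "h l \<noteq> 0" "\<forall>y\<in>set ?Y. dot s h y = 0" by (rule ex_orthogonal)
  obtain ys w where ys: "length ys = s - 1" "vdet (ys @ [w]) \<noteq> 0"
    "\<And>x. dot s h x = 0 \<Longrightarrow> vdet (ys @ [x]) = 0"
    using ex_hyperplane_basis[of l s h, OF h(1,2)] by blast
  let ?c = "vdet (ys @ [w])"
  \<comment> \<open>The pivots of \<open>us\<close> become the basis \<open>ys\<close> of the
    hyperplane, and the pivot of \<open>v\<close> the vector \<open>w\<close> outside of it.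
    Dividing by \<open>?c\<close> cancels the factor that the division-free elimination
    introduces.\<close>
  define q where "q j i l = (if j \<in> set us then the (map_of (zip us ys) j) l
    else if j = v then (if i = Suc (k v) then w l else \<theta> v i l / ?c) else \<theta> j i l)" for j i l
  have len: "length us = length ys" using us(2) ys(1) by simp
  have vus: "v \<notin> set us" using us(3) v(1) by blast
  have piv: "map (pivot k q) us = ys"
  proof (rule nth_equalityI)
    fix b assume "b < length (map (pivot k q) us)"
    then have b: "b < length us" by simp
    then have "map_of (zip us ys) (us ! b) = Some (ys ! b)"
      using len us(1) by (intro map_of_zip_nth) auto
    then show "map (pivot k q) us ! b = ys ! b"
      using b by (auto simp: pivot_def q_def)
  qed (use len in simp)
  have pv: "pivot k q v = w" using vus by (auto simp: pivot_def q_def)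
  have ds: "dot s (cofactors ys) x = vdet (ys @ [x])" for x
    using ys(1) v(2) by (intro dot_cofactors) simp
  have "M q j i l = \<theta> j i l" for j i l
  proof (cases "j = v \<and> Suc (k v) < i \<and> i \<le> s")
    case True
    have qi: "q v i = (\<lambda>l. \<theta> v i l / ?c)" using True vus by (auto simp: q_def)
    have "i \<in> set [Suc (Suc (k v))..<Suc s]" using True by (simp del: upt_Suc)
    then have "\<theta> v i \<in> set ?Y" unfolding set_map by (rule imageI)
    then have "dot s h (\<theta> v i) = 0" using h(3) by blast
    then have "dot s h (q v i) = 0"
      unfolding qi dot_def by (simp add: sum_divide_distrib[symmetric])
    then have "dot s (cofactors ys) (q v i) = 0" unfolding ds by (rule ys(3))
    then have "elim s (cofactors ys) v k q v i l = ?c * q v i l"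
      by (simp add: elim_def pv ds)
    also have "\<dots> = \<theta> v i l" using ys(2) by (simp add: qi)
    finally show ?thesis using True by (simp add: M_def piv)
  next
    case False
    have "q j i l = \<theta> j i l" if "j \<in> A" "j \<noteq> v"
    proof -
      have "j \<notin> set us" using that us(3) by blast
      then show ?thesis using that by (simp add: q_def)
    qed
    then show ?thesis using False by (auto simp: M_def)
  qed
  then have "M q = \<theta>" by (intro ext)
  then show ?thesis
    unfolding generic_def using reg imp f(2)
    by (intro exI[of _ "\<lambda>x. f (M (fst x), 0)"] conjI exI[of _ q]) auto
qed

lemma gen_pos_generic:
  assumes inf: "infinite (UNIV :: 'k::field set)" and "forest_blocks Bs"
  shows "generic (gen_pos s Bs k :: 'k frame \<Rightarrow> bool)"
  using assms(2)
proof (induction Bs arbitrary: k)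
  case Nil
  show ?case by (rule generic_mono[OF generic_True]) simp
next
  case (Cons B Bs)
  let ?A = "\<Union>(set Bs)"
  let ?J = "{js. distinct js \<and> length js = s \<and> set js \<subseteq> {j \<in> B. k j < s}}"
  let ?X = "{(us, v). (distinct us \<and> Suc (length us) = s \<and> set us \<subseteq> {j \<in> B - ?A. k j < s}) \<and>
      v \<in> B \<inter> ?A \<and> k v < s}"
  have finB: "finite B" and blocks: "forest_blocks Bs" using Cons.prems by auto
  have finJ: "finite ?J"
    by (rule finite_subset[OF _ finite_lists_length_eq[of B s]]) (use finB in auto)
  have finX: "finite ?X"
    by (rule finite_subset[of _ "{us. set us \<subseteq> B \<and> length us = s - 1} \<times> B"])
      (use finB finite_lists_length_eq[of B "s - 1"] in auto)
  have 1: "generic (\<lambda>q :: 'k frame. \<forall>js\<in>?J. vdet (map (pivot k q) js) \<noteq> 0)"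
  proof (rule generic_finite_ball[OF inf finJ])
    fix js assume "js \<in> ?J"
    then have "generic (\<lambda>q :: 'k frame. vdet (map (\<lambda>j. q j (Suc (k j))) js) \<noteq> 0)"
      by (intro generic_vdet) auto
    then show "generic (\<lambda>q :: 'k frame. vdet (map (pivot k q) js) \<noteq> 0)"
      by (simp add: pivot_def[abs_def])
  qed
  have 2: "generic (\<lambda>q :: 'k frame. \<forall>x\<in>?X. gen_pos s Bs (k(snd x := Suc (k (snd x))))
      (elim s (cofactors (map (pivot k q) (fst x))) (snd x) k q))"
  proof (rule generic_finite_ball[OF inf finX])
    fix x assume x: "x \<in> ?X"
    obtain us v where uv: "x = (us, v)" by (cases x)
    let ?P = "gen_pos s Bs (k(v := Suc (k v))) :: 'k frame \<Rightarrow> bool"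
    have "generic (\<lambda>q. ?P (elim s (cofactors (map (pivot k q) us)) v k q))"
    proof (rule generic_elim[where A = ?A])
      show "generic ?P" by (rule Cons.IH[OF blocks])
      show "?P q'" if "\<And>j i. j \<in> ?A \<Longrightarrow> (k(v := Suc (k v))) j < i \<Longrightarrow> i \<le> s \<Longrightarrow> q j i = q' j i" "?P q" for q q'
        using that(2) gen_pos_cong[of Bs "k(v := Suc (k v))" s q q'] that(1) by blast
    qed (use x uv in auto)
    then show "generic (\<lambda>q :: 'k frame. gen_pos s Bs (k(snd x := Suc (k (snd x))))
        (elim s (cofactors (map (pivot k q) (fst x))) (snd x) k q))"
      by (simp only: uv fst_conv snd_conv)
  qed
  show ?case
    using generic_conj[OF inf 1 generic_conj[OF inf Cons.IH[OF blocks] 2]]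
    by (rule generic_mono) (auto 0 0)
qed

lemma ex_gen_pos:
  assumes inf: "infinite (UNIV :: 'k::field set)" and "forest_blocks Bs" "finite W"
  obtains q :: "'k::field frame" where "gen_pos s Bs k q"
    "\<And>j. j \<in> W \<Longrightarrow> vdet (map (q j) [1..<Suc s]) \<noteq> 0"
proof -
  have "generic (\<lambda>q :: 'k frame. \<forall>j\<in>W. vdet (map (q j) [1..<Suc s]) \<noteq> 0)"
    by (rule generic_finite_ball[OF inf assms(3) generic_basis])
  from generic_ex[OF generic_conj[OF inf gen_pos_generic[OF inf assms(2)] this]] that
  show ?thesis by blast
qed

lemma complete_hypergraph_forest_blocks:
  assumes "complete_hypergraph_forest s V E"
  shows "\<exists>Bs. forest_blocks Bs \<and> \<Union>(set Bs) = V \<and> E = (\<Union>B\<in>set Bs. [B]\<^bsup>s\<^esup>)"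
  using assms
proof (induction rule: complete_hypergraph_forest.induct)
  case (complete V)
  then show ?case by (intro exI[of _ "[V]"]) auto
next
  case (glue V A B E1 E2)
  then obtain Bs where Bs: "forest_blocks Bs" "\<Union>(set Bs) = A" "E1 = (\<Union>B\<in>set Bs. [B]\<^bsup>s\<^esup>)" by blast
  have "finite B" using glue.hyps(1,3) finite_subset by blast
  then have "forest_blocks (B # Bs)" using Bs glue.hyps(7) by (simp add: Int_commute)
  moreover have "\<Union>(set (B # Bs)) = V" using Bs glue.hyps(6) by auto
  moreover have "E1 \<union> E2 = (\<Union>B\<in>set (B # Bs). [B]\<^bsup>s\<^esup>)" using Bs glue.hyps(5) by auto
  ultimately show ?case by blast
qed

section \<open>Ideals of the ring of a matrix\<close>

lemma const_poly_closed: "const_poly c \<in> carrier (mat_ring m n)"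
  by (auto simp: mat_ring_def const_poly_def monomials_def)

lemma mono_poly_closed: "t \<in> monomials m n \<Longrightarrow> mono_poly t \<in> carrier (mat_ring m n)"
  by (auto simp: mat_ring_def mono_poly_def)

lemma mat_ring_power_closed:
  "p \<in> carrier (mat_ring m n) \<Longrightarrow> p ^ k \<in> carrier (mat_ring m n)"
  by (induction k) (auto intro: mat_ring_one_closed mat_ring_mult_closed)

lemma mat_ring_idealI:
  fixes I :: "'k::field polynomial set"
  assumes "I \<subseteq> carrier (mat_ring m n)" "0 \<in> I" "\<And>x y. x \<in> I \<Longrightarrow> y \<in> I \<Longrightarrow> x + y \<in> I"
    and mult: "\<And>r x. r \<in> carrier (mat_ring m n) \<Longrightarrow> x \<in> I \<Longrightarrow> r * x \<in> I"
  shows "ideal I (mat_ring m n)"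
proof -
  interpret R: cring "mat_ring m n :: 'k polynomial ring" by (rule mat_ring_cring)
  have neg: "inv\<^bsub>add_monoid (mat_ring m n)\<^esub> x = - x" if x: "x \<in> carrier (mat_ring m n)" for x :: "'k polynomial"
  proof -
    have "\<ominus>\<^bsub>mat_ring m n\<^esub> x = - x"
      using x mat_ring_uminus_closed[OF x] by (intro R.minus_equality) auto
    then show ?thesis by (simp add: a_inv_def)
  qed
  show ?thesis
  proof (rule idealI)
    show "ring (mat_ring m n :: 'k polynomial ring)" by (rule R.ring_axioms)
    show "subgroup I (add_monoid (mat_ring m n))"
    proof (rule subgroup.intro)
      fix x assume x: "x \<in> I"
      have "(- 1) * x \<in> I" by (intro mult x mat_ring_uminus_closed mat_ring_one_closed)
      then show "inv\<^bsub>add_monoid (mat_ring m n)\<^esub> x \<in> I" using neg[of x] x assms(1) by auto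
    qed (use assms in auto)
  next
    fix a x :: "'k polynomial" assume "a \<in> I" "x \<in> carrier (mat_ring m n)"
    then have "x * a \<in> I" by (rule mult[rotated])
    then show "x \<otimes>\<^bsub>mat_ring m n\<^esub> a \<in> I" "a \<otimes>\<^bsub>mat_ring m n\<^esub> x \<in> I" by (simp_all add: mult.commute)
  qed
qed

lemma mat_ring_idealD:
  fixes I :: "'k::field polynomial set"
  assumes "ideal I (mat_ring m n)"
  shows "I \<subseteq> carrier (mat_ring m n)" "0 \<in> I" "\<And>x y. x \<in> I \<Longrightarrow> y \<in> I \<Longrightarrow> x + y \<in> I"
    "\<And>r x. r \<in> carrier (mat_ring m n) \<Longrightarrow> x \<in> I \<Longrightarrow> r * x \<in> I"
proof -
  interpret ideal I "mat_ring m n" by fact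
  have add: "additive_subgroup I (mat_ring m n)" by (rule ideal.axioms(1)[OF assms])
  show "I \<subseteq> carrier (mat_ring m n)" by (rule a_subset)
  show "0 \<in> I" using additive_subgroup.zero_closed[OF add] by simp
  show "\<And>x y. x \<in> I \<Longrightarrow> y \<in> I \<Longrightarrow> x + y \<in> I" using additive_subgroup.a_closed[OF add] by simp
  show "\<And>r x. r \<in> carrier (mat_ring m n) \<Longrightarrow> x \<in> I \<Longrightarrow> r * x \<in> I" using I_l_closed by simp
qed

lemma poly_subst_closed:
  assumes "\<And>t i j. t \<in> keys p \<Longrightarrow> (i, j) \<in> keys t \<Longrightarrow>
    \<phi> i j \<in> carrier (mat_ring m n)"
  shows "poly_subst \<phi> p \<in> carrier (mat_ring m n)"
  unfolding poly_subst_def using assms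
  by (intro mat_ring_sum_closed mat_ring_mult_closed const_poly_closed mat_ring_prod_closed)
    (auto intro: mat_ring_power_closed)

definition retract :: "nat \<Rightarrow> nat \<Rightarrow> 'k::field polynomial \<Rightarrow> 'k polynomial" where
  "retract m n = poly_subst (\<lambda>i j. if i \<in> {1..m} \<and> j \<in> {1..n} then var_poly i j else 0)"

lemma retract_ring_map: "ring_map (retract m n)"
  unfolding retract_def by (rule poly_subst_ring_map)

lemma retract_closed: "retract m n p \<in> carrier (mat_ring m n)"
  unfolding retract_def
  by (rule poly_subst_closed) (auto intro: var_poly_closed mat_ring_zero_closed)

lemma carrier_keys:
  assumes "p \<in> carrier (mat_ring m n)" "t \<in> keys p" "(i, j) \<in> keys t"
  shows "i \<in> {1..m}" "j \<in> {1..n}"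
proof -
  have "t \<in> monomials m n" using assms(1,2) by (auto simp: mat_ring_def)
  then have "(i, j) \<in> {1..m} \<times> {1..n}" using assms(3) unfolding monomials_def by blast
  then show "i \<in> {1..m}" "j \<in> {1..n}" by auto
qed

lemma ring_map_eq_on_carrier:
  assumes F: "ring_map F" and G: "ring_map G" and "\<And>a. F (const_poly a) = G (const_poly a)"
    and "\<And>i j. i \<in> {1..m} \<Longrightarrow> j \<in> {1..n} \<Longrightarrow> F (var_poly i j) = G (var_poly i j)"
    and p: "p \<in> carrier (mat_ring m n)"
  shows "F p = G p"
proof -
  have "F p = poly_eval (\<lambda>a. G (const_poly a)) (\<lambda>(i, j). F (var_poly i j)) p"
    by (subst ring_map_eq_poly_eval[OF F]) (simp only: assms(3))
  also have "\<dots> = poly_eval (\<lambda>a. G (const_poly a)) (\<lambda>(i, j). G (var_poly i j)) p"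
    by (rule poly_eval_cong) (use carrier_keys[OF p] assms(4) in auto)
  also have "\<dots> = G p" by (rule ring_map_eq_poly_eval[OF G, symmetric])
  finally show ?thesis .
qed

lemma retract_id: "p \<in> carrier (mat_ring m n) \<Longrightarrow> retract m n p = p"
  by (rule ring_map_eq_on_carrier[OF retract_ring_map ring_map_id]) (auto simp: retract_def)

text \<open>For the inclusion that is not formal, the variables outside the matrix are set to zero
  in a combination of generators. This fixes the generators and moves the coefficients into the ring
  of the matrix.\<close>

lemma genideal_eq:
  fixes G :: "'k::field polynomial set"
  assumes G: "G \<subseteq> carrier (mat_ring m n)"
  shows "Idl\<^bsub>mat_ring m n\<^esub> G = gen_ideal G \<inter> carrier (mat_ring m n)"
proof
  interpret R: cring "mat_ring m n :: 'k polynomial ring" by (rule mat_ring_cring)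
  show "Idl\<^bsub>mat_ring m n\<^esub> G \<subseteq> gen_ideal G \<inter> carrier (mat_ring m n)"
  proof (rule R.genideal_minimal)
    show "ideal (gen_ideal G \<inter> carrier (mat_ring m n)) (mat_ring m n)"
      by (rule mat_ring_idealI)
        (auto intro: poly_module.span_zero poly_module.span_add gen_ideal_mult
          mat_ring_zero_closed mat_ring_add_closed mat_ring_mult_closed)
    show "G \<subseteq> gen_ideal G \<inter> carrier (mat_ring m n)"
      using G poly_module.span_superset[of G] by auto
  qed
  note Idl = mat_ring_idealD[OF R.genideal_ideal[OF G]]
  have "retract m n x \<in> Idl\<^bsub>mat_ring m n\<^esub> G" if "x \<in> gen_ideal G" for x
    using that
  proof (induction rule: poly_module.span_induct_alt)
    case base
    then show ?case using Idl(2) by (simp add: ring_mapD[OF retract_ring_map])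
  next
    case (step c x y)
    have "retract m n x = x" using step G by (intro retract_id) auto
    moreover have "x \<in> Idl\<^bsub>mat_ring m n\<^esub> G" using step R.genideal_self[OF G] by blast
    ultimately have "retract m n c * retract m n x \<in> Idl\<^bsub>mat_ring m n\<^esub> G"
      using Idl(4)[OF retract_closed] by (simp only:)
    from Idl(3)[OF this step.IH] show ?case by (simp only: ring_mapD(2,3)[OF retract_ring_map])
  qed
  then show "gen_ideal G \<inter> carrier (mat_ring m n) \<subseteq> Idl\<^bsub>mat_ring m n\<^esub> G"
    using retract_id by fastforce
qed


section \<open>The action of the linear groups\<close>

lemma gl_action_ring_map: "ring_map (gl_action m g)"
  unfolding gl_action_def by (rule poly_subst_ring_map)

lemma gl_action_const [simp]: "gl_action m g (const_poly c) = const_poly c"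
  by (simp add: gl_action_def)

lemma gl_action_var:
  "gl_action m g (var_poly i j) = (\<Sum>k\<in>{1..m}. const_poly (g j $$ (k - 1, i - 1)) * var_poly k j)"
  by (simp add: gl_action_def)

lemma gl_action_closed:
  assumes "p \<in> carrier (mat_ring m n)"
  shows "gl_action m g p \<in> carrier (mat_ring m n)"
  unfolding gl_action_def
proof (rule poly_subst_closed)
  fix t i j assume "t \<in> keys p" "(i, j) \<in> keys t"
  from carrier_keys[OF assms this]
  show "(\<Sum>k\<in>{1..m}. const_poly (g j $$ (k - 1, i - 1)) * var_poly k j) \<in> carrier (mat_ring m n)"
    by (intro mat_ring_sum_closed mat_ring_mult_closed const_poly_closed var_poly_closed)
qed

lemma homog_gl_action: "homog a p \<Longrightarrow> homog a (gl_action m g p)"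
  unfolding gl_action_def
  by (erule homog_poly_subst[rotated]) (intro homog_sum homog_const_mult homog_var)

lemma gl_action_inverse:
  assumes gh: "\<And>j. j \<in> {1..n} \<Longrightarrow> g j \<in> carrier_mat m m \<and> h j \<in> carrier_mat m m \<and> g j * h j = 1\<^sub>m m"
    and p: "p \<in> carrier (mat_ring m n)"
  shows "gl_action m g (gl_action m h p) = p"
proof (rule ring_map_eq_on_carrier[OF ring_map_comp[OF gl_action_ring_map gl_action_ring_map]
      ring_map_id _ _ p])
  fix i j assume i: "i \<in> {1..m}" and j: "j \<in> {1..n}"
  have "gl_action m g (gl_action m h (var_poly i j)) =
      (\<Sum>k\<in>{1..m}. \<Sum>l\<in>{1..m}. const_poly (g j $$ (l - 1, k - 1) * h j $$ (k - 1, i - 1)) * var_poly l j)"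
    by (simp add: gl_action_var ring_map_sum[OF gl_action_ring_map] ring_mapD[OF gl_action_ring_map]
        ring_mapD(3)[OF const_poly_ring_map] sum_distrib_left mult_ac)
  also have "\<dots> = (\<Sum>l\<in>{1..m}. const_poly (\<Sum>k\<in>{1..m}. g j $$ (l - 1, k - 1) * h j $$ (k - 1, i - 1)) * var_poly l j)"
    by (subst sum.swap) (simp add: ring_map_sum[OF const_poly_ring_map] sum_distrib_right)
  also have "\<dots> = (\<Sum>l\<in>{1..m}. if l = i then var_poly l j else 0)"
  proof (rule sum.cong[OF refl])
    fix l assume l: "l \<in> {1..m}"
    have "(\<Sum>k\<in>{1..m}. g j $$ (l - 1, k - 1) * h j $$ (k - 1, i - 1)) =
        (\<Sum>k = 0..<m. g j $$ (l - 1, k) * h j $$ (k, i - 1))"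
      by (rule sum.reindex_bij_witness[of _ Suc "\<lambda>k. k - 1"]) auto
    also have "\<dots> = (g j * h j) $$ (l - 1, i - 1)"
    proof -
      have "g j \<in> carrier_mat m m" "h j \<in> carrier_mat m m" using gh[OF j] by auto
      then show ?thesis using l i by (auto simp: scalar_prod_def)
    qed
    also have "\<dots> = (if l = i then 1 else 0)" using gh[OF j] l i by auto
    finally show "const_poly (\<Sum>k\<in>{1..m}. g j $$ (l - 1, k - 1) * h j $$ (k - 1, i - 1)) * var_poly l j =
        (if l = i then var_poly l j else 0)" by simp
  qed
  also have "\<dots> = var_poly i j" using i by simp
  finally show "gl_action m g (gl_action m h (var_poly i j)) = var_poly i j" .
qed simp

text \<open>Back substitution from the last row upwards: below the diagonal, row \<open>i\<close> of
  \<open>A * B\<close> reduces to the diagonal entry of \<open>A\<close> times the entry of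
  \<open>B\<close>.\<close>

lemma upper_triangular_right_inverse:
  fixes A B :: "'a::field mat"
  assumes A: "A \<in> carrier_mat m m" and B: "B \<in> carrier_mat m m" and AB: "A * B = 1\<^sub>m m"
    and U: "upper_triangular A"
  shows "upper_triangular B"
proof -
  have "det A * det B = 1" using det_mult[OF A B] AB by simp
  then have "det A \<noteq> 0" by auto
  then have diag: "A $$ (i, i) \<noteq> 0" if "i < m" for i
    using upper_triangular_imp_det_eq_0_iff[OF A U] that A by (auto simp: diag_mat_def)
  have "B $$ (i, j) = 0" if "j < i" "i < m" for i j
    using that
  proof (induction "m - i" arbitrary: i rule: less_induct)
    case less
    have "0 = (A * B) $$ (i, j)" using less.prems AB by simp
    also have "\<dots> = (\<Sum>k = 0..<m. A $$ (i, k) * B $$ (k, j))"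
      using A B less.prems by (auto simp: scalar_prod_def)
    also have "\<dots> = A $$ (i, i) * B $$ (i, j) + (\<Sum>k\<in>{0..<m} - {i}. A $$ (i, k) * B $$ (k, j))"
      using less.prems by (intro sum.remove) auto
    also have "(\<Sum>k\<in>{0..<m} - {i}. A $$ (i, k) * B $$ (k, j)) = 0"
    proof (rule sum.neutral, rule ballI)
      fix k assume k: "k \<in> {0..<m} - {i}"
      show "A $$ (i, k) * B $$ (k, j) = 0"
      proof (cases "k < i")
        case True
        then show ?thesis using U A less.prems by (auto simp: upper_triangular_def)
      next
        case False
        then have "B $$ (k, j) = 0" using k less.prems by (intro less.hyps) auto
        then show ?thesis by simp
      qed
    qed
    finally show ?case using diag[of i] less.prems by simp
  qed
  then show ?thesis using B by (auto simp: upper_triangular_def)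
qed


section \<open>The monomial ideal of the nonstandard monomials\<close>

definition nonstd :: "nat \<Rightarrow> nat \<Rightarrow> nat set list \<Rightarrow> monomial set" where
  "nonstd s n Bs = {t \<in> monomials s n. \<not> std s Bs (\<lambda>_. 0) (keys t)}"

definition nonstd_ideal :: "nat \<Rightarrow> nat \<Rightarrow> nat set list \<Rightarrow> 'k::field polynomial set" where
  "nonstd_ideal s n Bs = Idl\<^bsub>mat_ring s n\<^esub> (mono_poly ` nonstd s n Bs)"

lemma nonstd_mono:
  assumes "forest_blocks Bs" "t \<in> nonstd s n Bs" "u \<in> monomials s n"
    and "dominated (keys t) (keys u)"
  shows "u \<in> nonstd s n Bs"
  using assms std_dominated[OF assms(1) _ assms(4), of s "\<lambda>_. 0" "\<lambda>_. 0"]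
  by (force simp: nonstd_def monomials_def)

text \<open>A multiple of a nonstandard monomial has a larger support and is again nonstandard by
  \<open>nonstd_mono\<close>; so membership can be read off from the support of a
  polynomial.\<close>

lemma nonstd_ideal_eq:
  assumes blocks: "forest_blocks Bs"
  shows "(nonstd_ideal s n Bs :: 'k::field polynomial set) =
    {p \<in> carrier (mat_ring s n). keys p \<subseteq> nonstd s n Bs}" (is "_ = ?J")
proof -
  have sub: "mono_poly ` nonstd s n Bs \<subseteq> (carrier (mat_ring s n) :: 'k polynomial set)"
    by (auto simp: nonstd_def intro: mono_poly_closed)
  have "keys x \<inter> monomials s n \<subseteq> nonstd s n Bs"
    if "x \<in> gen_ideal (mono_poly ` nonstd s n Bs)" for x :: "'k polynomial"
    using that
  proof (induction rule: poly_module.span_induct_alt)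
    case base
    then show ?case by simp
  next
    case (step c x y)
    then obtain t where t: "t \<in> nonstd s n Bs" "x = mono_poly t" by blast
    have "u \<in> nonstd s n Bs" if "u \<in> keys (c * x)" "u \<in> monomials s n" for u
    proof -
      have "u \<in> keys (mono_poly t * c)" using that(1) t(2) by (simp add: mult.commute)
      then obtain w where w: "u = t + w" using keys_mono_mult[of t c] by blast
      have "keys t \<subseteq> keys u" unfolding w by (auto simp: in_keys_iff lookup_add)
      then show ?thesis
        by (intro nonstd_mono[OF blocks t(1) that(2)]) (auto simp: dominated_def)
    qed
    then show ?case using step Poly_Mapping.keys_add[of "c * x" y] by blast
  qed
  moreover have "p \<in> gen_ideal (mono_poly ` nonstd s n Bs)"
    if "keys p \<subseteq> nonstd s n Bs" for p :: "'k polynomial"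
  proof -
    have "(\<Sum>t\<in>keys p. const_poly (lookup p t) * mono_poly t)
        \<in> gen_ideal (mono_poly ` nonstd s n Bs)"
      using that by (intro poly_module.span_sum gen_ideal_mult poly_module.span_base) blast
    then show ?thesis using sum_single[of p] by (simp add: single_eq_const_mono)
  qed
  ultimately show ?thesis
    unfolding nonstd_ideal_def genideal_eq[OF sub] by (auto simp: mat_ring_def)
qed

lemma monomial_ideal_nonstd: "monomial_ideal s n (nonstd_ideal s n Bs)"
  unfolding monomial_ideal_def nonstd_ideal_def by (intro exI[of _ "nonstd s n Bs"]) (auto simp: nonstd_def)

lemma ideal_nonstd: "ideal (nonstd_ideal s n Bs :: 'k::field polynomial set) (mat_ring s n)"
proof -
  interpret R: cring "mat_ring s n :: 'k polynomial ring" by (rule mat_ring_cring)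
  show ?thesis unfolding nonstd_ideal_def
    by (rule R.genideal_ideal) (auto simp: nonstd_def intro: mono_poly_closed)
qed

text \<open>
  If \<open>u\<close> is a standard monomial of \<open>p\<close>, then killing the variables outside of \<open>u\<close> kills all
  nonstandard monomials, but not \<open>p\<close>; and so it does not kill the powers of \<open>p\<close>.
\<close>

lemma radical_nonstd:
  assumes blocks: "forest_blocks Bs"
  shows "radical_ideal s n (nonstd_ideal s n Bs :: 'k::field polynomial set)"
  unfolding radical_ideal_def
proof (intro conjI ballI allI impI ideal_nonstd)
  fix p :: "'k polynomial" and e
  assume p: "p \<in> carrier (mat_ring s n)" and pe: "p ^ e \<in> nonstd_ideal s n Bs"
  show "p \<in> nonstd_ideal s n Bs"
  proof (rule ccontr)
    assume "p \<notin> nonstd_ideal s n Bs"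
    then obtain u where u: "u \<in> keys p" "u \<notin> nonstd s n Bs"
      using p by (auto simp: nonstd_ideal_eq[OF blocks])
    have uM: "u \<in> monomials s n" using p u(1) by (auto simp: mat_ring_def)
    let ?X = "keys u"
    let ?T = "{t \<in> keys p. keys t \<subseteq> ?X}"
    let ?f = "\<Sum>t\<in>?T. single t (lookup p t)"
    have lf: "lookup ?f t = (if t \<in> ?T then lookup p t else 0)" for t
      by (auto simp: lookup_sum lookup_single when_def)
    have kf: "keys ?f = ?T"
    proof (rule Set.set_eqI)
      fix t
      have "t \<in> keys ?f \<longleftrightarrow> (if t \<in> ?T then lookup p t else 0) \<noteq> 0"
        unfolding in_keys_iff[of t ?f] lf ..
      then show "t \<in> keys ?f \<longleftrightarrow> t \<in> ?T" by (auto simp: in_keys_iff[of t p])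
    qed
    have inj: "t = t'" if "t \<in> ?T" "t' \<in> ?T"
      "\<And>x. x \<in> ?X \<Longrightarrow> lookup t x = lookup t' x" for t t'
    proof (rule poly_mapping_eqI)
      fix x show "lookup t x = lookup t' x"
      proof (cases "x \<in> ?X")
        case False
        then have "x \<notin> keys t" "x \<notin> keys t'" using that(1,2) by auto
        then show ?thesis by (simp add: in_keys_iff)
      qed (rule that(3))
    qed
    have "\<exists>w t0. (\<forall>x. w x \<ge> (1::nat)) \<and> t0 \<in> ?T \<and>
        (\<forall>t\<in>?T - {t0}. (\<Sum>x\<in>?X. w x * lookup t0 x) < (\<Sum>x\<in>?X. w x * lookup t x))"
      by (rule unique_minimal_weight) (simp, simp, use u(1) in blast, rule inj)
    then obtain w t0 where t0: "t0 \<in> ?T" and min: "\<And>t. t \<in> ?T - {t0} \<Longrightarrow>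
        (\<Sum>x\<in>?X. w x * lookup t0 x) < (\<Sum>x\<in>?X. w x * lookup t x)"
      by blast
    have wsum: "(\<Sum>x\<in>keys t. w x * lookup t x) = (\<Sum>x\<in>?X. w x * lookup t x)"
      if "t \<in> ?T" for t
      using that by (intro sum.mono_neutral_left) (auto simp: in_keys_iff)
    have rc: "restrict_cols UNIV = (\<lambda>t. t)"
      by (intro ext poly_mapping_eqI) (simp add: lookup_restrict_cols)
    let ?Z = "\<lambda>v. [:0, 1:] ^ w v :: 'k poly"
    let ?Z' = "\<lambda>v. if v \<in> ?X then ?Z v else 0"
    \<comment> \<open>\<open>?f\<close> is the part of \<open>p\<close> in the variables of
      \<open>u\<close>. Powers of one indeterminate, with weights that single out a monomial, map it
      to a nonzero element of an integral domain; with \<open>A = {}\<close> the fibres are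
      scalars.\<close>
    have "poly_eval (\<lambda>c. [:c:]) ?Z ?f \<noteq> 0"
    proof (rule fiber_eval_nonzero[where A = "{}" and w = w and r = "\<lambda>_. 1"])
      show "t0 \<in> restrict_cols (- {}) ` keys ?f" using t0 by (simp add: rc kf)
      fix t assume "t \<in> restrict_cols (- {}) ` keys ?f" "t \<noteq> t0"
      then have t: "t \<in> ?T - {t0}" by (simp add: rc kf)
      then show "(\<Sum>v\<in>keys t0. w v * lookup t0 v) <
          (\<Sum>v\<in>keys t. w v * lookup t v)"
        using min[OF t] wsum[of t] wsum[OF t0] by simp
    next
      have r0: "restrict_cols {} t = 0" for t
        by (intro poly_mapping_eqI) (simp add: lookup_restrict_cols)
      have "{t \<in> keys ?f. restrict_cols (- {}) t = t0} = {t0}" using t0 by (auto simp: rc kf)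
      then have "fiber {} ?f t0 = single 0 (lookup p t0)"
        using t0 by (simp add: fiber_def r0 lf)
      then show "peval (\<lambda>v. poly (?Z v) 0) (fiber {} ?f t0) \<noteq> 0"
        using t0 by (simp add: poly_eval_single ring_map_id in_keys_iff)
    qed auto
    also have "poly_eval (\<lambda>c. [:c:]) ?Z ?f = poly_eval (\<lambda>c. [:c:]) ?Z' ?f"
      by (rule poly_eval_cong) (use kf in auto)
    also have "\<dots> = (\<Sum>t\<in>keys p. [:lookup ?f t:] * monom_eval ?Z' t)"
      by (rule poly_eval_superset[OF pCons_ring_map]) (use kf in auto)
    also have "\<dots> = poly_eval (\<lambda>c. [:c:]) ?Z' p"
      unfolding poly_eval_def
    proof (rule sum.cong[OF refl])
      fix t assume t: "t \<in> keys p"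
      show "[:lookup ?f t:] * monom_eval ?Z' t = [:lookup p t:] * monom_eval ?Z' t"
      proof (cases "t \<in> ?T")
        case False
        then obtain v where v: "v \<in> keys t" "v \<notin> ?X" using t by blast
        then have "monom_eval ?Z' t = 0"
          unfolding monom_eval_def by (intro prod_zero) (auto simp: in_keys_iff power_0_left intro!: bexI[of _ v])
        then show ?thesis by simp
      qed (simp add: lf)
    qed
    finally have nz: "poly_eval (\<lambda>c. [:c:]) ?Z' p \<noteq> 0" .
    have "poly_eval (\<lambda>c. [:c:]) ?Z' x = 0" if x: "x \<in> nonstd_ideal s n Bs" for x
      unfolding poly_eval_def
    proof (rule sum.neutral, rule ballI)
      fix t assume "t \<in> keys x"
      then have t: "t \<in> nonstd s n Bs" using x by (auto simp: nonstd_ideal_eq[OF blocks])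
      have "\<not> keys t \<subseteq> ?X"
        using nonstd_mono[OF blocks t uM] u(2) by (auto simp: dominated_def)
      then obtain v where v: "v \<in> keys t" "v \<notin> ?X" by blast
      then have "monom_eval ?Z' t = 0"
        unfolding monom_eval_def by (intro prod_zero) (auto simp: in_keys_iff power_0_left intro!: bexI[of _ v])
      then show "[:lookup x t:] * monom_eval ?Z' t = 0" by simp
    qed
    then have "poly_eval (\<lambda>c. [:c:]) ?Z' p ^ e = 0"
      using pe by (simp flip: ring_mapD(7)[OF poly_eval_ring_map[OF pCons_ring_map]])
    then show False using nz by simp
  qed
qed

section \<open>Upper triangular substitutions move variables to smaller rows\<close>

definition all_below :: "nat \<Rightarrow> nat \<Rightarrow> (nat \<times> nat) set \<Rightarrow> 'k::field polynomial \<Rightarrow> bool" where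
  "all_below m n S p \<longleftrightarrow> (\<forall>t\<in>keys p. t \<in> monomials m n \<and> dominated S (keys t))"

lemma all_below_mult:
  assumes "all_below m n S p" "all_below m n S' q"
  shows "all_below m n (S \<union> S') (p * q)"
  unfolding all_below_def
proof
  fix t assume "t \<in> keys (p * q)"
  then obtain u w where t: "t = u + w" "u \<in> keys p" "w \<in> keys q"
    using Poly_Mapping.keys_mult[of p q] by blast
  have "keys t = keys u \<union> keys w"
    unfolding t(1) by (auto simp: in_keys_iff lookup_add)
  then show "t \<in> monomials m n \<and> dominated (S \<union> S') (keys t)"
    using assms t by (fastforce simp: all_below_def monomials_def dominated_def)
qed

lemma all_below_power: "all_below m n S p \<Longrightarrow> e > 0 \<Longrightarrow> all_below m n S (p ^ e)"
proof (induction e)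
  case (Suc e)
  then show ?case using all_below_mult[of m n S p S "p ^ e"] by (cases "e = 0") auto
qed simp

text \<open>Upper triangularity sends a variable in row \<open>i\<close> into the span of those in
  rows up to \<open>i\<close> of its column. Every variable of \<open>t\<close> occurs with a
  positive exponent, so each monomial of the image contains such a replacement for it.\<close>

lemma all_below_gl_action:
  assumes g: "\<And>j. j \<in> {1..n} \<Longrightarrow> g j \<in> carrier_mat m m \<and> upper_triangular (g j)"
    and t: "t \<in> monomials m n"
  shows "all_below m n (keys t) (gl_action m g (mono_poly t))"
proof -
  let ?L = "\<lambda>(i, j). \<Sum>k\<in>{1..m}. const_poly (g j $$ (k - 1, i - 1)) * var_poly k j"
  have L: "all_below m n {(i, j)} (?L (i, j))" if ij: "(i, j) \<in> keys t" for i j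
  proof -
    have i: "i \<in> {1..m}" "j \<in> {1..n}" using t ij by (auto simp: monomials_def)
    have "keys (const_poly (g j $$ (k - 1, i - 1)) * var_poly k j) \<subseteq>
        (\<lambda>k. single (k, j) 1) ` {1..i}" if k: "k \<in> {1..m}" for k
    proof (cases "k \<le> i")
      case True
      then show ?thesis
        using keys_const_mult[of "g j $$ (k - 1, i - 1)" "var_poly k j"] k
        by (auto simp: var_poly_def mono_poly_def)
    next
      case False
      then have "g j $$ (k - 1, i - 1) = 0"
        using g[OF i(2)] i k by (auto simp: upper_triangular_def)
      then show ?thesis by simp
    qed
    then have "keys (?L (i, j)) \<subseteq> (\<lambda>k. single (k, j) 1) ` {1..i}"
      unfolding prod.case by (rule keys_sum_subset)
    then show ?thesis
      using i unfolding all_below_def by (fastforce simp: monomials_def dominated_def)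
  qed
  have "all_below m n F (\<Prod>v\<in>F. ?L v ^ lookup t v)" if "F \<subseteq> keys t" for F
    using finite_subset[OF that finite_keys] that
  proof (induction F rule: finite_induct)
    case empty
    then show ?case by (auto simp: all_below_def monomials_def dominated_def)
  next
    case (insert v F)
    obtain i j where v: "v = (i, j)" by (cases v)
    have "all_below m n {v} (?L v ^ lookup t v)"
      using L[of i j] insert.prems v by (intro all_below_power) (auto simp: in_keys_iff)
    from all_below_mult[OF this insert.IH] show ?case using insert by simp
  qed
  from this[OF subset_refl] show ?thesis
    by (simp add: gl_action_def poly_subst_eq_poly_eval const_poly_ring_map monom_eval_def)
qed

lemma gl_action_nonstd:
  fixes p :: "'k::field polynomial"
  assumes blocks: "forest_blocks Bs"
    and g: "\<And>j. j \<in> {1..n} \<Longrightarrow> g j \<in> carrier_mat s s \<and> upper_triangular (g j)"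
    and p: "p \<in> nonstd_ideal s n Bs"
  shows "gl_action s g p \<in> nonstd_ideal s n Bs"
proof -
  have pc: "p \<in> carrier (mat_ring s n)" and pk: "keys p \<subseteq> nonstd s n Bs"
    using p by (auto simp: nonstd_ideal_eq[OF blocks])
  have "p = (\<Sum>t\<in>keys p. const_poly (lookup p t) * mono_poly t)"
    using sum_single[of p] by (simp add: single_eq_const_mono)
  then have "gl_action s g p =
      (\<Sum>t\<in>keys p. const_poly (lookup p t) * gl_action s g (mono_poly t))"
    by (metis (no_types, lifting) gl_action_const gl_action_ring_map ring_mapD(3) ring_map_sum sum.cong)
  moreover have "keys (gl_action s g (mono_poly t) :: 'k polynomial) \<subseteq> nonstd s n Bs"
    if "t \<in> keys p" for t
  proof
    fix u assume u: "u \<in> keys (gl_action s g (mono_poly t) :: 'k polynomial)"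
    have t: "t \<in> nonstd s n Bs" "t \<in> monomials s n" using that pk by (auto simp: nonstd_def)
    from all_below_gl_action[OF g t(2)] u
    have "u \<in> monomials s n" "dominated (keys t) (keys u)"
      by (auto simp: all_below_def)
    then show "u \<in> nonstd s n Bs" by (rule nonstd_mono[OF blocks t(1)])
  qed
  ultimately have "keys (gl_action s g p) \<subseteq> nonstd s n Bs"
    using keys_const_mult by (simp only:) (rule keys_sum_subset, blast)
  then show ?thesis using gl_action_closed[OF pc] by (simp add: nonstd_ideal_eq[OF blocks])
qed

text \<open>Stability under the inverse matrices, which are upper triangular as well, turns the
  inclusion into an equality.\<close>

lemma borel_fixed_nonstd:
  assumes blocks: "forest_blocks Bs"
  shows "borel_fixed s n (nonstd_ideal s n Bs :: 'k::field polynomial set)"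
  unfolding borel_fixed_def
proof
  fix g :: "nat \<Rightarrow> 'k mat" assume g: "g \<in> borel_group s n"
  have gj: "g j \<in> carrier_mat s s \<and> upper_triangular (g j)" if "j \<in> {1..n}" for j
    using g that by (simp add: borel_group_def)
  have "\<exists>B. B \<in> carrier_mat s s \<and> g j * B = 1\<^sub>m s" if j: "j \<in> {1..n}" for j
  proof -
    have "invertible_mat (g j)" using g j by (simp add: borel_group_def)
    then obtain B where B: "inverts_mat (g j) B" "inverts_mat B (g j)"
      unfolding invertible_mat_def by blast
    have 1: "g j * B = 1\<^sub>m s" "B * g j = 1\<^sub>m (dim_row B)" using B gj[OF j] by (auto simp: inverts_mat_def)
    have "dim_col B = s" using arg_cong[OF 1(1), of dim_col] by simp
    moreover have "dim_row B = s" using arg_cong[OF 1(2), of dim_col] gj[OF j] by auto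
    ultimately show ?thesis using 1(1) by blast
  qed
  then obtain h where h: "\<And>j. j \<in> {1..n} \<Longrightarrow> h j \<in> carrier_mat s s \<and> g j * h j = 1\<^sub>m s" by metis
  have hj: "h j \<in> carrier_mat s s \<and> upper_triangular (h j)" if "j \<in> {1..n}" for j
    using upper_triangular_right_inverse[of "g j" s "h j"] gj[OF that] h[OF that] by blast
  show "gl_action s g ` nonstd_ideal s n Bs = nonstd_ideal s n Bs"
  proof
    show "gl_action s g ` nonstd_ideal s n Bs \<subseteq> nonstd_ideal s n Bs"
      using gl_action_nonstd[where g = g and n = n, OF blocks gj] by blast
    show "nonstd_ideal s n Bs \<subseteq> gl_action s g ` nonstd_ideal s n Bs"
    proof
      fix p :: "'k polynomial" assume p: "p \<in> nonstd_ideal s n Bs"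
      then have "gl_action s g (gl_action s h p) = p"
        using gj h by (intro gl_action_inverse[of n]) (auto simp: nonstd_ideal_eq[OF blocks])
      then show "p \<in> gl_action s g ` nonstd_ideal s n Bs"
        using gl_action_nonstd[where g = h and n = n, OF blocks hj p] by (metis imageI)
    qed
  qed
qed

section \<open>Hilbert functions\<close>

lemma span_mono_poly_iff: "p \<in> poly_vs.span (mono_poly ` M) \<longleftrightarrow> keys p \<subseteq> M"
proof
  assume "p \<in> poly_vs.span (mono_poly ` M)"
  then show "keys p \<subseteq> M"
  proof (induction rule: poly_vs.span_induct_alt)
    case base
    then show ?case by simp
  next
    case (step c x y)
    then obtain t where "t \<in> M" "x = mono_poly t" by blast
    then have "keys (poly_scale c x) \<subseteq> M"
      using keys_const_mult[of c x] by (auto simp: poly_scale_def mono_poly_def)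
    then show ?case using step Poly_Mapping.keys_add[of "poly_scale c x" y] by blast
  qed
next
  assume "keys p \<subseteq> M"
  then show "p \<in> poly_vs.span (mono_poly ` M)"
    by (rule poly_span_mono_poly) (intro poly_vs.span_base imageI)
qed

text \<open>The family \<open>e\<close> on \<open>D\<close> is a basis of a complement of
  \<open>X\<close> in the span of the monomials in \<open>M\<close>. Applied with the same
  \<open>D\<close> and \<open>M\<close> to the nonstandard ideal and to the ideal of minors, it
  makes their Hilbert functions agree without computing either.\<close>

lemma dim_complement:
  fixes X :: "'k::field polynomial set" and e :: "monomial \<Rightarrow> 'k polynomial"
  assumes finM: "finite M" and finD: "finite D" and X: "poly_vs.subspace X"
    and XM: "X \<subseteq> poly_vs.span (mono_poly ` M)"
    and eM: "\<And>t. t \<in> D \<Longrightarrow> e t \<in> poly_vs.span (mono_poly ` M)"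
    and ind: "\<And>c t. (\<Sum>t\<in>D. poly_scale (c t) (e t)) \<in> X \<Longrightarrow> t \<in> D \<Longrightarrow> c t = 0"
    and spn: "\<And>p. p \<in> poly_vs.span (mono_poly ` M) \<Longrightarrow> \<exists>c. p - (\<Sum>t\<in>D. poly_scale (c t) (e t)) \<in> X"
  shows "poly_vs.dim X + card D = card M"
proof -
  obtain B where B: "B \<subseteq> X" "poly_vs.independent B" "X \<subseteq> poly_vs.span B" "card B = poly_vs.dim X"
    using poly_vs.basis_exists by blast
  have cM: "card (mono_poly ` M :: 'k polynomial set) = card M"
    by (rule card_image[OF inj_on_subset[OF inj_mono_poly]]) simp
  have iM: "poly_vs.independent (mono_poly ` M :: 'k polynomial set)" by (rule independent_mono_poly[OF finM])
  have finB: "finite B"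
    using poly_vs.independent_span_bound[of "mono_poly ` M" B] finM B XM by auto
  have inj: "inj_on e D"
  proof (rule inj_onI, rule ccontr)
    fix t u assume tu: "t \<in> D" "u \<in> D" "e t = e u" "t \<noteq> u"
    let ?c = "\<lambda>x. if x = t then 1 else if x = u then -1 else 0 :: 'k"
    have "(\<Sum>x\<in>D. poly_scale (?c x) (e x)) = (\<Sum>x\<in>{t, u}. poly_scale (?c x) (e x))"
      using finD tu by (intro sum.mono_neutral_right) auto
    also have "\<dots> = 0" using tu by simp
    finally have "(\<Sum>x\<in>D. poly_scale (?c x) (e x)) \<in> X" using poly_vs.subspace_0[OF X] by simp
    from ind[OF this tu(1)] show False by simp
  qed
  have disj: "B \<inter> e ` D = {}"
  proof (rule ccontr)
    assume "B \<inter> e ` D \<noteq> {}"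
    then obtain u where u: "u \<in> D" "e u \<in> X" using B(1) by blast
    let ?c = "\<lambda>x. if x = u then 1 else 0 :: 'k"
    have "(\<Sum>x\<in>D. poly_scale (?c x) (e x)) = (\<Sum>x\<in>{u}. poly_scale (?c x) (e x))"
      using finD u by (intro sum.mono_neutral_right) auto
    then have "(\<Sum>x\<in>D. poly_scale (?c x) (e x)) \<in> X" using u by simp
    from ind[OF this u(1)] show False by simp
  qed
  have iBe: "poly_vs.independent (B \<union> e ` D)"
  proof (rule poly_vs.independent_if_scalars_zero)
    fix f :: "'k polynomial \<Rightarrow> 'k" and x
    assume z: "(\<Sum>x\<in>B \<union> e ` D. poly_scale (f x) x) = 0" and x: "x \<in> B \<union> e ` D"
    have split: "(\<Sum>x\<in>B. poly_scale (f x) x) + (\<Sum>t\<in>D. poly_scale (f (e t)) (e t)) = 0"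
      using z finB finD disj inj by (simp add: sum.union_disjoint sum.reindex)
    have BX: "(\<Sum>x\<in>B. poly_scale (f x) x) \<in> X"
      using B(1) by (intro poly_vs.subspace_sum[OF X] poly_vs.subspace_scale[OF X]) auto
    have "(\<Sum>t\<in>D. poly_scale (f (e t)) (e t)) = - (\<Sum>x\<in>B. poly_scale (f x) x)"
      using split by (simp only: eq_neg_iff_add_eq_0 add.commute)
    then have "(\<Sum>t\<in>D. poly_scale (f (e t)) (e t)) \<in> X" using poly_vs.subspace_neg[OF X BX] by simp
    then have fe: "f (e t) = 0" if "t \<in> D" for t by (rule ind[OF _ that])
    then have "(\<Sum>x\<in>B. poly_scale (f x) x) = 0" using split by simp
    then have fB: "f b = 0" if "b \<in> B" for b
      using poly_vs.independentD[OF B(2) finB subset_refl] that by blast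
    show "f x = 0" using x fe fB by blast
  qed (use finB finD in simp)
  have "B \<union> e ` D \<subseteq> poly_vs.span (mono_poly ` M)" using B(1) XM eM by blast
  then have le: "card (B \<union> e ` D) \<le> card M"
    using poly_vs.independent_span_bound[OF _ iBe, of "mono_poly ` M"] finM cM by simp
  have "poly_vs.span (mono_poly ` M) \<subseteq> poly_vs.span (B \<union> e ` D)"
  proof
    fix p :: "'k polynomial" assume "p \<in> poly_vs.span (mono_poly ` M)"
    then obtain c where c: "p - (\<Sum>t\<in>D. poly_scale (c t) (e t)) \<in> X" using spn by blast
    then have "p - (\<Sum>t\<in>D. poly_scale (c t) (e t)) \<in> poly_vs.span (B \<union> e ` D)"
      using B(3) poly_vs.span_mono[of B "B \<union> e ` D"] by blast
    moreover have "(\<Sum>t\<in>D. poly_scale (c t) (e t)) \<in> poly_vs.span (B \<union> e ` D)"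
      by (intro poly_vs.span_sum poly_vs.span_scale poly_vs.span_base) blast
    ultimately have "p - (\<Sum>t\<in>D. poly_scale (c t) (e t)) + (\<Sum>t\<in>D. poly_scale (c t) (e t))
        \<in> poly_vs.span (B \<union> e ` D)" by (rule poly_vs.span_add)
    then show "p \<in> poly_vs.span (B \<union> e ` D)" by simp
  qed
  then have "mono_poly ` M \<subseteq> poly_vs.span (B \<union> e ` D)" using poly_vs.span_superset by blast
  then have ge: "card M \<le> card (B \<union> e ` D)"
    using poly_vs.independent_span_bound[OF _ iM, of "B \<union> e ` D"] finB finD cM by simp
  have "card (B \<union> e ` D) = card B + card D"
    using card_Un_disjoint[OF finB finite_imageI[OF finD] disj] card_image[OF inj] by simp
  then show ?thesis using le ge B(4) by simp
qed

definition degree_monomials :: "nat \<Rightarrow> nat \<Rightarrow> (nat \<Rightarrow>\<^sub>0 nat) \<Rightarrow> monomial set" where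
  "degree_monomials m n a = {t \<in> monomials m n. mdeg t = a}"

lemma finite_degree_monomials: "finite (degree_monomials m n a)"
  by (rule finite_subset[OF _ finite_monomials_mdeg[of m a]])
    (fastforce simp: degree_monomials_def monomials_def)

lemma keys_degree_monomials:
  "keys p \<subseteq> degree_monomials m n a \<longleftrightarrow> p \<in> carrier (mat_ring m n) \<and> homog a p"
  by (auto simp: degree_monomials_def mat_ring_def homog_def)

lemma graded_piece_eq: "graded_piece I a = {p \<in> I. homog a p}"
  by (simp add: graded_piece_def homog_def)

lemma subspace_graded_piece:
  assumes "ideal I (mat_ring m n)"
  shows "poly_vs.subspace (graded_piece I a)"
  unfolding graded_piece_eq
  using mat_ring_idealD[OF assms]
  by (auto simp: poly_vs.subspace_def poly_scale_def const_poly_closed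
      intro!: homog_add homog_const_mult)

lemma graded_piece_span:
  assumes "ideal I (mat_ring m n)"
  shows "graded_piece I a \<subseteq> poly_vs.span (mono_poly ` degree_monomials m n a)"
  using mat_ring_idealD(1)[OF assms]
  by (auto simp: graded_piece_eq span_mono_poly_iff keys_degree_monomials)

lemma sum_const_mono:
  assumes "finite D" "keys p \<subseteq> D"
  shows "(\<Sum>t\<in>D. const_poly (lookup p t) * mono_poly t) = p"
proof -
  have "(\<Sum>t\<in>D. const_poly (lookup p t) * mono_poly t) =
      (\<Sum>t\<in>keys p. const_poly (lookup p t) * mono_poly t)"
    using assms by (intro sum.mono_neutral_right) (auto simp: in_keys_iff)
  then show ?thesis using sum_single[of p] by (simp add: single_eq_const_mono)
qed

lemma lookup_sum_const_mono:
  "finite D \<Longrightarrow> lookup (\<Sum>t\<in>D. const_poly (c t) * mono_poly t) u = (if u \<in> D then c u else 0)"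
  by (simp add: lookup_sum mono_poly_def lookup_single when_def if_distrib cong: if_cong)

lemma std_set_degree_monomials:
  "\<Union>(set Bs) = {1..n} \<Longrightarrow> std_set s Bs (\<lambda>_. 0) a \<subseteq> degree_monomials s n a"
  using std_cells[of s Bs "\<lambda>_. 0"] by (fastforce simp: std_set_def degree_monomials_def monomials_def cells_def)

lemma dim_graded_piece_nonstd:
  assumes blocks: "forest_blocks Bs" and V: "\<Union>(set Bs) = {1..n}"
  shows "poly_vs.dim (graded_piece (nonstd_ideal s n Bs :: 'k::field polynomial set) a) +
    card (std_set s Bs (\<lambda>_. 0) a) = card (degree_monomials s n a)"
proof (rule dim_complement[where e = mono_poly])
  let ?D = "std_set s Bs (\<lambda>_. 0) a" and ?J = "nonstd_ideal s n Bs :: 'k polynomial set"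
  note J = nonstd_ideal_eq[OF blocks, of s n]
  show "poly_vs.subspace (graded_piece ?J a)" by (rule subspace_graded_piece[OF ideal_nonstd])
  show "graded_piece ?J a \<subseteq> poly_vs.span (mono_poly ` degree_monomials s n a)"
    by (rule graded_piece_span[OF ideal_nonstd])
  show "mono_poly t \<in> poly_vs.span (mono_poly ` degree_monomials s n a)" if "t \<in> ?D" for t
    using that std_set_degree_monomials[OF V] by (intro poly_vs.span_base imageI) blast
  show "c t = 0" if c: "(\<Sum>t\<in>?D. poly_scale (c t) (mono_poly t)) \<in> graded_piece ?J a" and t: "t \<in> ?D"
    for c :: "monomial \<Rightarrow> 'k" and t
  proof (rule ccontr)
    assume "c t \<noteq> 0"
    then have "t \<in> keys (\<Sum>t\<in>?D. const_poly (c t) * mono_poly t)"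
      unfolding in_keys_iff lookup_sum_const_mono[OF finite_std_set] using t by simp
    then have "t \<in> nonstd s n Bs" using c by (auto simp: graded_piece_def J poly_scale_def)
    then show False using t by (simp add: nonstd_def std_set_def)
  qed
  fix p :: "'k polynomial" assume "p \<in> poly_vs.span (mono_poly ` degree_monomials s n a)"
  then have p: "keys p \<subseteq> degree_monomials s n a" by (simp add: span_mono_poly_iff)
  let ?p = "p - (\<Sum>t\<in>?D. const_poly (lookup p t) * mono_poly t)"
  have "keys ?p \<subseteq> degree_monomials s n a - ?D"
  proof
    fix t assume "t \<in> keys ?p"
    then have "lookup p t - (if t \<in> ?D then lookup p t else 0) \<noteq> 0"
      unfolding in_keys_iff lookup_minus lookup_sum_const_mono[OF finite_std_set] .
    then show "t \<in> degree_monomials s n a - ?D" using p by (auto simp: in_keys_iff split: if_splits)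
  qed
  then have "?p \<in> graded_piece ?J a"
    by (auto simp: graded_piece_def J mat_ring_def degree_monomials_def nonstd_def std_set_def)
  then show "\<exists>c. p - (\<Sum>t\<in>?D. poly_scale (c t) (mono_poly t)) \<in> graded_piece ?J a"
    unfolding poly_scale_def by blast
qed (rule finite_degree_monomials finite_std_set)+


section \<open>The ideal of a forest\<close>

lemma rows_eq: "R \<in> [{1..s}]\<^bsup>s\<^esup> \<longleftrightarrow> R = {1..s}"
  using card_subset_eq[of "{1..s}" R] by (auto simp: nsets_def)

lemma generic_minor_eq_vdet:
  assumes "finite C" "card C = s"
  shows "generic_minor s {1..s} C = vdet (map (\<lambda>j a. var_poly (Suc a) j) (sorted_list_of_set C))"
proof -
  have "{1..s} = {1..<Suc s}" by auto
  then have r: "sorted_list_of_set {1..s} ! a = Suc a" if "a < s" for a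
    using that by (simp del: upt_Suc)
  have len: "length (sorted_list_of_set C) = s" using assms by simp
  have "generic_minor s {1..s} C =
      det (transpose_mat (mat s s (\<lambda>(a, b). var_poly (sorted_list_of_set {1..s} ! a) (sorted_list_of_set C ! b))))"
    unfolding generic_minor_def by (rule det_transpose[symmetric, of _ s]) simp
  also have "transpose_mat (mat s s (\<lambda>(a, b). var_poly (sorted_list_of_set {1..s} ! a) (sorted_list_of_set C ! b))) =
      mat s s (\<lambda>(b, a). (map (\<lambda>j a. var_poly (Suc a) j) (sorted_list_of_set C) ! b) a)"
    using len r by (intro eq_matI) (auto simp del: length_sorted_list_of_set)
  finally show ?thesis unfolding vdet_def using len by simp
qed

locale forest_coordinates =
  fixes s n :: nat and Bs :: "nat set list" and E :: "nat set set"
    and q :: "'k::field frame"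
  assumes inf: "infinite (UNIV :: 'k set)" and s: "s \<ge> 1"
    and blocks: "forest_blocks Bs" and V: "\<Union>(set Bs) = {1..n}"
    and E: "E = (\<Union>B\<in>set Bs. [B]\<^bsup>s\<^esup>)"
    and gp: "gen_pos s Bs (\<lambda>_. 0) q"
    and basis: "\<And>j. j \<in> {1..n} \<Longrightarrow> vdet (map (q j) [1..<Suc s]) \<noteq> 0"
begin

text \<open>Acting by \<open>G\<close> substitutes for the generic column \<open>j\<close> the
  combination of the frame vectors \<open>q j i\<close> with the variables \<open>z_ij\<close> as
  coefficients; this is the passage to the new coordinates.\<close>

definition G :: "nat \<Rightarrow> 'k mat" where
  "G j = mat s s (\<lambda>(a, b). q j (Suc a) b)"

definition minors :: "'k polynomial set" where
  "minors = {generic_minor s R C | R C. R \<in> [{1..s}]\<^bsup>s\<^esup> \<and> C \<in> E}"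

abbreviation I :: "'k polynomial set" where
  "I \<equiv> hypergraph_ideal s s n E"

abbreviation I' :: "'k polynomial set" where
  "I' \<equiv> hyp_ideal s Bs (\<lambda>_. 0) q"

lemma det_G: "j \<in> {1..n} \<Longrightarrow> det (G j) \<noteq> 0"
proof -
  assume j: "j \<in> {1..n}"
  have "mat s s (\<lambda>(b, a). (map (q j) [1..<Suc s] ! b) a) = G j"
    by (intro eq_matI) (auto simp: G_def simp del: upt_Suc)
  then show "det (G j) \<noteq> 0" using basis[OF j] by (simp add: vdet_def del: upt_Suc)
qed

definition H :: "nat \<Rightarrow> 'k mat" where
  "H j = (SOME B. B \<in> carrier_mat s s \<and> B * G j = 1\<^sub>m s \<and> G j * B = 1\<^sub>m s)"

lemma H:
  assumes "j \<in> {1..n}"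
  shows "H j \<in> carrier_mat s s" "H j * G j = 1\<^sub>m s" "G j * H j = 1\<^sub>m s"
proof -
  have "G j \<in> Units (ring_mat TYPE('k) s ())"
    by (rule det_non_zero_imp_unit[OF _ det_G[OF assms]]) (simp add: G_def)
  then have "\<exists>B. B \<in> carrier_mat s s \<and> B * G j = 1\<^sub>m s \<and> G j * B = 1\<^sub>m s"
    unfolding Units_def by (auto simp: ring_mat_simps)
  from someI_ex[OF this] show "H j \<in> carrier_mat s s" "H j * G j = 1\<^sub>m s" "G j * H j = 1\<^sub>m s"
    unfolding H_def[symmetric] by auto
qed

lemma G_carrier: "G j \<in> carrier_mat s s"
  by (simp add: G_def)

lemma HG: "p \<in> carrier (mat_ring s n) \<Longrightarrow> gl_action s H (gl_action s G p) = p"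
  by (rule gl_action_inverse) (auto simp: H G_carrier)

lemma GH: "p \<in> carrier (mat_ring s n) \<Longrightarrow> gl_action s G (gl_action s H p) = p"
  by (rule gl_action_inverse) (auto simp: H G_carrier)

lemma edge: "C \<in> E \<Longrightarrow> \<exists>B\<in>set Bs. C \<subseteq> B" "C \<in> E \<Longrightarrow> finite C" "C \<in> E \<Longrightarrow> card C = s" "C \<in> E \<Longrightarrow> C \<subseteq> {1..n}"
  using E V by (auto simp: nsets_def)

lemma G_minor:
  assumes C: "C \<in> E"
  shows "gl_action s G (generic_minor s {1..s} C) = block_minor s (\<lambda>_. 0) q (sorted_list_of_set C)"
proof -
  have col: "gl_action s G (var_poly (Suc a) j) = gcol s (\<lambda>_. 0) q j a" if "a < s" for a j
  proof -
    have "gl_action s G (var_poly (Suc a) j) = (\<Sum>k\<in>{1..s}. const_poly (q j k a) * var_poly k j)"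
      unfolding gl_action_var using that by (intro sum.cong refl) (auto simp: G_def)
    also have "{1..s} = {0<..s}" by auto
    finally show ?thesis by (simp add: gcol_def column_def mult.commute)
  qed
  have len: "length (sorted_list_of_set C) = s" using edge[OF C] by simp
  show ?thesis
    unfolding generic_minor_eq_vdet[OF edge(2,3)[OF C]] ring_map_vdet[OF gl_action_ring_map] block_minor_def
    by (rule vdet_cong) (use len col in auto)
qed

lemma minors_eq: "minors = {generic_minor s {1..s} C | C. C \<in> E}"
  unfolding minors_def rows_eq by blast

lemma minors_closed: "minors \<subseteq> carrier (mat_ring s n)"
  unfolding minors_def
proof clarify
  fix R C assume "R \<in> [{1..s}]\<^bsup>s\<^esup>" "C \<in> E"
  then show "generic_minor s R C \<in> carrier (mat_ring s n)"
    using edge(2-4)[of C] by (intro generic_minor_closed) (auto simp: nsets_def)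
qed

lemma I_eq: "I = gen_ideal minors \<inter> carrier (mat_ring s n)"
  unfolding hypergraph_ideal_def minors_def[symmetric] by (rule genideal_eq[OF minors_closed])

lemma I_ideal: "ideal I (mat_ring s n)"
proof -
  interpret R: cring "mat_ring s n :: 'k polynomial ring" by (rule mat_ring_cring)
  show ?thesis unfolding hypergraph_ideal_def minors_def[symmetric]
    by (rule R.genideal_ideal[OF minors_closed])
qed

lemma G_I: "p \<in> I \<Longrightarrow> gl_action s G p \<in> I'"
proof -
  assume "p \<in> I"
  then have "p \<in> gen_ideal minors" by (simp add: I_eq)
  moreover have "gl_action s G g \<in> I'" if gm: "g \<in> minors" for g
  proof -
    obtain C where C: "C \<in> E" "g = generic_minor s {1..s} C" using gm minors_eq by blast
    obtain B where B: "B \<in> set Bs" "C \<subseteq> B" using edge(1)[OF C(1)] by blast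
    show ?thesis unfolding C(2) G_minor[OF C(1)]
      by (rule block_minor_mem[OF B(1)]) (use edge[OF C(1)] B in auto)
  qed
  ultimately show "gl_action s G p \<in> I'" using gen_ideal_image[OF gl_action_ring_map] by blast
qed

lemma block_minor_cases:
  assumes "B \<in> set Bs" "set js \<subseteq> B" "distinct js" "length js = s"
  obtains C where "C \<in> E" "block_minor s (\<lambda>_. 0) q js = gl_action s G (generic_minor s {1..s} C) \<or>
    block_minor s (\<lambda>_. 0) q js = - gl_action s G (generic_minor s {1..s} C)"
proof (rule that)
  show C: "set js \<in> E" using assms E by (auto simp: nsets_def distinct_card)
  have "mset js = mset (sorted_list_of_set (set js))"
    using assms(3) by (metis distinct_sorted_list_of_set finite_set set_eq_iff_mset_eq_distinct set_sorted_list_of_set)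
  then have "mset (map (gcol s (\<lambda>_. 0) q) js) = mset (map (gcol s (\<lambda>_. 0) q) (sorted_list_of_set (set js)))"
    by (simp only: mset_map)
  from vdet_mset[OF this]
  show "block_minor s (\<lambda>_. 0) q js = gl_action s G (generic_minor s {1..s} (set js)) \<or>
    block_minor s (\<lambda>_. 0) q js = - gl_action s G (generic_minor s {1..s} (set js))"
    unfolding G_minor[OF C] block_minor_def .
qed

text \<open>\<open>I'\<close> is an ideal in all variables and contains variables outside the
  matrix. These are killed by \<open>retract\<close> before returning with \<open>H\<close>, and
  each block minor returns to a minor up to sign.\<close>

lemma I_if_G:
  assumes p: "p \<in> carrier (mat_ring s n)" and Gp: "gl_action s G p \<in> I'"
  shows "p \<in> I"
proof -
  let ?F = "\<lambda>x. gl_action s H (retract s n x)"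
  have F: "ring_map ?F" by (rule ring_map_comp[OF gl_action_ring_map retract_ring_map])
  have "?F x \<in> gen_ideal minors" if "x \<in> hyp_gens s Bs (\<lambda>_. 0) q" for x
  proof -
    from that consider (var) i j where "x = var_poly i j" "j \<in> {1..n}" "(i, j) \<notin> cells s {1..n} (\<lambda>_. 0)"
      | (minor) js B where "x = block_minor s (\<lambda>_. 0) q js" "B \<in> set Bs" "set js \<subseteq> B" "distinct js" "length js = s"
      unfolding hyp_gens_def V by blast
    then show ?thesis
    proof cases
      case var
      then have "retract s n x = 0" by (auto simp: retract_def cells_def)
      then show ?thesis by (simp add: ring_mapD[OF gl_action_ring_map] poly_module.span_zero)
    next
      case minor
      obtain C where C: "C \<in> E" "x = gl_action s G (generic_minor s {1..s} C) \<or>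
          x = - gl_action s G (generic_minor s {1..s} C)"
        using block_minor_cases[OF minor(2-5)] minor(1) by blast
      let ?g = "generic_minor s {1..s} C :: 'k polynomial"
      have g: "?g \<in> minors" using C(1) by (auto simp: minors_eq)
      then have gc: "?g \<in> carrier (mat_ring s n)" using minors_closed by blast
      have "?F (gl_action s G ?g) = ?g" using retract_id[OF gl_action_closed[OF gc]] HG[OF gc] by simp
      then show ?thesis
        using C(2) poly_module.span_base[OF g] poly_module.span_neg[OF poly_module.span_base[OF g]]
        by (auto simp: ring_mapD(5)[OF F])
    qed
  qed
  then have "?F (gl_action s G p) \<in> gen_ideal minors" by (rule gen_ideal_image[OF F _ Gp])
  then show ?thesis
    using p retract_id[OF gl_action_closed[OF p]] HG[OF p] by (simp add: I_eq)
qed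

lemma I_multigraded: "multigraded_ideal s n I"
  unfolding multigraded_ideal_def
proof (intro conjI I_ideal ballI allI)
  fix p a assume p: "p \<in> I"
  have "\<exists>b. homog b g" if gm: "g \<in> minors" for g
  proof -
    obtain C where C: "C \<in> E" "g = generic_minor s {1..s} C" using gm minors_eq by blast
    have "g \<in> carrier (mat_ring s n)" using gm minors_closed by blast
    then have "g = gl_action s H (block_minor s (\<lambda>_. 0) q (sorted_list_of_set C))"
      using G_minor[OF C(1)] HG C(2) by metis
    then show ?thesis
      using homog_gl_action homog_block_minor[of "sorted_list_of_set C" s] edge[OF C(1)] by fastforce
  qed
  then have "hom_component a p \<in> gen_ideal minors"
    using p by (intro hom_component_gen_ideal) (auto simp: I_eq)
  moreover have "hom_component a p \<in> carrier (mat_ring s n)"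
    using p by (auto simp: I_eq mat_ring_def keys_hom_component)
  ultimately show "hom_component a p \<in> I" by (simp add: I_eq)
qed

text \<open>The standard monomials in the new coordinates, transported back by \<open>H\<close>, are
  a basis of a complement: \<open>std_indep\<close> gives independence and \<open>std_spans\<close>
  generation.\<close>

lemma dim_graded_piece_I:
  "poly_vs.dim (graded_piece I a) + card (std_set s Bs (\<lambda>_. 0) a) = card (degree_monomials s n a)"
proof (rule dim_complement[where e = "\<lambda>t. gl_action s H (mono_poly t)"])
  let ?D = "std_set s Bs (\<lambda>_. 0) a" and ?M = "degree_monomials s n a"
  note DM = std_set_degree_monomials[OF V, of s a]
  have comb: "(\<Sum>t\<in>?D. poly_scale (c t) (gl_action s H (mono_poly t))) =
      gl_action s H (\<Sum>t\<in>?D. const_poly (c t) * mono_poly t)" for c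
    by (simp add: poly_scale_def ring_map_sum[OF gl_action_ring_map] ring_mapD[OF gl_action_ring_map])
  show "poly_vs.subspace (graded_piece I a)" by (rule subspace_graded_piece[OF I_ideal])
  show "graded_piece I a \<subseteq> poly_vs.span (mono_poly ` ?M)" by (rule graded_piece_span[OF I_ideal])
  show "gl_action s H (mono_poly t) \<in> poly_vs.span (mono_poly ` ?M)" if "t \<in> ?D" for t
  proof -
    have "t \<in> ?M" using that DM by blast
    then have "mono_poly t \<in> carrier (mat_ring s n)" "homog a (mono_poly t :: 'k polynomial)"
      by (auto simp: degree_monomials_def mono_poly_closed)
    then show ?thesis
      unfolding span_mono_poly_iff keys_degree_monomials by (intro conjI gl_action_closed homog_gl_action)
  qed
  show "c t = 0" if c: "(\<Sum>t\<in>?D. poly_scale (c t) (gl_action s H (mono_poly t))) \<in> graded_piece I a"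
    and t: "t \<in> ?D" for c :: "monomial \<Rightarrow> 'k" and t
  proof -
    let ?d = "\<Sum>t\<in>?D. const_poly (c t) * mono_poly t :: 'k polynomial"
    have ld: "lookup ?d u = (if u \<in> ?D then c u else 0)" for u
      by (rule lookup_sum_const_mono[OF finite_std_set])
    have kd: "keys ?d \<subseteq> ?D" unfolding subset_iff in_keys_iff ld by auto
    have dc: "?d \<in> carrier (mat_ring s n)"
      using subset_trans[OF kd DM] unfolding keys_degree_monomials by simp
    have "gl_action s H ?d \<in> I" using c unfolding comb by (simp add: graded_piece_def)
    then have "?d \<in> I'" using G_I[of "gl_action s H ?d"] GH[OF dc] by simp
    then have "?d = 0" using std_indep[OF inf s blocks gp] kd unfolding std_indep_def by blast
    then show "c t = 0" using ld[of t] t by simp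
  qed
  fix p :: "'k polynomial" assume "p \<in> poly_vs.span (mono_poly ` ?M)"
  then have pM: "keys p \<subseteq> ?M" by (simp add: span_mono_poly_iff)
  then have pc: "p \<in> carrier (mat_ring s n)" and pa: "homog a p" by (simp_all add: keys_degree_monomials)
  have "\<exists>d. keys d \<subseteq> ?D \<and> p - gl_action s H d \<in> graded_piece I a"
  \<comment> \<open>\<open>std_spans\<close> speaks only of degrees in the columns of the blocks; in
    any other degree the matrix ring has no monomials.\<close>
  proof (cases "keys a \<subseteq> {1..n}")
    case True
    obtain d where d: "keys d \<subseteq> ?D" "gl_action s G p - d \<in> I'"
      using std_spans[OF blocks s gp] True homog_gl_action[OF pa] unfolding std_spans_def V by blast
    have dM: "d \<in> carrier (mat_ring s n)" "homog a d"
      using subset_trans[OF d(1) DM] by (simp_all add: keys_degree_monomials)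
    let ?p = "p - gl_action s H d"
    have cl: "?p \<in> carrier (mat_ring s n)"
      using mat_ring_add_closed[OF pc mat_ring_uminus_closed[OF gl_action_closed[OF dM(1)]]] by simp
    have "gl_action s G ?p = gl_action s G p - d"
      using GH[OF dM(1)] by (simp add: ring_mapD[OF gl_action_ring_map])
    then have "?p \<in> I" using d(2) by (intro I_if_G[OF cl]) simp
    moreover have "homog a ?p" using pa homog_gl_action[OF dM(2)] by (rule homog_diff)
    ultimately show ?thesis using d(1) by (auto simp: graded_piece_eq)
  next
    case False
    have "keys a \<subseteq> {1..n}" if "t \<in> ?M" for t
    proof -
      have a: "a = mdeg t" and t: "keys t \<subseteq> {1..s} \<times> {1..n}"
        using that by (auto simp only: degree_monomials_def monomials_def)
      show ?thesis unfolding a keys_mdeg using t by auto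
    qed
    then have "?M = {}" using False by blast
    then have "p = 0" using pM by simp
    then show ?thesis
      using mat_ring_idealD(2)[OF I_ideal]
      by (intro exI[of _ 0]) (simp add: graded_piece_eq ring_mapD[OF gl_action_ring_map])
  qed
  then obtain d where d: "keys d \<subseteq> ?D" "p - gl_action s H d \<in> graded_piece I a" by blast
  have "(\<Sum>t\<in>?D. poly_scale (lookup d t) (gl_action s H (mono_poly t))) = gl_action s H d"
    unfolding comb sum_const_mono[OF finite_std_set d(1)] ..
  then show "\<exists>c. p - (\<Sum>t\<in>?D. poly_scale (c t) (gl_action s H (mono_poly t))) \<in> graded_piece I a"
    using d(2) by (intro exI[of _ "lookup d"]) simp
qed (rule finite_degree_monomials finite_std_set)+

lemma cartwright_sturmfels_I: "cartwright_sturmfels s n I"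
  unfolding cartwright_sturmfels_def
proof (intro conjI I_multigraded exI)
  show "monomial_ideal s n (nonstd_ideal s n Bs :: 'k polynomial set)" by (rule monomial_ideal_nonstd)
  show "radical_ideal s n (nonstd_ideal s n Bs :: 'k polynomial set)" by (rule radical_nonstd[OF blocks])
  show "borel_fixed s n (nonstd_ideal s n Bs :: 'k polynomial set)" by (rule borel_fixed_nonstd[OF blocks])
  show "hilbert_series (nonstd_ideal s n Bs :: 'k polynomial set) = hilbert_series I"
  proof
    fix a
    have "poly_vs.dim (graded_piece (nonstd_ideal s n Bs :: 'k polynomial set) a) =
        poly_vs.dim (graded_piece I a)"
      using dim_graded_piece_nonstd[OF blocks V, of s a, where 'k = 'k] dim_graded_piece_I[of a] by linarith
    then show "hilbert_series (nonstd_ideal s n Bs :: 'k polynomial set) a = hilbert_series I a"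
      by (simp add: hilbert_series_def)
  qed
qed

end

theorem proposition5p2:
  fixes s n :: nat and E :: "nat set set"
  assumes "infinite (UNIV :: 'k::field set)"
    and "s \<ge> 2" and "n \<ge> 1"
    and "complete_hypergraph_forest s {1..n} E"
  shows "cartwright_sturmfels s n (hypergraph_ideal s s n E :: 'k polynomial set)"
proof -
  obtain Bs where Bs: "forest_blocks Bs" "\<Union>(set Bs) = {1..n}" "E = (\<Union>B\<in>set Bs. [B]\<^bsup>s\<^esup>)"
    using complete_hypergraph_forest_blocks[OF assms(4)] by blast
  obtain q :: "'k frame" where q: "gen_pos s Bs (\<lambda>_. 0) q"
    "\<And>j. j \<in> {1..n} \<Longrightarrow> vdet (map (q j) [1..<Suc s]) \<noteq> 0"
    using ex_gen_pos[OF assms(1) Bs(1), of "{1..n}"] by blast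
  interpret forest_coordinates s n Bs E q
    by unfold_locales (use assms Bs q in auto)
  show ?thesis by (rule cartwright_sturmfels_I)
qed

end
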